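(* Let $\tilde h$ be a hybrid regulation function, let $\mathcal Q=\{B_{\mathrm d}(\xi_j,\delta\tilde h(\xi_j))\}_{j\in J}$ be a structured admissible covering of $\mathbb{R}^d\setminus\{0\}$, and let $\{\phi_j\}_{j\in J}\subset\mathcal S(\mathbb{R}^d)$ be the associated square-root system (see context). Let $J=J_1\cup J_2$ be indexed by $\mathbb{Z}$ as described in the context. Then for every tempered distribution $f\in\mathcal S'(\mathbb{R}^d)$, $$f=\sum_{j\in J_1}\check\phi_j^2*f+\sum_{j\in J_2}\check\phi_j^2*f ,$$ with convergence of the series in $\mathcal S'/\mathcal P$. More precisely, there exist a constant $p$ depending only on the order of the distribution $\hat f$ (for fixed $\tilde h$, $\mathcal{Q}$, $\{\phi_j\}$), a sequence of polynomials $\{P_k\}_{k=1}^\infty\subset\mathcal P$ with $\deg P_k\le p$, and $P\in\mathcal P$, such that $$f=\lim_{k,K\to\infty}\Big(\sum_{j=-k}^{K}\check\phi_j^2*f+P_k\Big)+P ,$$ with convergence in $\mathcal S'(\mathbb{R}^d)$.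
   Context: Fourier transform: $\hat f(\xi)=\mathcal F f(\xi)=(2\pi)^{-d/2}\int f(x)e^{-ix\cdot\xi}\,dx$, extended to $\mathcal S'$. $\mathcal P$ is the space of polynomials on $\mathbb{R}^d$. The notation $\check\phi_j^2*f$ means $\mathcal F^{-1}(\phi_j^2\hat f)$. Anisotropy: $\vec a=(a_1,\dots,a_d)$ is fixed with $a_i>0$, $\sum_i a_i=d$; $D_{\vec a}(t)=\mathrm{diag}(t^{a_1},\dots,t^{a_d})$ for $t>0$; $|0|_{\vec a}=0$ and for $\xi\ne0$, $|\xi|_{\vec a}$ is the unique $t>0$ with $|D_{\vec a}(1/t)\xi|=1$ ($|\cdot|$ Euclidean norm). $\kappa\ge1$ is a constant with $|\xi+\zeta|_{\vec a}\le\kappa(|\xi|_{\vec a}+|\zeta|_{\vec a})$. Quasi-distance $\mathrm d(\xi,\zeta)=|\xi-\zeta|_{\vec a}$, balls $B_{\mathrm d}(\xi,r)=\{\zeta:\mathrm d(\xi,\zeta)<r\}$. A function $h:\mathbb{R}^d\setminus\{0\}\to(0,\infty)$ is $\mathrm d$-moderate if there are constants $R,\delta_0>0$ such that for all $\xi,\zeta\in\mathbb{R}^d\setminus\{0\}$, $\mathrm d(\xi,\zeta)\le\delta_0h(\xi)$ implies $R^{-1}\le h(\xi)/h(\zeta)\le R$. Hybrid regulation function: $\tilde h=\rho h_1+(1-\rho)h_2:\mathbb{R}^d\setminus\{0\}\to(0,\infty)$, where $\rho$ is a $C^s$ ramp function ($s\ge1$) with values in $[0,1]$, $\rho(\xi)=1$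 for $0<|\xi|_{\vec a}\le 2/3$ and $\rho(\xi)=0$ for $|\xi|_{\vec a}\ge 4/3$; $h_1,h_2$ are $\mathrm d$-moderate; $c_0|\xi|_{\vec a}^r\le h_1(\xi)\le c_1|\xi|_{\vec a}$ for $0<|\xi|_{\vec a}\le4/3$ with some $c_0,c_1>0$, $r\ge1$; and $c_2\le h_2(\xi)\le c_3|\xi|_{\vec a}$ for $|\xi|_{\vec a}\ge2/3$ with some $c_2,c_3>0$. $\tilde h$ is $\mathrm d$-moderate; let $\delta_0$ be its constant and $0<\delta<\delta_0$. An admissible covering of $\mathbb{R}^d\setminus\{0\}$ is a family $\{Q_j\}_{j\in J}$ of measurable subsets of $\mathbb{R}^d\setminus\{0\}$ with union $\mathbb{R}^d\setminus\{0\}$ and $\sup_j\#\{i:Q_i\cap Q_j\ne\emptyset\}<\infty$. A structured admissible covering: $J$ countable, $T_j=A_j\cdot+b_j$ ($j\in J$) invertible affine maps, $P\subset Q\subset\mathbb{R}^d\setminus\{0\}$ bounded open with $P$ compactly contained in $Q$, such that $\{T_jP\}_{j}$ and $\{Q_j\}_j:=\{T_jQ\}_{j}$ are admissible coverings of $\mathbb{R}^d\setminus\{0\}$, and a constant $K_0$ such that $T_jQ\cap T_kQ\ne\emptyset$ implies $\|A_k^{-1}A_j\|_{\ell_\infty}\le K_0$ (maximum of absolute values of entries). Here $Q_j=B_{\mathrm d}(\xi_j,\delta\tilde h(\xi_j))$ and $A_j=D_{\vec a}(\delta\tilde h(\xi_j))$. Square-root system: fix a non-negative $\Phi\in C^\infty(\mathbb{R}^d)$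 with $\Phi=1$ on $P$, $\mathrm{supp}\,\Phi\subset Q$; set $g_j(\xi)=\Phi(T_j^{-1}\xi)$ and $\phi_j=g_j/\sqrt{\sum_{k\in J}g_k^2}$. Then $\mathrm{supp}\,\phi_j\subset Q_j$, $\sum_j\phi_j^2=1$ on $\mathbb{R}^d\setminus\{0\}$, and $\sup_j|Q_j|^{1/p-1}\|\mathcal F^{-1}\phi_j\|_{L_p}<\infty$ for all $p\in(0,1]$. Ordering of $J$: let $\delta_*>0$ be at most the minimum of the $\mathrm d$-moderateness constants of $h_1$ and $h_2$ with $\delta_*c_1<1$, and fix $0<C<\frac{2/3}{\kappa(1+c_1\delta_* )}$. Let $J_2=\{j\in J: B_{\mathrm d}(\xi_j,\delta\tilde h(\xi_j))\cap B_{\mathrm d}(0,C)=\emptyset\}$ and $J_1=J\setminus J_2$. Identify $J$ with $\mathbb{Z}$ so that $J_1$ corresponds to the negative integers and $J_2$ to the non-negative integers. *)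

theory Defs
  imports "HOL-Analysis.Analysis"
begin

section \<open>Smoothness\<close>

definition partial :: "'n::finite \<Rightarrow> (real^'n \<Rightarrow> 'b::real_normed_vector) \<Rightarrow> real^'n \<Rightarrow> 'b" where
  "partial i f x = frechet_derivative f (at x) (axis i 1)"

text \<open>A derivative \<open>\<partial>\<^sup>\<alpha>\<close> is given by a list of coordinates in which \<open>i\<close> occurs \<open>\<alpha>\<^sub>i\<close> times;
  the length of the list is the order of the derivative. By the symmetry of
  partial derivatives the order of the list is irrelevant for smooth functions.\<close>

definition partials :: "'n::finite list \<Rightarrow> (real^'n \<Rightarrow> 'b::real_normed_vector) \<Rightarrow> real^'n \<Rightarrow> 'b" where
  "partials is f = foldr partial is f"

definition C_k_on :: "nat \<Rightarrow> (real^'n::finite) set \<Rightarrow> (real^'n \<Rightarrow> 'b::real_normed_vector) \<Rightarrow> bool" where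
  "C_k_on k S f \<longleftrightarrow>
     (\<forall>is. length is < k \<longrightarrow> (\<forall>x\<in>S. partials is f differentiable (at x))) \<and>
     (\<forall>is. length is \<le> k \<longrightarrow> continuous_on S (partials is f))"

definition smooth :: "(real^'n::finite \<Rightarrow> 'b::real_normed_vector) \<Rightarrow> bool" where
  "smooth f \<longleftrightarrow> (\<forall>k. C_k_on k UNIV f)"

definition supp :: "(real^'n::finite \<Rightarrow> 'b::real_normed_vector) \<Rightarrow> (real^'n) set" where
  "supp f = closure {x. f x \<noteq> 0}"


section \<open>Schwartz functions and tempered distributions\<close>

definition schwartz_seminorm :: "nat \<Rightarrow> nat \<Rightarrow> (real^'n::finite \<Rightarrow> complex) \<Rightarrow> real" where
  "schwartz_seminorm N m \<psi> =
     (SUP (is, x) \<in> {is. length is \<le> m} \<times> UNIV. (1 + norm x) ^ N * norm (partials is \<psi> x))"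

definition schwartz :: "(real^'n::finite \<Rightarrow> complex) set" where
  "schwartz = {\<psi>. smooth \<psi> \<and>
     (\<forall>N is. bounded (range (\<lambda>x. (1 + norm x) ^ N *\<^sub>R partials is \<psi> x)))}"

text \<open>Distributions are functionals on \<^const>\<open>schwartz\<close>; they are extensional (\<^const>\<open>undefined\<close>
  on all other functions), so that equality of distributions is equality in HOL.\<close>

definition tempered :: "((real^'n::finite \<Rightarrow> complex) \<Rightarrow> complex) set" where
  "tempered = {u \<in> extensional schwartz.
     (\<forall>\<psi>\<in>schwartz. \<forall>\<theta>\<in>schwartz. u (\<lambda>x. \<psi> x + \<theta> x) = u \<psi> + u \<theta>) \<and>
     (\<forall>c. \<forall>\<psi>\<in>schwartz. u (\<lambda>x. c * \<psi> x) = c * u \<psi>) \<and>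
     (\<exists>N C. \<forall>\<psi>\<in>schwartz. norm (u \<psi>) \<le> C * schwartz_seminorm N N \<psi>)}"

text \<open>The weak-* topology, i.e. pointwise convergence on \<^const>\<open>schwartz\<close>.\<close>

definition tempered_topology :: "((real^'n::finite \<Rightarrow> complex) \<Rightarrow> complex) topology" where
  "tempered_topology = subtopology (product_topology (\<lambda>_. euclidean) schwartz) tempered"

definition dist_add ::
  "((real^'n::finite \<Rightarrow> complex) \<Rightarrow> complex) \<Rightarrow> ((real^'n \<Rightarrow> complex) \<Rightarrow> complex) \<Rightarrow>
   (real^'n \<Rightarrow> complex) \<Rightarrow> complex" (infixl "\<oplus>\<^sub>D" 65) where
  "u \<oplus>\<^sub>D v = (\<lambda>\<psi>\<in>schwartz. u \<psi> + v \<psi>)"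

definition dist_sum ::
  "('i \<Rightarrow> (real^'n::finite \<Rightarrow> complex) \<Rightarrow> complex) \<Rightarrow> 'i set \<Rightarrow> (real^'n \<Rightarrow> complex) \<Rightarrow> complex" where
  "dist_sum u I = (\<lambda>\<psi>\<in>schwartz. \<Sum>i\<in>I. u i \<psi>)"

definition dist_mult ::
  "(real^'n::finite \<Rightarrow> real) \<Rightarrow> ((real^'n \<Rightarrow> complex) \<Rightarrow> complex) \<Rightarrow> (real^'n \<Rightarrow> complex) \<Rightarrow> complex" where
  "dist_mult m u = (\<lambda>\<psi>\<in>schwartz. u (\<lambda>x. of_real (m x) * \<psi> x))"

definition dist_of_fun :: "(real^'n::finite \<Rightarrow> complex) \<Rightarrow> (real^'n \<Rightarrow> complex) \<Rightarrow> complex" where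
  "dist_of_fun g = (\<lambda>\<psi>\<in>schwartz. LINT x|lborel. g x * \<psi> x)"

text \<open>The order of a distribution in the usual sense: the least \<open>m\<close> such that, on test functions
  supported in any given compact set, the distribution is bounded by the sup norms of the
  derivatives of order at most \<open>m\<close>. It exists for every tempered distribution.\<close>

definition order_at_most :: "((real^'n::finite \<Rightarrow> complex) \<Rightarrow> complex) \<Rightarrow> nat \<Rightarrow> bool" where
  "order_at_most u m \<longleftrightarrow>
     (\<forall>K. compact K \<longrightarrow> (\<exists>C. \<forall>\<psi>. smooth \<psi> \<and> supp \<psi> \<subseteq> K \<longrightarrow> norm (u \<psi>) \<le> C * schwartz_seminorm 0 m \<psi>))"

definition dist_order :: "((real^'n::finite \<Rightarrow> complex) \<Rightarrow> complex) \<Rightarrow> nat" where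
  "dist_order u = (LEAST m. order_at_most u m)"


section \<open>Fourier transform\<close>

definition fourier :: "(real^'n::finite \<Rightarrow> complex) \<Rightarrow> real^'n \<Rightarrow> complex" where
  "fourier \<psi> \<xi> = of_real ((2 * pi) powr (- real CARD('n) / 2)) *
     (LINT x|lborel. \<psi> x * exp (- \<i> * of_real (x \<bullet> \<xi>)))"

definition inv_fourier :: "(real^'n::finite \<Rightarrow> complex) \<Rightarrow> real^'n \<Rightarrow> complex" where
  "inv_fourier \<psi> x = of_real ((2 * pi) powr (- real CARD('n) / 2)) *
     (LINT \<xi>|lborel. \<psi> \<xi> * exp (\<i> * of_real (x \<bullet> \<xi>)))"

definition dist_fourier ::
  "((real^'n::finite \<Rightarrow> complex) \<Rightarrow> complex) \<Rightarrow> (real^'n \<Rightarrow> complex) \<Rightarrow> complex" where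
  "dist_fourier u = (\<lambda>\<psi>\<in>schwartz. u (fourier \<psi>))"

definition dist_inv_fourier ::
  "((real^'n::finite \<Rightarrow> complex) \<Rightarrow> complex) \<Rightarrow> (real^'n \<Rightarrow> complex) \<Rightarrow> complex" where
  "dist_inv_fourier u = (\<lambda>\<psi>\<in>schwartz. u (inv_fourier \<psi>))"

definition fourier_multiplier ::
  "(real^'n::finite \<Rightarrow> real) \<Rightarrow> ((real^'n \<Rightarrow> complex) \<Rightarrow> complex) \<Rightarrow> (real^'n \<Rightarrow> complex) \<Rightarrow> complex" where
  "fourier_multiplier m f = dist_inv_fourier (dist_mult m (dist_fourier f))"


section \<open>Polynomials and tempered distributions modulo polynomials\<close>

text \<open>Polynomials are complex-valued \<^const>\<open>polynomial_function\<close>s on \<open>real^'n\<close>.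
  The following bounds the total degree.\<close>

definition poly_degree_le :: "nat \<Rightarrow> (real^'n::finite \<Rightarrow> complex) \<Rightarrow> bool" where
  "poly_degree_le p P \<longleftrightarrow>
     (\<exists>c. P = (\<lambda>x. \<Sum>\<alpha> | (\<Sum>i\<in>UNIV. \<alpha> i) \<le> p. c \<alpha> * of_real (\<Prod>i\<in>UNIV. (x $ i) ^ \<alpha> i)))"

definition quotient_topology :: "'a topology \<Rightarrow> ('a \<Rightarrow> 'b) \<Rightarrow> 'b topology" where
  "quotient_topology X q =
     topology (\<lambda>U. U \<subseteq> q ` topspace X \<and> openin X {x \<in> topspace X. q x \<in> U})"

lemma openin_quotient_topology:
  "openin (quotient_topology X q) U \<longleftrightarrow>
     U \<subseteq> q ` topspace X \<and> openin X {x \<in> topspace X. q x \<in> U}"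
proof -
  have "istopology (\<lambda>U. U \<subseteq> q ` topspace X \<and> openin X {x \<in> topspace X. q x \<in> U})"
    unfolding istopology_def
  proof (intro conjI allI impI)
    fix S T
    assume "S \<subseteq> q ` topspace X \<and> openin X {x \<in> topspace X. q x \<in> S}"
      and "T \<subseteq> q ` topspace X \<and> openin X {x \<in> topspace X. q x \<in> T}"
    moreover have "{x \<in> topspace X. q x \<in> S \<inter> T} =
        {x \<in> topspace X. q x \<in> S} \<inter> {x \<in> topspace X. q x \<in> T}" by auto
    ultimately show "S \<inter> T \<subseteq> q ` topspace X" "openin X {x \<in> topspace X. q x \<in> S \<inter> T}"
      by auto
  next
    fix \<K>
    assume *: "\<forall>K\<in>\<K>. K \<subseteq> q ` topspace X \<and> openin X {x \<in> topspace X. q x \<in> K}"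
    then show "\<Union>\<K> \<subseteq> q ` topspace X" by blast
    have "{x \<in> topspace X. q x \<in> \<Union>\<K>} = (\<Union>K\<in>\<K>. {x \<in> topspace X. q x \<in> K})" by auto
    then show "openin X {x \<in> topspace X. q x \<in> \<Union>\<K>}" using * by auto
  qed
  then show ?thesis
    by (simp add: quotient_topology_def topology_inverse')
qed

definition mod_poly ::
  "((real^'n::finite \<Rightarrow> complex) \<Rightarrow> complex) \<Rightarrow> ((real^'n \<Rightarrow> complex) \<Rightarrow> complex) set" where
  "mod_poly u = {u \<oplus>\<^sub>D dist_of_fun P | P. polynomial_function P}"

definition tempered_mod_poly_topology ::
  "((real^'n::finite \<Rightarrow> complex) \<Rightarrow> complex) set topology" where
  "tempered_mod_poly_topology = quotient_topology tempered_topology mod_poly"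


section \<open>Anisotropic geometry\<close>

definition dilation :: "real^'n::finite \<Rightarrow> real \<Rightarrow> real^'n^'n" where
  "dilation a t = (\<chi> i l. if i = l then t powr (a $ i) else 0)"

definition anorm :: "real^'n::finite \<Rightarrow> real^'n \<Rightarrow> real" where
  "anorm a \<xi> = (if \<xi> = 0 then 0 else (THE t. t > 0 \<and> norm (dilation a (1 / t) *v \<xi>) = 1))"

definition adist :: "real^'n::finite \<Rightarrow> real^'n \<Rightarrow> real^'n \<Rightarrow> real" where
  "adist a \<xi> \<zeta> = anorm a (\<xi> - \<zeta>)"

definition aball :: "real^'n::finite \<Rightarrow> real^'n \<Rightarrow> real \<Rightarrow> (real^'n) set" where
  "aball a \<xi> r = {\<zeta>. adist a \<xi> \<zeta> < r}"

text \<open>Functions on the punctured space are total functions whose value at \<open>0\<close> is never used.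
  The constant \<open>\<delta>\<^sub>0\<close> is a parameter because it is referred to later on.\<close>

definition moderate :: "real^'n::finite \<Rightarrow> real \<Rightarrow> (real^'n \<Rightarrow> real) \<Rightarrow> bool" where
  "moderate a \<delta>\<^sub>0 h \<longleftrightarrow> \<delta>\<^sub>0 > 0 \<and> (\<forall>\<xi>. \<xi> \<noteq> 0 \<longrightarrow> h \<xi> > 0) \<and>
     (\<exists>R>0. \<forall>\<xi> \<zeta>. \<xi> \<noteq> 0 \<and> \<zeta> \<noteq> 0 \<and> adist a \<xi> \<zeta> \<le> \<delta>\<^sub>0 * h \<xi> \<longrightarrow>
        inverse R \<le> h \<xi> / h \<zeta> \<and> h \<xi> / h \<zeta> \<le> R)"

definition ramp :: "real^'n::finite \<Rightarrow> (real^'n \<Rightarrow> real) \<Rightarrow> bool" where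
  "ramp a \<rho> \<longleftrightarrow> (\<exists>s\<ge>1. C_k_on s (- {0}) \<rho>) \<and>
     (\<forall>\<xi>. \<xi> \<noteq> 0 \<longrightarrow> 0 \<le> \<rho> \<xi> \<and> \<rho> \<xi> \<le> 1) \<and>
     (\<forall>\<xi>. 0 < anorm a \<xi> \<and> anorm a \<xi> \<le> 2/3 \<longrightarrow> \<rho> \<xi> = 1) \<and>
     (\<forall>\<xi>. anorm a \<xi> \<ge> 4/3 \<longrightarrow> \<rho> \<xi> = 0)"

text \<open>\<open>\<delta>\<^sub>1\<close>, \<open>\<delta>\<^sub>2\<close> are moderateness constants of \<open>h\<^sub>1\<close>, \<open>h\<^sub>2\<close>.\<close>

definition hybrid_regulation ::
  "real^'n::finite \<Rightarrow> (real^'n \<Rightarrow> real) \<Rightarrow> (real^'n \<Rightarrow> real) \<Rightarrow> (real^'n \<Rightarrow> real) \<Rightarrow>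
   real \<Rightarrow> real \<Rightarrow> real \<Rightarrow> (real^'n \<Rightarrow> real) \<Rightarrow> bool" where
  "hybrid_regulation a \<rho> h\<^sub>1 h\<^sub>2 \<delta>\<^sub>1 \<delta>\<^sub>2 c\<^sub>1 h \<longleftrightarrow>
     ramp a \<rho> \<and> moderate a \<delta>\<^sub>1 h\<^sub>1 \<and> moderate a \<delta>\<^sub>2 h\<^sub>2 \<and> c\<^sub>1 > 0 \<and>
     (\<exists>c\<^sub>0 r. c\<^sub>0 > 0 \<and> r \<ge> 1 \<and> (\<forall>\<xi>. 0 < anorm a \<xi> \<and> anorm a \<xi> \<le> 4/3 \<longrightarrow>
        c\<^sub>0 * anorm a \<xi> powr r \<le> h\<^sub>1 \<xi> \<and> h\<^sub>1 \<xi> \<le> c\<^sub>1 * anorm a \<xi>)) \<and>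
     (\<exists>c\<^sub>2 c\<^sub>3. c\<^sub>2 > 0 \<and> c\<^sub>3 > 0 \<and> (\<forall>\<xi>. anorm a \<xi> \<ge> 2/3 \<longrightarrow>
        c\<^sub>2 \<le> h\<^sub>2 \<xi> \<and> h\<^sub>2 \<xi> \<le> c\<^sub>3 * anorm a \<xi>)) \<and>
     (\<forall>\<xi>. \<xi> \<noteq> 0 \<longrightarrow> h \<xi> = \<rho> \<xi> * h\<^sub>1 \<xi> + (1 - \<rho> \<xi>) * h\<^sub>2 \<xi>)"


section \<open>Structured coverings and square-root systems\<close>

definition admissible_covering :: "'j set \<Rightarrow> ('j \<Rightarrow> (real^'n::finite) set) \<Rightarrow> bool" where
  "admissible_covering J Q \<longleftrightarrow>
     (\<forall>j\<in>J. Q j \<in> sets lebesgue \<and> Q j \<subseteq> - {0}) \<and> (\<Union>j\<in>J. Q j) = - {0} \<and>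
     (\<exists>N. \<forall>j\<in>J. finite {i\<in>J. Q i \<inter> Q j \<noteq> {}} \<and> card {i\<in>J. Q i \<inter> Q j \<noteq> {}} \<le> N)"

definition affine_map :: "real^'n^'n \<Rightarrow> real^'n \<Rightarrow> real^'n::finite \<Rightarrow> real^'n" where
  "affine_map M v x = M *v x + v"

definition max_entry_norm :: "real^'n^'n::finite \<Rightarrow> real" where
  "max_entry_norm M = Max (range (\<lambda>(i, l). \<bar>M $ i $ l\<bar>))"

definition structured_covering ::
  "'j set \<Rightarrow> ('j \<Rightarrow> real^'n^'n) \<Rightarrow> ('j \<Rightarrow> real^'n) \<Rightarrow> (real^'n::finite) set \<Rightarrow> (real^'n) set \<Rightarrow> bool" where
  "structured_covering J A b P Q \<longleftrightarrow>
     countable J \<and> (\<forall>j\<in>J. invertible (A j)) \<and>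
     open P \<and> bounded P \<and> open Q \<and> bounded Q \<and> Q \<subseteq> - {0} \<and>
     compact (closure P) \<and> closure P \<subseteq> Q \<and>
     admissible_covering J (\<lambda>j. affine_map (A j) (b j) ` P) \<and>
     admissible_covering J (\<lambda>j. affine_map (A j) (b j) ` Q) \<and>
     (\<exists>K\<^sub>0. \<forall>j\<in>J. \<forall>k\<in>J. affine_map (A j) (b j) ` Q \<inter> affine_map (A k) (b k) ` Q \<noteq> {} \<longrightarrow>
        max_entry_norm (matrix_inv (A k) ** A j) \<le> K\<^sub>0)"

definition pulled_bump ::
  "('j \<Rightarrow> real^'n^'n) \<Rightarrow> ('j \<Rightarrow> real^'n) \<Rightarrow> (real^'n::finite \<Rightarrow> real) \<Rightarrow> 'j \<Rightarrow> real^'n \<Rightarrow> real" where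
  "pulled_bump A b \<Phi> j \<xi> = \<Phi> (inv (affine_map (A j) (b j)) \<xi>)"

text \<open>For a structured covering and \<open>supp \<Phi> \<subseteq> Q\<close>, the sum is finite at each point; at \<open>0\<close> all
  terms vanish and the quotient is \<open>0\<close>.\<close>

definition sqrt_system ::
  "'j set \<Rightarrow> ('j \<Rightarrow> real^'n^'n) \<Rightarrow> ('j \<Rightarrow> real^'n) \<Rightarrow> (real^'n::finite \<Rightarrow> real) \<Rightarrow> 'j \<Rightarrow> real^'n \<Rightarrow> real" where
  "sqrt_system J A b \<Phi> j \<xi> =
     pulled_bump A b \<Phi> j \<xi> / sqrt (\<Sum>\<^sub>\<infinity>k\<in>J. (pulled_bump A b \<Phi> k \<xi>)\<^sup>2)"

definition low_indices ::
  "real^'n::finite \<Rightarrow> 'j set \<Rightarrow> ('j \<Rightarrow> (real^'n) set) \<Rightarrow> real \<Rightarrow> 'j set" where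
  "low_indices a J Q C = {j\<in>J. Q j \<inter> aball a 0 C \<noteq> {}}"

end

theory Submission
  imports Defs "HOL-Probability.Characteristic_Functions" "HOL-Probability.Sinc_Integral"
begin

text \<open>
  Let \<open>u\<close> be the Fourier transform of \<open>f\<close>, and let \<open>\<mu>\<^sub>I\<close> be the sum of the \<open>\<phi>\<^sub>j\<^sup>2\<close> over \<open>j \<in> I\<close>, so that the
  partial sums correspond to \<open>\<mu>\<^sub>I u\<close> with \<open>I\<close> finite. Away from the origin the radii of the balls are
  bounded from below, the derivatives of \<open>\<mu>\<^sub>I\<close> are bounded uniformly in \<open>I\<close>, and the high frequency
  part converges when tested against any Schwartz function. Near the origin the derivatives of order at
  most \<open>m\<close> of \<open>\<mu>\<^sub>I\<close> grow at most like the distance to the power \<open>- M m\<close>, where \<open>M\<close> depends only on \<open>a\<close>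
  and the regulation function. As \<open>u\<close> has some order \<open>m\<close>, the low frequency sums converge on test functions
  that vanish to order \<open>m + M m + 1\<close> at \<open>0\<close>. Removing the Taylor polynomial at \<open>0\<close> from a test
  function amounts, after inverse Fourier transformation, to adding a polynomial of degree at most
  \<open>m + M m\<close> to the partial sum. Since \<open>\<mu>\<^sub>J = 1\<close> off the origin, the limit differs from \<open>f\<close> by a
  polynomial of the same kind. Taylor polynomials are only needed for inverse Fourier transforms, where
  the remainder is given by the remainder of the exponential series under the integral.
\<close>

section \<open>Calculus of iterated partial derivatives\<close>

lemma partials_Nil [simp]: "partials [] f = f"
  by (simp add: partials_def)

lemma partials_Cons: "partials (i # is) f = partial i (partials is f)"
  by (simp add: partials_def)

lemma partials_snoc: "partials (is @ [i]) f = partials is (partial i f)"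
  by (simp add: partials_def)

lemma partial_eqI: "(f has_derivative f') (at x) \<Longrightarrow> partial i f x = f' (axis i 1)"
  unfolding partial_def by (metis frechet_derivative_at)

lemma has_derivative_cong_open:
  assumes "open U" "x \<in> U" "\<And>y. y \<in> U \<Longrightarrow> f y = g y"
  shows "(f has_derivative D) (at x) \<longleftrightarrow> (g has_derivative D) (at x)"
  using has_derivative_transform_within_open[of f D x UNIV U g]
    has_derivative_transform_within_open[of g D x UNIV U f] assms by auto

lemma partial_cong_open:
  assumes "open U" "x \<in> U" "\<And>y. y \<in> U \<Longrightarrow> f y = g y"
  shows "partial i f x = partial i g x"
  unfolding partial_def frechet_derivative_def
  by (simp add: has_derivative_cong_open[OF assms(1,2), of f g] assms(3))

lemma partials_cong_open:
  assumes "open U" "\<And>y. y \<in> U \<Longrightarrow> f y = g y" "x \<in> U"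
  shows "partials is f x = partials is g x"
  using assms(3)
proof (induction "is" arbitrary: x)
  case (Cons i "is")
  then show ?case unfolding partials_Cons by (intro partial_cong_open[OF assms(1)]) auto
qed (simp add: assms)

definition diff_upto :: "nat \<Rightarrow> (real^'n::finite) set \<Rightarrow> (real^'n \<Rightarrow> 'b::real_normed_vector) \<Rightarrow> bool" where
  "diff_upto n U f \<longleftrightarrow> (\<forall>is. length is < n \<longrightarrow> (\<forall>x\<in>U. partials is f differentiable (at x)))"

definition smooth_on :: "(real^'n::finite) set \<Rightarrow> (real^'n \<Rightarrow> 'b::real_normed_vector) \<Rightarrow> bool" where
  "smooth_on U f \<longleftrightarrow> (\<forall>n. diff_upto n U f)"

lemma diff_upto_0 [simp]: "diff_upto 0 U f"
  by (simp add: diff_upto_def)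

lemma diff_upto_Suc:
  "diff_upto (Suc n) U f \<longleftrightarrow> (\<forall>x\<in>U. f differentiable (at x)) \<and> (\<forall>i. diff_upto n U (partial i f))"
  (is "_ \<longleftrightarrow> ?R")
proof
  assume "diff_upto (Suc n) U f"
  then show ?R
    unfolding diff_upto_def by (metis Suc_less_eq length_append_singleton list.size(3)
        partials_Nil partials_snoc zero_less_Suc)
next
  assume R: ?R
  show "diff_upto (Suc n) U f"
    unfolding diff_upto_def
  proof (intro allI impI)
    fix "is" :: "'a list" assume "length is < Suc n"
    then show "\<forall>x\<in>U. partials is f differentiable (at x)"
      using R by (cases "is" rule: rev_cases) (auto simp: diff_upto_def partials_snoc)
  qed
qed

lemma diff_upto_mono: "diff_upto n U f \<Longrightarrow> m \<le> n \<Longrightarrow> V \<subseteq> U \<Longrightarrow> diff_upto m V f"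
  unfolding diff_upto_def by (meson order_less_le_trans subsetD)

lemma smooth_on_mono: "smooth_on U f \<Longrightarrow> V \<subseteq> U \<Longrightarrow> smooth_on V f"
  unfolding smooth_on_def using diff_upto_mono by blast

lemma smooth_onD: "smooth_on U f \<Longrightarrow> x \<in> U \<Longrightarrow> partials is f differentiable (at x)"
  unfolding smooth_on_def diff_upto_def by blast

lemma smooth_on_differentiable: "smooth_on U f \<Longrightarrow> x \<in> U \<Longrightarrow> f differentiable (at x)"
  using smooth_onD[of U f x "[]"] by simp

lemma smooth_on_isCont: "smooth_on U f \<Longrightarrow> x \<in> U \<Longrightarrow> isCont (partials is f) x"
  by (intro differentiable_imp_continuous_within smooth_onD)

lemma smooth_on_partial: "smooth_on U f \<Longrightarrow> smooth_on U (partial i f)"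
  unfolding smooth_on_def using diff_upto_Suc by blast

lemma smooth_on_partials: "smooth_on U f \<Longrightarrow> smooth_on U (partials is f)"
  by (induction "is") (auto simp: partials_Cons smooth_on_partial)

lemma smooth_iff_smooth_on: "smooth f \<longleftrightarrow> smooth_on UNIV f"
proof
  assume s: "smooth_on UNIV f"
  then have "continuous_on UNIV (partials is f)" for "is"
    by (simp add: continuous_on_eq_continuous_at smooth_on_isCont)
  then show "smooth f"
    using s by (auto simp: smooth_def C_k_on_def smooth_onD)
qed (auto simp: smooth_def C_k_on_def smooth_on_def diff_upto_def)

lemma diff_upto_cong:
  assumes "open U" "\<And>x. x \<in> U \<Longrightarrow> f x = g x" "diff_upto n U f"
  shows "diff_upto n U g"
  unfolding diff_upto_def
proof (intro allI impI ballI)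
  fix "is" :: "'a list" and x assume *: "length is < n" "x \<in> U"
  then have "partials is f differentiable (at x)"
    using assms(3) by (auto simp: diff_upto_def)
  then obtain D where "(partials is f has_derivative D) (at x)"
    by (auto simp: differentiable_def)
  then have "(partials is g has_derivative D) (at x)"
    by (rule has_derivative_transform_within_open[OF _ assms(1) *(2)])
      (rule partials_cong_open[OF assms(1,2)])
  then show "partials is g differentiable (at x)"
    by (auto simp: differentiable_def)
qed

lemma smooth_on_cong:
  "open U \<Longrightarrow> (\<And>x. x \<in> U \<Longrightarrow> f x = g x) \<Longrightarrow> smooth_on U f \<Longrightarrow> smooth_on U g"
  unfolding smooth_on_def using diff_upto_cong by blast

lemma smooth_on_Un: "smooth_on U f \<Longrightarrow> smooth_on V f \<Longrightarrow> smooth_on (U \<union> V) f"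
  unfolding smooth_on_def diff_upto_def by blast

lemma smooth_on_locally:
  assumes "\<And>x. x \<in> U \<Longrightarrow> \<exists>V. x \<in> V \<and> smooth_on V f"
  shows "smooth_on U f"
proof -
  have "partials is f differentiable (at x)" if "x \<in> U" for x "is"
    using assms[OF that] smooth_onD by auto
  then show ?thesis by (auto simp: smooth_on_def diff_upto_def)
qed

lemma partial_bounded_linear:
  assumes "bounded_linear T" "f differentiable (at x)"
  shows "partial i (\<lambda>x. T (f x)) x = T (partial i f x)"
proof -
  have "((\<lambda>x. T (f x)) has_derivative (\<lambda>h. T (frechet_derivative f (at x) h))) (at x)"
    by (rule bounded_linear.has_derivative[OF assms(1)])
      (use assms(2) in \<open>simp add: frechet_derivative_works\<close>)
  from partial_eqI[OF this] show ?thesis by (simp add: partial_def)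
qed

lemma partial_add:
  assumes "f differentiable (at x)" "g differentiable (at x)"
  shows "partial i (\<lambda>x. f x + g x) x = partial i f x + partial i g x"
proof -
  have "((\<lambda>x. f x + g x) has_derivative
      (\<lambda>h. frechet_derivative f (at x) h + frechet_derivative g (at x) h)) (at x)"
    using assms by (intro has_derivative_add) (auto simp: frechet_derivative_works)
  from partial_eqI[OF this] show ?thesis by (simp add: partial_def)
qed

lemma partial_mult:
  fixes f g :: "real^'n::finite \<Rightarrow> 'b::real_normed_algebra"
  assumes "f differentiable (at x)" "g differentiable (at x)"
  shows "partial i (\<lambda>x. f x * g x) x = partial i f x * g x + f x * partial i g x"
proof -
  have "((\<lambda>x. f x * g x) has_derivative
      (\<lambda>h. f x * frechet_derivative g (at x) h + frechet_derivative f (at x) h * g x)) (at x)"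
    using assms by (intro has_derivative_mult) (auto simp: frechet_derivative_works)
  from partial_eqI[OF this] show ?thesis by (simp add: partial_def)
qed

lemma partial_inverse:
  fixes f :: "real^'n::finite \<Rightarrow> 'b::real_normed_field"
  assumes "f differentiable (at x)" "f x \<noteq> 0"
  shows "partial i (\<lambda>x. inverse (f x)) x = - (inverse (f x) * inverse (f x) * partial i f x)"
proof -
  have "((\<lambda>x. inverse (f x)) has_derivative
      (\<lambda>h. - (inverse (f x) * frechet_derivative f (at x) h * inverse (f x)))) (at x)"
    using assms by (intro Deriv.has_derivative_inverse) (auto simp: frechet_derivative_works)
  from partial_eqI[OF this] show ?thesis by (simp add: partial_def)
qed

lemma diff_upto_bounded_linear:
  assumes "open U" "bounded_linear T"
  shows "diff_upto n U f \<Longrightarrow> diff_upto n U (\<lambda>x. T (f x))"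
proof (induction n arbitrary: f)
  case (Suc n)
  then have d: "f differentiable (at x)" if "x \<in> U" for x using that by (auto simp: diff_upto_Suc)
  have "diff_upto n U (partial i (\<lambda>x. T (f x)))" for i
    by (rule diff_upto_cong[OF assms(1), of "\<lambda>x. T (partial i f x)"])
      (use Suc d in \<open>auto simp: diff_upto_Suc partial_bounded_linear[OF assms(2)]\<close>)
  moreover have "(\<lambda>x. T (f x)) differentiable (at x)" if "x \<in> U" for x
    using bounded_linear.has_derivative[OF assms(2)] d[OF that] by (auto simp: differentiable_def)
  ultimately show ?case
    by (simp add: diff_upto_Suc)
qed simp

lemma partials_bounded_linear:
  assumes "open U" "bounded_linear T" "smooth_on U f" "x \<in> U"
  shows "partials is (\<lambda>x. T (f x)) x = T (partials is f x)"
  using assms(4)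
proof (induction "is" arbitrary: x)
  case (Cons i "is")
  have "partials (i # is) (\<lambda>x. T (f x)) x = partial i (\<lambda>x. T (partials is f x)) x"
    unfolding partials_Cons by (rule partial_cong_open[OF assms(1)]) (use Cons in auto)
  also have "\<dots> = T (partials (i # is) f x)"
    unfolding partials_Cons
    by (intro partial_bounded_linear assms(2) smooth_onD[OF assms(3)] Cons.prems)
  finally show ?case .
qed simp

lemma smooth_on_bounded_linear:
  "open U \<Longrightarrow> bounded_linear T \<Longrightarrow> smooth_on U f \<Longrightarrow> smooth_on U (\<lambda>x. T (f x))"
  unfolding smooth_on_def using diff_upto_bounded_linear by blast

lemma diff_upto_add:
  assumes "open U"
  shows "diff_upto n U f \<Longrightarrow> diff_upto n U g \<Longrightarrow> diff_upto n U (\<lambda>x. f x + g x)"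
proof (induction n arbitrary: f g)
  case (Suc n)
  then have d: "f differentiable (at x)" "g differentiable (at x)" if "x \<in> U" for x
    using that by (auto simp: diff_upto_Suc)
  have "diff_upto n U (partial i (\<lambda>x. f x + g x))" for i
    by (rule diff_upto_cong[OF assms(1), of "\<lambda>x. partial i f x + partial i g x"])
      (use Suc d in \<open>auto simp: diff_upto_Suc partial_add\<close>)
  then show ?case
    using d by (auto simp: diff_upto_Suc)
qed simp

lemma smooth_on_add:
  "open U \<Longrightarrow> smooth_on U f \<Longrightarrow> smooth_on U g \<Longrightarrow> smooth_on U (\<lambda>x. f x + g x)"
  unfolding smooth_on_def using diff_upto_add by blast

lemma partials_add:
  assumes "open U" "smooth_on U f" "smooth_on U g" "x \<in> U"
  shows "partials is (\<lambda>x. f x + g x) x = partials is f x + partials is g x"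
  using assms(4)
proof (induction "is" arbitrary: x)
  case (Cons i "is")
  have "partials (i # is) (\<lambda>x. f x + g x) x = partial i (\<lambda>x. partials is f x + partials is g x) x"
    unfolding partials_Cons by (rule partial_cong_open[OF assms(1)]) (use Cons in auto)
  also have "\<dots> = partials (i # is) f x + partials (i # is) g x"
    unfolding partials_Cons
    by (intro partial_add smooth_onD[OF assms(2)] smooth_onD[OF assms(3)] Cons.prems)
  finally show ?case .
qed simp

lemma diff_upto_mult:
  fixes f g :: "real^'n::finite \<Rightarrow> 'b::real_normed_algebra"
  assumes "open U"
  shows "diff_upto n U f \<Longrightarrow> diff_upto n U g \<Longrightarrow> diff_upto n U (\<lambda>x. f x * g x)"
proof (induction n arbitrary: f g)
  case (Suc n)
  then have d: "f differentiable (at x)" "g differentiable (at x)" if "x \<in> U" for x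
    using that by (auto simp: diff_upto_Suc)
  have "diff_upto n U f" "diff_upto n U g"
    using Suc.prems diff_upto_mono by (blast intro: le_SucI)+
  then have "diff_upto n U (\<lambda>x. partial i f x * g x + f x * partial i g x)" for i
    using Suc by (intro diff_upto_add[OF assms]) (auto simp: diff_upto_Suc)
  then have "diff_upto n U (partial i (\<lambda>x. f x * g x))" for i
    by (rule diff_upto_cong[OF assms, rotated]) (use d in \<open>simp add: partial_mult\<close>)
  then show ?case
    using d by (auto simp: diff_upto_Suc intro!: differentiable_mult)
qed simp

lemma smooth_on_mult:
  fixes f g :: "real^'n::finite \<Rightarrow> 'b::real_normed_algebra"
  shows "open U \<Longrightarrow> smooth_on U f \<Longrightarrow> smooth_on U g \<Longrightarrow> smooth_on U (\<lambda>x. f x * g x)"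
  unfolding smooth_on_def using diff_upto_mult by blast

lemma smooth_on_uminus: "open U \<Longrightarrow> smooth_on U f \<Longrightarrow> smooth_on U (\<lambda>x. - f x)"
  by (rule smooth_on_bounded_linear[of U uminus]) (auto intro: bounded_linear_minus[OF bounded_linear_ident])

lemma diff_upto_inverse:
  fixes f :: "real^'n::finite \<Rightarrow> 'b::real_normed_field"
  assumes "open U" "\<And>x. x \<in> U \<Longrightarrow> f x \<noteq> 0"
  shows "diff_upto n U f \<Longrightarrow> diff_upto n U (\<lambda>x. inverse (f x))"
proof (induction n)
  case (Suc n)
  then have d: "f differentiable (at x)" if "x \<in> U" for x
    using that by (auto simp: diff_upto_Suc)
  have "diff_upto n U f"
    using Suc.prems diff_upto_mono by (blast intro: le_SucI)+
  then have "diff_upto n U (\<lambda>x. inverse (f x) * inverse (f x) * partial i f x)" for i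
    using Suc by (intro diff_upto_mult[OF assms(1)]) (auto simp: diff_upto_Suc)
  then have "diff_upto n U (\<lambda>x. - (inverse (f x) * inverse (f x) * partial i f x))" for i
    by (rule diff_upto_bounded_linear[OF assms(1) bounded_linear_minus[OF bounded_linear_ident]])
  then have "diff_upto n U (partial i (\<lambda>x. inverse (f x)))" for i
    by (rule diff_upto_cong[OF assms(1), rotated]) (use d assms in \<open>simp add: partial_inverse\<close>)
  then show ?case
    using d assms by (auto simp: diff_upto_Suc intro!: differentiable_inverse)
qed simp

lemma smooth_on_inverse:
  fixes f :: "real^'n::finite \<Rightarrow> 'b::real_normed_field"
  shows "open U \<Longrightarrow> (\<And>x. x \<in> U \<Longrightarrow> f x \<noteq> 0) \<Longrightarrow> smooth_on U f \<Longrightarrow> smooth_on U (\<lambda>x. inverse (f x))"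
  unfolding smooth_on_def using diff_upto_inverse by blast

lemma partial_const [simp]: "partial i (\<lambda>x. c) = (\<lambda>x. 0)"
  using partial_eqI[OF has_derivative_const] by fastforce

lemma partials_const: "partials is (\<lambda>x. c) = (if is = [] then (\<lambda>x. c) else (\<lambda>x. 0))"
  by (induction "is") (auto simp: partials_Cons)

lemma diff_upto_const [simp]: "diff_upto n U (\<lambda>x. c)"
  by (auto simp: diff_upto_def partials_const)

lemma smooth_on_const [simp]: "smooth_on U (\<lambda>x. c)"
  by (simp add: smooth_on_def)

lemma smooth_on_sum:
  assumes "open U" "\<And>k. k \<in> F \<Longrightarrow> smooth_on U (f k)"
  shows "smooth_on U (\<lambda>x. \<Sum>k\<in>F. f k x)"
  using assms(2)
  by (induction F rule: infinite_finite_induct) (auto intro!: smooth_on_add assms(1))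

lemma smooth_on_coord [simp]: "smooth_on U (\<lambda>x::real^'n::finite. x $ k)"
proof -
  have d: "((\<lambda>x::real^'n. x $ k) has_derivative (\<lambda>h. h $ k)) (at x)" for x
    by (rule bounded_linear.has_derivative[OF bounded_linear_vec_nth has_derivative_ident])
  have "partial i (\<lambda>x::real^'n. x $ k) = (\<lambda>x. axis i 1 $ k)" for i
    using partial_eqI[OF d] by blast
  then have "diff_upto n U (\<lambda>x::real^'n. x $ k)" for n
    by (cases n) (use d in \<open>auto simp: diff_upto_Suc differentiable_def\<close>)
  then show ?thesis by (simp add: smooth_on_def)
qed

text \<open>Coordinatewise affine maps are the only changes of variables that occur: anisotropic
  dilations and reflections.\<close>

lemma has_derivative_diag_affine:
  fixes f :: "real^'n::finite \<Rightarrow> 'b::real_normed_vector" and s :: "'n \<Rightarrow> real" and c :: "real^'n"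
  defines "T \<equiv> \<lambda>x::real^'n. \<chi> i. s i * (x $ i - c $ i)"
  assumes "f differentiable (at (T x))"
  shows "((\<lambda>x. f (T x)) has_derivative
    (\<lambda>h. frechet_derivative f (at (T x)) (\<chi> i. s i * h $ i))) (at x)"
proof -
  have l: "bounded_linear (\<lambda>h::real^'n. \<chi> i. s i * h $ i)"
    by (intro linear_conv_bounded_linear[THEN iffD1] linearI) (auto simp: vec_eq_iff algebra_simps)
  have "T = (\<lambda>x. (\<chi> i. s i * x $ i) + (\<chi> i. - s i * c $ i))"
    by (auto simp: T_def fun_eq_iff vec_eq_iff algebra_simps)
  then have "(T has_derivative (\<lambda>h. \<chi> i. s i * h $ i)) (at x)"
    using bounded_linear_imp_has_derivative[OF l, of "at x"]
    by (simp add: has_derivative_add_const)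
  then show ?thesis
    using diff_chain_at[of T _ x f "frechet_derivative f (at (T x))"] assms(2)
    by (simp add: frechet_derivative_works o_def)
qed

lemma partial_diag_affine:
  fixes f :: "real^'n::finite \<Rightarrow> 'b::real_normed_vector"
  assumes "f differentiable (at (\<chi> i. s i * (x $ i - c $ i)))"
  shows "partial k (\<lambda>x. f (\<chi> i. s i * (x $ i - c $ i))) x
    = s k *\<^sub>R partial k f (\<chi> i. s i * (x $ i - c $ i))"
proof -
  have "(\<chi> i. s i * axis k 1 $ i) = s k *\<^sub>R (axis k 1 :: real^'n)"
    by (auto simp: vec_eq_iff axis_def)
  then show ?thesis
    using partial_eqI[OF has_derivative_diag_affine[OF assms], of k] assms
    by (simp add: partial_def linear_frechet_derivative linear_cmul)
qed

lemma
  fixes f :: "real^'n::finite \<Rightarrow> 'b::real_normed_vector"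
  assumes "smooth_on UNIV f"
  shows partials_diag_affine: "partials is (\<lambda>x. f (\<chi> i. s i * (x $ i - c $ i))) x
      = prod_list (map s is) *\<^sub>R partials is f (\<chi> i. s i * (x $ i - c $ i))"
    and smooth_on_diag_affine: "smooth_on UNIV (\<lambda>x. f (\<chi> i. s i * (x $ i - c $ i)))"
proof -
  let ?T = "\<lambda>x::real^'n. \<chi> i. s i * (x $ i - c $ i)"
  have d: "(\<lambda>x. partials is f (?T x)) differentiable (at x)" for "is" x
    using has_derivative_diag_affine[of "partials is f"] smooth_onD[OF assms]
    by (auto simp: differentiable_def)
  have eq: "partials is (\<lambda>x. f (?T x)) = (\<lambda>x. prod_list (map s is) *\<^sub>R partials is f (?T x))" for "is"
  proof (induction "is")
    case (Cons k "is")
    have "partial k (\<lambda>x. prod_list (map s is) *\<^sub>R partials is f (?T x)) x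
        = prod_list (map s is) *\<^sub>R partial k (\<lambda>x. partials is f (?T x)) x" for x
      by (rule partial_bounded_linear[OF bounded_linear_scaleR_right d])
    also have "\<dots> x = prod_list (map s (k # is)) *\<^sub>R partials (k # is) f (?T x)" for x
      using smooth_onD[OF assms]
      by (subst partial_diag_affine) (auto simp: partials_Cons)
    finally show ?case by (auto simp: partials_Cons Cons.IH)
  qed simp
  show "partials is (\<lambda>x. f (?T x)) x = prod_list (map s is) *\<^sub>R partials is f (?T x)" by (simp add: eq)
  show "smooth_on UNIV (\<lambda>x. f (?T x))"
    unfolding smooth_on_def diff_upto_def eq using d by (auto intro!: differentiable_scaleR)
qed

section \<open>Jet bounds at a point\<close>

definition jet :: "nat \<Rightarrow> real \<Rightarrow> real \<Rightarrow> (real^'n::finite \<Rightarrow> 'b::real_normed_vector) \<Rightarrow> real^'n \<Rightarrow> bool" where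
  "jet n C L f x \<longleftrightarrow> (\<forall>is. length is \<le> n \<longrightarrow> norm (partials is f x) \<le> C * L ^ length is)"

lemma jetD: "jet n C L f x \<Longrightarrow> length is \<le> n \<Longrightarrow> norm (partials is f x) \<le> C * L ^ length is"
  by (simp add: jet_def)

lemma jet_0 [simp]: "jet 0 C L f x \<longleftrightarrow> norm (f x) \<le> C"
  by (simp add: jet_def)

lemma jet_Suc: "jet (Suc n) C L f x \<longleftrightarrow> norm (f x) \<le> C \<and> (\<forall>i. jet n (C * L) L (partial i f) x)"
  (is "_ \<longleftrightarrow> ?R")
proof
  assume j: "jet (Suc n) C L f x"
  have "norm (partials is (partial i f) x) \<le> C * L * L ^ length is" if "length is \<le> n" for "is" i
    using jetD[OF j, of "is @ [i]"] that by (simp add: partials_snoc mult.assoc)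
  then show ?R using jetD[OF j, of "[]"] by (auto simp: jet_def)
next
  assume R: ?R
  show "jet (Suc n) C L f x"
    unfolding jet_def
  proof (intro allI impI)
    fix "is" :: "'a list" assume "length is \<le> Suc n"
    then show "norm (partials is f x) \<le> C * L ^ length is"
      using R by (cases "is" rule: rev_cases) (auto simp: jet_def partials_snoc mult.assoc)
  qed
qed

lemma jet_mono:
  assumes "jet n C L f x" "m \<le> n" "C \<le> C'" "L \<le> L'" "0 \<le> C" "0 \<le> L"
  shows "jet m C' L' f x"
  unfolding jet_def
proof (intro allI impI)
  fix "is" :: "'a list" assume "length is \<le> m"
  then have "norm (partials is f x) \<le> C * L ^ length is" using assms by (auto intro!: jetD[of n])
  also have "\<dots> \<le> C' * L' ^ length is"
    using assms by (intro mult_mono power_mono) auto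
  finally show "norm (partials is f x) \<le> C' * L' ^ length is" .
qed

lemma jet_cong_open:
  assumes "open U" "\<And>y. y \<in> U \<Longrightarrow> f y = g y" "x \<in> U"
  shows "jet n C L f x \<longleftrightarrow> jet n C L g x"
  unfolding jet_def using partials_cong_open[of U f g, OF assms] by simp

lemma jet_add:
  assumes "open U" "x \<in> U" "smooth_on U f" "smooth_on U g" "jet n C L f x" "jet n D L g x"
  shows "jet n (C + D) L (\<lambda>x. f x + g x) x"
  unfolding jet_def
proof (intro allI impI)
  fix "is" :: "'a list" assume "length is \<le> n"
  then show "norm (partials is (\<lambda>x. f x + g x) x) \<le> (C + D) * L ^ length is"
    unfolding partials_add[OF assms(1,3,4,2)]
    using jetD[OF assms(5)] jetD[OF assms(6)] norm_triangle_mono by (fastforce simp: algebra_simps)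
qed

lemma jet_zero: "0 \<le> C \<Longrightarrow> 0 \<le> L \<Longrightarrow> jet n C L (\<lambda>x. 0) x"
  by (simp add: jet_def partials_const)

lemma jet_sum:
  assumes "open U" "x \<in> U" "finite F" "\<And>k. k \<in> F \<Longrightarrow> smooth_on U (f k)"
    "\<And>k. k \<in> F \<Longrightarrow> jet n C L (f k) x" "0 \<le> L"
  shows "jet n (of_nat (card F) * C) L (\<lambda>x. \<Sum>k\<in>F. f k x) x"
  using assms(3-5)
proof (induction F rule: finite_induct)
  case (insert k F)
  then have "jet n (C + of_nat (card F) * C) L (\<lambda>x. f k x + (\<Sum>k\<in>F. f k x)) x"
    by (intro jet_add[OF assms(1,2)] smooth_on_sum assms(1)) auto
  then show ?case using insert by (simp add: algebra_simps)
qed (simp add: jet_zero assms(6))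

lemma jet_mult:
  fixes f g :: "real^'n::finite \<Rightarrow> 'b::real_normed_algebra"
  assumes "open U" "x \<in> U" "0 \<le> L"
  shows "smooth_on U f \<Longrightarrow> smooth_on U g \<Longrightarrow> jet n C L f x \<Longrightarrow> jet n D L g x \<Longrightarrow> 0 \<le> C \<Longrightarrow> 0 \<le> D
    \<Longrightarrow> jet n (2 ^ n * C * D) L (\<lambda>x. f x * g x) x"
proof (induction n arbitrary: f g C D)
  case 0
  then show ?case by (auto intro!: order_trans[OF norm_mult_ineq] mult_mono)
next
  case (Suc n)
  have n: "norm (f x) \<le> C" "norm (g x) \<le> D" using Suc.prems by (auto simp: jet_Suc)
  have "norm (f x * g x) \<le> C * D"
    using n Suc.prems by (auto intro!: order_trans[OF norm_mult_ineq] mult_mono)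
  also have "\<dots> \<le> 2 ^ Suc n * C * D"
    using Suc.prems mult_right_mono[of 1 "2 ^ Suc n" "C * D"]
    by (simp add: mult.assoc one_le_power del: power_Suc)
  finally have 1: "norm (f x * g x) \<le> 2 ^ Suc n * C * D" .
  have 2: "jet n (2 ^ Suc n * C * D * L) L (partial i (\<lambda>x. f x * g x)) x" for i
  proof -
    have "jet n (2 ^ n * (C * L) * D) L (\<lambda>x. partial i f x * g x) x"
      using Suc.prems assms
      by (intro Suc.IH smooth_on_partial) (auto simp: jet_Suc intro: jet_mono[of "Suc n" D L g])
    moreover have "jet n (2 ^ n * C * (D * L)) L (\<lambda>x. f x * partial i g x) x"
      using Suc.prems assms
      by (intro Suc.IH smooth_on_partial) (auto simp: jet_Suc intro: jet_mono[of "Suc n" C L f])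
    ultimately have "jet n (2 ^ n * (C * L) * D + 2 ^ n * C * (D * L)) L
        (\<lambda>x. partial i f x * g x + f x * partial i g x) x"
      using Suc.prems by (intro jet_add[OF assms(1,2)] smooth_on_mult assms smooth_on_partial)
    moreover have "partial i (\<lambda>x. f x * g x) y = partial i f y * g y + f y * partial i g y"
      if "y \<in> U" for y
      using Suc.prems that by (intro partial_mult smooth_on_differentiable[of U])
    ultimately show ?thesis
      by (subst jet_cong_open[OF assms(1) _ assms(2)]) (auto simp: algebra_simps)
  qed
  from 1 2 show ?case by (simp add: jet_Suc)
qed

lemma jet_bounded_linear:
  assumes "open U" "x \<in> U" "smooth_on U f" "bounded_linear T" "\<And>y. norm (T y) \<le> norm y" "jet n C L f x"
  shows "jet n C L (\<lambda>x. T (f x)) x"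
  using assms(6) order_trans[OF assms(5)] unfolding jet_def
  by (simp add: partials_bounded_linear[OF assms(1,4,3,2)])

lemma jet_uminus:
  assumes "open U" "x \<in> U" "smooth_on U f" "jet n C L f x"
  shows "jet n C L (\<lambda>x. - f x) x"
  by (rule jet_bounded_linear[OF assms(1-3) bounded_linear_minus[OF bounded_linear_ident]]) (use assms in auto)

lemma jet_inverse:
  fixes C :: real
  assumes "0 \<le> C"
  obtains D where "0 \<le> D"
    "\<And>(f :: real^'n::finite \<Rightarrow> 'b::real_normed_field) U L x. open U \<Longrightarrow> x \<in> U \<Longrightarrow> 0 \<le> L \<Longrightarrow>
      smooth_on U f \<Longrightarrow> \<forall>y\<in>U. 1 \<le> norm (f y) \<Longrightarrow> jet n C L f x \<Longrightarrow>
      jet n D L (\<lambda>x. inverse (f x)) x"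
proof -
  have "\<exists>D\<ge>0. \<forall>(f :: real^'n::finite \<Rightarrow> 'b::real_normed_field) U L x. open U \<longrightarrow> x \<in> U \<longrightarrow> 0 \<le> L \<longrightarrow>
      smooth_on U f \<longrightarrow> (\<forall>y\<in>U. 1 \<le> norm (f y)) \<longrightarrow> jet n C L f x \<longrightarrow> jet n D L (\<lambda>x. inverse (f x)) x"
  proof (induction n)
    case 0
    show ?case
      by (intro exI[of _ 1]) (auto simp: norm_inverse inverse_le_1_iff)
  next
    case (Suc n)
    then obtain D where D: "D \<ge> 0" "\<And>(f :: real^'n::finite \<Rightarrow> 'b) U L x. open U \<Longrightarrow> x \<in> U \<Longrightarrow> 0 \<le> L \<Longrightarrow>
      smooth_on U f \<Longrightarrow> (\<And>y. y \<in> U \<Longrightarrow> 1 \<le> norm (f y)) \<Longrightarrow> jet n C L f x \<Longrightarrow>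
      jet n D L (\<lambda>x. inverse (f x)) x" by metis
    define E where "E = 2 ^ n * (2 ^ n * D * D) * C"
    show ?case
    proof (intro exI[of _ "max 1 E"] conjI allI impI)
      fix f :: "real^'n \<Rightarrow> 'b" and U L x
      assume *: "open U" "x \<in> U" "0 \<le> L" "smooth_on U f" "\<forall>y\<in>U. 1 \<le> norm (f y)" "jet (Suc n) C L f x"
      have nz: "f y \<noteq> 0" if "y \<in> U" for y using *(5) that by fastforce
      have jn: "jet n D L (\<lambda>x. inverse (f x)) x"
        using * assms by (intro D(2)[of U]) (auto intro: jet_mono[of "Suc n" C L f])
      have si: "smooth_on U (\<lambda>x. inverse (f x))" by (intro smooth_on_inverse * nz)
      have "jet n (max 1 E * L) L (partial i (\<lambda>x. inverse (f x))) x" for i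
      proof -
        have "jet n (2 ^ n * (2 ^ n * D * D) * (C * L)) L
            (\<lambda>x. inverse (f x) * inverse (f x) * partial i f x) x"
          using * jn D(1) assms
          by (intro jet_mult[OF *(1,2)] smooth_on_partial smooth_on_mult si) (auto simp: jet_Suc)
        then have "jet n (E * L) L (\<lambda>x. - (inverse (f x) * inverse (f x) * partial i f x)) x"
          using * by (intro jet_uminus[OF *(1,2)] smooth_on_mult si smooth_on_partial)
            (auto simp: E_def mult.assoc)
        then have "jet n (max 1 E * L) L (\<lambda>x. - (inverse (f x) * inverse (f x) * partial i f x)) x"
          by (rule jet_mono) (use D(1) assms *(3) in \<open>auto intro!: mult_right_mono simp: E_def\<close>)
        then show ?thesis
          by (subst jet_cong_open[OF *(1) _ *(2)])
            (auto intro!: partial_inverse smooth_on_differentiable[OF *(4)] nz)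
      qed
      moreover have "norm (inverse (f x)) \<le> 1"
        using * by (simp add: norm_inverse inverse_le_1_iff)
      ultimately show "jet (Suc n) (max 1 E) L (\<lambda>x. inverse (f x)) x"
        by (auto simp: jet_Suc le_max_iff_disj)
    qed auto
  qed
  then show ?thesis using that by metis
qed

section \<open>Schwartz functions\<close>

lemma schwartz_iff: "\<psi> \<in> schwartz \<longleftrightarrow>
    smooth_on UNIV \<psi> \<and> (\<forall>N is. \<exists>B. \<forall>x. (1 + norm x) ^ N * norm (partials is \<psi> x) \<le> B)"
  by (auto simp: schwartz_def smooth_iff_smooth_on bounded_iff)

lemma schwartz_smooth_on [intro]: "\<psi> \<in> schwartz \<Longrightarrow> smooth_on UNIV \<psi>"
  by (simp add: schwartz_iff)

lemma finite_lists_le: "finite {is :: 'n::finite list. length is \<le> m}"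
  using finite_lists_length_le[of "UNIV :: 'n set" m] by simp

lemma bdd_above_schwartz_seminorm:
  assumes "\<And>is. length is \<le> m \<Longrightarrow> \<exists>B. \<forall>x. (1 + norm x) ^ N * norm (partials is \<psi> x) \<le> B"
  shows "bdd_above ((\<lambda>(is, x). (1 + norm x) ^ N * norm (partials is \<psi> x)) ` ({is. length is \<le> m} \<times> UNIV))"
proof -
  obtain B where B: "\<And>is x. length is \<le> m \<Longrightarrow> (1 + norm x) ^ N * norm (partials is \<psi> x) \<le> B is"
    using assms by metis
  show ?thesis
  proof (rule bdd_aboveI2[where M = "Max (B ` {is. length is \<le> m})"], clarsimp)
    fix "is" :: "'a list" and x assume *: "length is \<le> m"
    from B[OF this, of x] show "(1 + norm x) ^ N * norm (partials is \<psi> x) \<le> Max (B ` {is. length is \<le> m})"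
      by (rule order_trans) (use * finite_lists_le in \<open>auto intro!: Max_ge\<close>)
  qed
qed

lemma schwartz_seminorm_upper:
  assumes "\<And>is. length is \<le> m \<Longrightarrow> \<exists>B. \<forall>x. (1 + norm x) ^ N * norm (partials is \<psi> x) \<le> B"
    and "length is \<le> m"
  shows "(1 + norm x) ^ N * norm (partials is \<psi> x) \<le> schwartz_seminorm N m \<psi>"
  unfolding schwartz_seminorm_def
  by (rule cSUP_upper2[OF bdd_above_schwartz_seminorm[OF assms(1)], of _ "(is, x)"]) (use assms in auto)

lemma schwartz_seminorm_ge:
  "\<psi> \<in> schwartz \<Longrightarrow> length is \<le> m \<Longrightarrow> (1 + norm x) ^ N * norm (partials is \<psi> x) \<le> schwartz_seminorm N m \<psi>"
  by (rule schwartz_seminorm_upper) (auto simp: schwartz_iff)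

lemma schwartz_seminorm_le:
  assumes "\<And>is x. length is \<le> m \<Longrightarrow> (1 + norm x) ^ N * norm (partials is \<psi> x) \<le> B"
  shows "schwartz_seminorm N m \<psi> \<le> B"
  unfolding schwartz_seminorm_def by (rule cSUP_least) (use assms in \<open>auto intro: exI[of _ "[]"]\<close>)

lemma schwartz_seminorm_nonneg: "\<psi> \<in> schwartz \<Longrightarrow> 0 \<le> schwartz_seminorm N m \<psi>"
  by (rule order_trans[OF _ schwartz_seminorm_ge[of \<psi> "[]" m 0 N]]) auto

lemma schwartz_seminorm_mono:
  assumes "\<psi> \<in> schwartz" "N \<le> N'" "m \<le> m'"
  shows "schwartz_seminorm N m \<psi> \<le> schwartz_seminorm N' m' \<psi>"
proof (rule schwartz_seminorm_le)
  fix "is" :: "'a list" and x assume "length is \<le> m"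
  have "(1 + norm x) ^ N * norm (partials is \<psi> x) \<le> (1 + norm x) ^ N' * norm (partials is \<psi> x)"
    using assms by (intro mult_right_mono power_increasing) auto
  also have "\<dots> \<le> schwartz_seminorm N' m' \<psi>"
    using assms \<open>length is \<le> m\<close> by (intro schwartz_seminorm_ge) auto
  finally show "(1 + norm x) ^ N * norm (partials is \<psi> x) \<le> schwartz_seminorm N' m' \<psi>" .
qed

lemma schwartz_add:
  assumes "\<psi> \<in> schwartz" "\<theta> \<in> schwartz" shows "(\<lambda>x. \<psi> x + \<theta> x) \<in> schwartz"
  unfolding schwartz_iff
proof (intro conjI allI)
  show "smooth_on UNIV (\<lambda>x. \<psi> x + \<theta> x)" using assms by (intro smooth_on_add) auto
  fix N and "is" :: "'a list"
  have "(1 + norm x) ^ N * norm (partials is (\<lambda>x. \<psi> x + \<theta> x) x)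
      \<le> schwartz_seminorm N (length is) \<psi> + schwartz_seminorm N (length is) \<theta>" for x
  proof -
    have "(1 + norm x) ^ N * norm (partials is (\<lambda>x. \<psi> x + \<theta> x) x)
      \<le> (1 + norm x) ^ N * norm (partials is \<psi> x) + (1 + norm x) ^ N * norm (partials is \<theta> x)"
      using assms by (subst partials_add[of UNIV])
        (auto simp: distrib_left[symmetric] intro!: mult_left_mono norm_triangle_ineq)
    also have "\<dots> \<le> schwartz_seminorm N (length is) \<psi> + schwartz_seminorm N (length is) \<theta>"
      using assms by (intro add_mono schwartz_seminorm_ge) auto
    finally show ?thesis .
  qed
  then show "\<exists>B. \<forall>x. (1 + norm x) ^ N * norm (partials is (\<lambda>x. \<psi> x + \<theta> x) x) \<le> B" by blast
qed

definition continuous_op :: "((real^'n::finite \<Rightarrow> complex) \<Rightarrow> real^'n \<Rightarrow> complex) \<Rightarrow> bool" where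
  "continuous_op T \<longleftrightarrow> (\<forall>\<psi>\<in>schwartz. T \<psi> \<in> schwartz) \<and>
     (\<forall>N m. \<exists>N' C. \<forall>\<psi>\<in>schwartz. schwartz_seminorm N m (T \<psi>) \<le> C * schwartz_seminorm N' N' \<psi>)"

lemma continuous_op_schwartz: "continuous_op T \<Longrightarrow> \<psi> \<in> schwartz \<Longrightarrow> T \<psi> \<in> schwartz"
  by (simp add: continuous_op_def)

lemma continuous_opE:
  assumes "continuous_op T"
  obtains N' C where "0 \<le> C"
    "\<And>\<psi>. \<psi> \<in> schwartz \<Longrightarrow> schwartz_seminorm N m (T \<psi>) \<le> C * schwartz_seminorm N' N' \<psi>"
proof -
  obtain N' C where C:
    "\<And>\<psi>. \<psi> \<in> schwartz \<Longrightarrow> schwartz_seminorm N m (T \<psi>) \<le> C * schwartz_seminorm N' N' \<psi>"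
    using assms unfolding continuous_op_def by meson
  show ?thesis
  proof (rule that[of "max C 0" N'])
    fix \<psi> :: "real^'a \<Rightarrow> complex" assume \<psi>: "\<psi> \<in> schwartz"
    show "schwartz_seminorm N m (T \<psi>) \<le> max C 0 * schwartz_seminorm N' N' \<psi>"
      by (rule order_trans[OF C[OF \<psi>]]) (intro mult_right_mono schwartz_seminorm_nonneg \<psi>, simp)
  qed simp
qed

lemma continuous_opI:
  assumes "\<And>\<psi>. \<psi> \<in> schwartz \<Longrightarrow> smooth_on UNIV (T \<psi>)"
    and "\<And>N is. \<exists>N' C. \<forall>\<psi>\<in>schwartz. \<forall>x. (1 + norm x) ^ N * norm (partials is (T \<psi>) x)
      \<le> C * schwartz_seminorm N' N' \<psi>"
  shows "continuous_op T"
  unfolding continuous_op_def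
proof (intro conjI ballI allI)
  fix \<psi> :: "real^'a \<Rightarrow> complex" assume "\<psi> \<in> schwartz"
  then show "T \<psi> \<in> schwartz"
    using assms unfolding schwartz_iff[of "T \<psi>"] by blast
next
  fix N m
  obtain N' C where C: "\<And>is \<psi> x. \<psi> \<in> schwartz \<Longrightarrow> (1 + norm x) ^ N * norm (partials is (T \<psi>) x)
      \<le> C is * schwartz_seminorm (N' is) (N' is) \<psi>"
    using assms(2)[of N] by metis
  define I where "I = {is :: 'a list. length is \<le> m}"
  have fin: "finite I" unfolding I_def by (rule finite_lists_le)
  define K where "K = Max (N' ` I)"
  define D where "D = (\<Sum>is\<in>I. \<bar>C is\<bar>)"
  have "schwartz_seminorm N m (T \<psi>) \<le> D * schwartz_seminorm K K \<psi>" if \<psi>: "\<psi> \<in> schwartz" for \<psi>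
  proof (rule schwartz_seminorm_le)
    fix "is" :: "'a list" and x assume "length is \<le> m"
    then have i: "is \<in> I" by (simp add: I_def)
    note C[OF \<psi>, of x "is"]
    also have "C is * schwartz_seminorm (N' is) (N' is) \<psi> \<le> D * schwartz_seminorm K K \<psi>"
    proof (rule mult_mono)
      have "\<bar>C is\<bar> \<le> D" unfolding D_def using i fin by (intro member_le_sum) auto
      then show "C is \<le> D" "0 \<le> D" by auto
      show "schwartz_seminorm (N' is) (N' is) \<psi> \<le> schwartz_seminorm K K \<psi>"
        unfolding K_def using i fin by (intro schwartz_seminorm_mono \<psi> Max_ge) auto
      show "0 \<le> schwartz_seminorm (N' is) (N' is) \<psi>" by (rule schwartz_seminorm_nonneg[OF \<psi>])
    qed
    finally show "(1 + norm x) ^ N * norm (partials is (T \<psi>) x) \<le> D * schwartz_seminorm K K \<psi>" .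
  qed
  then show "\<exists>N' C. \<forall>\<psi>\<in>schwartz. schwartz_seminorm N m (T \<psi>) \<le> C * schwartz_seminorm N' N' \<psi>"
    by blast
qed

lemma continuous_op_comp:
  assumes S: "continuous_op S" and T: "continuous_op T"
  shows "continuous_op (\<lambda>\<psi>. T (S \<psi>))"
  unfolding continuous_op_def
proof (intro conjI ballI allI)
  fix N m
  obtain M C where C: "0 \<le> C"
    "\<And>\<psi>. \<psi> \<in> schwartz \<Longrightarrow> schwartz_seminorm N m (T \<psi>) \<le> C * schwartz_seminorm M M \<psi>"
    by (rule continuous_opE[OF T, where N = N and m = m]) (rule that)
  obtain K D where D: "0 \<le> D"
    "\<And>\<psi>. \<psi> \<in> schwartz \<Longrightarrow> schwartz_seminorm M M (S \<psi>) \<le> D * schwartz_seminorm K K \<psi>"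
    by (rule continuous_opE[OF S, where N = M and m = M]) (rule that)
  have "schwartz_seminorm N m (T (S \<psi>)) \<le> (C * D) * schwartz_seminorm K K \<psi>" if "\<psi> \<in> schwartz" for \<psi>
    using C(2)[OF continuous_op_schwartz[OF S that]] mult_left_mono[OF D(2)[OF that] C(1)]
    by (simp add: mult.assoc)
  then show "\<exists>N' C. \<forall>\<psi>\<in>schwartz. schwartz_seminorm N m (T (S \<psi>)) \<le> C * schwartz_seminorm N' N' \<psi>"
    by blast
qed (use assms continuous_op_schwartz in blast)

definition slow_growth :: "(real^'n::finite \<Rightarrow> complex) \<Rightarrow> bool" where
  "slow_growth f \<longleftrightarrow> smooth_on UNIV f \<and> (\<forall>n. \<exists>C K. \<forall>x. jet n (C * (1 + norm x) ^ K) 1 f x)"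

lemma continuous_op_mult:
  assumes "slow_growth f"
  shows "continuous_op (\<lambda>\<psi> x. f x * \<psi> x)"
proof (rule continuous_opI)
  fix N and "is" :: "'a list"
  define n where "n = length is"
  obtain C K where C: "\<And>x. jet n (C * (1 + norm x) ^ K) 1 f x"
    using assms unfolding slow_growth_def by blast
  have C0: "0 \<le> C"
    using jetD[OF C[of 0], of "[]"] order_trans[OF norm_ge_zero[of "f 0"]] by simp
  have "(1 + norm x) ^ N * norm (partials is (\<lambda>x. f x * \<psi> x) x)
      \<le> 2 ^ n * C * schwartz_seminorm (N + K + n) (N + K + n) \<psi>"
    if \<psi>: "\<psi> \<in> schwartz" for \<psi> x
  proof -
    define D where "D = schwartz_seminorm (N + K) n \<psi> / (1 + norm x) ^ (N + K)"
    have pos: "0 < (1 + norm x) ^ (N + K)"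
      by (intro zero_less_power add_pos_nonneg) auto
    have "jet n D 1 \<psi> x"
      unfolding jet_def D_def using schwartz_seminorm_ge[OF \<psi>, of _ n x "N + K"] pos
      by (simp add: pos_le_divide_eq mult.commute)
    then have "jet n (2 ^ n * (C * (1 + norm x) ^ K) * D) 1 (\<lambda>x. f x * \<psi> x) x"
      using assms \<psi> C C0 pos
      by (intro jet_mult[of UNIV]) (auto simp: slow_growth_def D_def schwartz_seminorm_nonneg)
    from jetD[OF this, of "is"]
    have "(1 + norm x) ^ N * norm (partials is (\<lambda>x. f x * \<psi> x) x)
       \<le> (1 + norm x) ^ N * (2 ^ n * (C * (1 + norm x) ^ K) * D)"
      by (intro mult_left_mono) (auto simp: n_def)
    also have "\<dots> = 2 ^ n * C * schwartz_seminorm (N + K) n \<psi>"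
      using norm_ge_zero[of x] by (auto simp: D_def power_add simp del: norm_ge_zero)
    also have "\<dots> \<le> 2 ^ n * C * schwartz_seminorm (N + K + n) (N + K + n) \<psi>"
      using C0 by (intro mult_left_mono schwartz_seminorm_mono \<psi>) auto
    finally show ?thesis .
  qed
  then show "\<exists>N' C. \<forall>\<psi>\<in>schwartz. \<forall>x. (1 + norm x) ^ N * norm (partials is (\<lambda>x. f x * \<psi> x) x)
      \<le> C * schwartz_seminorm N' N' \<psi>" by blast
qed (use assms in \<open>auto intro!: smooth_on_mult simp: slow_growth_def\<close>)

lemma jet_const: "norm c \<le> C \<Longrightarrow> 0 \<le> L \<Longrightarrow> jet n C L (\<lambda>x. c) x"
  using order_trans[OF norm_ge_zero, of c C] by (auto simp: jet_def partials_const)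

lemma slow_growth_const: "slow_growth (\<lambda>x. c)"
  unfolding slow_growth_def using jet_const[of c "norm c" 1]
  by (intro conjI allI exI[of _ "norm c"] exI[of _ 0]) auto

lemma smooth_on_of_real: "open U \<Longrightarrow> smooth_on U f \<Longrightarrow> smooth_on U (\<lambda>x. complex_of_real (f x))"
  by (rule smooth_on_bounded_linear[OF _ bounded_linear_of_real])

lemma slow_growth_coord: "slow_growth (\<lambda>x. complex_of_real (x $ k))"
  unfolding slow_growth_def
proof (intro conjI allI exI)
  have "partial i (\<lambda>x. complex_of_real (x $ k)) = (\<lambda>x. of_real (axis i 1 $ k))" for i
  proof
    fix x :: "real^'a"
    have "((\<lambda>x. complex_of_real (x $ k)) has_derivative (\<lambda>h. of_real (h $ k))) (at x)"
      by (intro bounded_linear.has_derivative[OF bounded_linear_of_real]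
          bounded_linear.has_derivative[OF bounded_linear_vec_nth has_derivative_ident])
    from partial_eqI[OF this] show "partial i (\<lambda>x. complex_of_real (x $ k)) x = of_real (axis i 1 $ k)" .
  qed
  moreover have "norm (complex_of_real (axis i 1 $ k)) \<le> 1 + norm x" for i and x :: "real^'a"
    by (auto simp: axis_def)
  moreover have "norm (complex_of_real (x $ k)) \<le> 1 + norm x" for x :: "real^'a"
    using component_le_norm_cart[of x k] by simp
  ultimately show "jet n (1 * (1 + norm x) ^ 1) 1 (\<lambda>x. complex_of_real (x $ k)) x" for n and x :: "real^'a"
    by (cases n) (auto simp: jet_Suc intro!: jet_const)
qed (auto intro!: smooth_on_of_real)

definition coord_power :: "'n::finite list \<Rightarrow> real^'n \<Rightarrow> complex" where
  "coord_power is x = prod_list (map (\<lambda>i. of_real (x $ i)) is)"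

lemma coord_power_simps [simp]:
  "coord_power [] x = 1" "coord_power (i # is) x = of_real (x $ i) * coord_power is x"
  by (simp_all add: coord_power_def)

lemma continuous_op_coord_power: "continuous_op (\<lambda>\<psi> x. coord_power is x * \<psi> x)"
proof (induction "is")
  case Nil
  show ?case using continuous_op_mult[OF slow_growth_const, of 1] by simp
next
  case (Cons i "is")
  show ?case
    using continuous_op_comp[OF Cons.IH continuous_op_mult[OF slow_growth_coord, of i]]
    by (simp add: mult.assoc)
qed

lemma schwartz_mult: "slow_growth f \<Longrightarrow> \<psi> \<in> schwartz \<Longrightarrow> (\<lambda>x. f x * \<psi> x) \<in> schwartz"
  using continuous_op_mult continuous_op_schwartz by blast

lemma schwartz_cmult: "\<psi> \<in> schwartz \<Longrightarrow> (\<lambda>x. c * \<psi> x) \<in> schwartz"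
  by (rule schwartz_mult[OF slow_growth_const])

lemma schwartz_sum: "(\<And>k. k \<in> F \<Longrightarrow> \<psi> k \<in> schwartz) \<Longrightarrow> (\<lambda>x. \<Sum>k\<in>F. \<psi> k x) \<in> schwartz"
proof (induction F rule: infinite_finite_induct)
  case (insert k F)
  then show ?case using schwartz_add[of "\<psi> k" "\<lambda>x. \<Sum>k\<in>F. \<psi> k x"] by simp
qed (auto simp: schwartz_iff partials_const)

lemma schwartz_coord_power: "\<psi> \<in> schwartz \<Longrightarrow> (\<lambda>x. coord_power is x * \<psi> x) \<in> schwartz"
  using continuous_op_coord_power continuous_op_schwartz by blast

lemma schwartz_partials: "\<psi> \<in> schwartz \<Longrightarrow> partials is \<psi> \<in> schwartz"
proof -
  assume \<psi>: "\<psi> \<in> schwartz"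
  have "partials js (partials is \<psi>) = partials (js @ is) \<psi>" for js
    by (simp add: partials_def)
  then show ?thesis using \<psi> by (auto simp: schwartz_iff smooth_on_partials)
qed

lemma
  assumes \<psi>: "\<psi> \<in> schwartz"
  shows partials_reflect: "norm (partials is (\<lambda>x. \<psi> (- x)) x) = norm (partials is \<psi> (- x))"
    and schwartz_reflect: "(\<lambda>x. \<psi> (- x)) \<in> schwartz"
proof -
  have eq: "(\<chi> i. - (x $ i)) = - x" for x :: "real^'a"
    by (simp add: vec_eq_iff)
  have sm: "smooth_on UNIV \<psi>" using \<psi> by auto
  have "norm (prod_list (map (\<lambda>_. - 1) is) :: real) = 1" for "is" :: "'a list"
    by (induction "is") auto
  then have 1: "norm (partials is (\<lambda>x. \<psi> (- x)) x) = norm (partials is \<psi> (- x))" for "is" x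
    using partials_diag_affine[OF sm, of "is" "\<lambda>_. - 1" 0 x] by (simp add: eq)
  then show "norm (partials is (\<lambda>x. \<psi> (- x)) x) = norm (partials is \<psi> (- x))" .
  have s: "smooth_on UNIV (\<lambda>x. \<psi> (- x))"
    using smooth_on_diag_affine[OF sm, of "\<lambda>_. - 1" 0] by (simp add: eq)
  show "(\<lambda>x. \<psi> (- x)) \<in> schwartz"
    unfolding schwartz_iff using s 1 \<psi> norm_minus_cancel unfolding schwartz_iff by metis
qed

lemma continuous_op_reflect: "continuous_op (\<lambda>\<psi> x. \<psi> (- x))"
proof (rule continuous_opI)
  fix N and "is" :: "'a list"
  have "(1 + norm x) ^ N * norm (partials is (\<lambda>x. \<psi> (- x)) x)
      \<le> 1 * schwartz_seminorm (N + length is) (N + length is) \<psi>" if "\<psi> \<in> schwartz" for \<psi> x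
    using schwartz_seminorm_ge[OF that, of "is" "length is" "- x" N]
      schwartz_seminorm_mono[OF that, of N "N + length is" "length is" "N + length is"]
    by (simp add: partials_reflect[OF that])
  then show "\<exists>N' C. \<forall>\<psi>\<in>schwartz. \<forall>x. (1 + norm x) ^ N * norm (partials is (\<lambda>x. \<psi> (- x)) x)
      \<le> C * schwartz_seminorm N' N' \<psi>" by blast
qed (use schwartz_reflect in auto)

lemma schwartz_isCont: "\<psi> \<in> schwartz \<Longrightarrow> isCont \<psi> x"
  using smooth_on_isCont[of UNIV \<psi> x "[]"] by (auto simp: schwartz_iff)

lemma schwartz_measurable [measurable_dest]: "\<psi> \<in> schwartz \<Longrightarrow> \<psi> \<in> borel_measurable borel"
  by (intro borel_measurable_continuous_onI continuous_at_imp_continuous_on) (auto simp: schwartz_isCont)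

section \<open>Integrability on Euclidean space\<close>

lemma
  fixes f :: "'a::euclidean_space \<Rightarrow> real \<Rightarrow> 'b::{real_normed_field,banach,second_countable_topology}"
  assumes f: "\<And>b. b \<in> Basis \<Longrightarrow> integrable lborel (f b)"
  shows integrable_lborel_prod: "integrable lborel (\<lambda>x. \<Prod>b\<in>Basis. f b (x \<bullet> b))"
    and integral_lborel_prod:
      "(LINT x|lborel. (\<Prod>b\<in>Basis. f b (x \<bullet> b))) = (\<Prod>b\<in>Basis. integral\<^sup>L lborel (f b))"
proof -
  interpret product_sigma_finite "\<lambda>_::'a. lborel :: real measure" by standard
  let ?T = "\<lambda>g. \<Sum>b\<in>Basis. g b *\<^sub>R b :: 'a"
  have T: "?T \<in> measurable (\<Pi>\<^sub>M b\<in>Basis. lborel) borel" by measurable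
  have m: "(\<lambda>x. \<Prod>b\<in>Basis. f b (x \<bullet> b)) \<in> borel_measurable borel"
    using f[THEN borel_measurable_integrable]
    by (intro borel_measurable_prod measurable_compose[of "\<lambda>x. x \<bullet> b" borel borel "f b" for b]) auto
  have eq: "(\<Prod>b\<in>Basis. f b (?T g \<bullet> b)) = (\<Prod>b\<in>Basis. f b (g b))" for g
    by (intro prod.cong refl) simp
  show "integrable lborel (\<lambda>x. \<Prod>b\<in>Basis. f b (x \<bullet> b))"
    unfolding lborel_eq[where 'a='a] integrable_distr_eq[OF T m] eq
    by (rule product_integrable_prod) (use f in auto)
  show "(LINT x|lborel. (\<Prod>b\<in>Basis. f b (x \<bullet> b))) = (\<Prod>b\<in>Basis. integral\<^sup>L lborel (f b))"
    unfolding lborel_eq[where 'a='a] integral_distr[OF T m] eq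
    unfolding lborel_eq[symmetric]
    by (rule product_integral_prod) (use f in auto)
qed

lemma integrable_decay: "integrable lborel (\<lambda>x::'a::euclidean_space. 1 / (1 + norm x) ^ (2 * DIM('a)))"
proof (rule Bochner_Integration.integrable_bound)
  have "integrable lborel (\<lambda>x::real. inverse (1 + x\<^sup>2))"
    using integrable_inverse_1_plus_square by (simp add: set_integrable_def)
  then show "integrable lborel (\<lambda>x::'a. \<Prod>b\<in>Basis. inverse (1 + (x \<bullet> b)\<^sup>2))"
    by (intro integrable_lborel_prod)
  show "AE x in lborel. norm (1 / (1 + norm x) ^ (2 * DIM('a))) \<le> norm (\<Prod>b\<in>(Basis::'a set). inverse (1 + (x \<bullet> b)\<^sup>2))"
  proof (rule AE_I2)
    fix x :: 'a
    have *: "1 + (x \<bullet> b)\<^sup>2 \<le> (1 + norm x)\<^sup>2" if "b \<in> Basis" for b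
      using power_mono[OF Basis_le_norm[OF that, of x], of 2] norm_ge_zero[of x]
      unfolding power2_sum by (simp add: add_increasing2)
    have "1 / (1 + norm x) ^ (2 * DIM('a)) = (\<Prod>b\<in>(Basis::'a set). inverse ((1 + norm x)\<^sup>2))"
      by (simp add: power_mult divide_inverse power_inverse)
    also have "\<dots> \<le> (\<Prod>b\<in>(Basis::'a set). inverse (1 + (x \<bullet> b)\<^sup>2))"
      by (intro prod_mono conjI le_imp_inverse_le *) (auto intro: add_pos_nonneg)
    finally show "norm (1 / (1 + norm x) ^ (2 * DIM('a))) \<le> norm (\<Prod>b\<in>(Basis::'a set). inverse (1 + (x \<bullet> b)\<^sup>2))"
      by (simp add: abs_of_nonneg)
  qed
qed measurable

lemma integrable_bound_decay:
  fixes f :: "real^'n::finite \<Rightarrow> 'b::{banach,second_countable_topology}"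
  assumes [measurable]: "f \<in> borel_measurable borel" and "\<And>x. norm (f x) \<le> B / (1 + norm x) ^ (2 * CARD('n))"
  shows "integrable lborel f"
    and "norm (integral\<^sup>L lborel f) \<le> B * (LINT x::real^'n|lborel. 1 / (1 + norm x) ^ (2 * CARD('n)))"
proof -
  have i: "integrable lborel (\<lambda>x::real^'n. B * (1 / (1 + norm x) ^ (2 * CARD('n))))"
    using integrable_decay[where 'a="real^'n"] by (intro integrable_mult_right) simp
  show I: "integrable lborel f"
    by (rule Bochner_Integration.integrable_bound[OF i])
      (use assms order_trans[OF assms(2) abs_ge_self] in \<open>auto simp: abs_mult\<close>)
  have "norm (integral\<^sup>L lborel f) \<le> (LINT x|lborel. norm (f x))" by (rule integral_norm_bound)
  also have "\<dots> \<le> (LINT x::real^'n|lborel. B * (1 / (1 + norm x) ^ (2 * CARD('n))))"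
    by (intro integral_mono i integrable_norm I) (use assms in auto)
  finally show "norm (integral\<^sup>L lborel f) \<le> B * (LINT x::real^'n|lborel. 1 / (1 + norm x) ^ (2 * CARD('n)))"
    unfolding integral_mult_right_zero .
qed

lemma schwartz_decay:
  fixes \<psi> :: "real^'n::finite \<Rightarrow> complex"
  assumes "\<psi> \<in> schwartz"
  shows "(1 + norm x) ^ k * norm (\<psi> x) \<le> schwartz_seminorm (k + 2 * CARD('n)) 0 \<psi> / (1 + norm x) ^ (2 * CARD('n))"
proof -
  have pos: "0 < (1 + norm x) ^ (2 * CARD('n))"
    by (intro zero_less_power add_pos_nonneg) auto
  show ?thesis
    using schwartz_seminorm_ge[OF assms, of "[]" 0 x "k + 2 * CARD('n)"] pos
    by (simp add: pos_le_divide_eq power_add mult_ac)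
qed

lemma integrable_schwartz_moment:
  assumes "\<psi> \<in> schwartz" shows "integrable lborel (\<lambda>x. (1 + norm x) ^ k * norm (\<psi> x))"
  using schwartz_measurable[OF assms] schwartz_decay[OF assms, of _ k]
  by (intro integrable_bound_decay(1)[where B = "schwartz_seminorm (k + 2 * CARD('a)) 0 \<psi>"]) auto

lemma integrable_schwartz_mult:
  assumes \<psi>: "\<psi> \<in> schwartz" and f: "f \<in> borel_measurable borel" "\<And>x. norm (f x) \<le> C * (1 + norm x) ^ k"
  shows "integrable lborel (\<lambda>x. \<psi> x * f x)"
proof (rule Bochner_Integration.integrable_bound)
  show "integrable lborel (\<lambda>x. C * ((1 + norm x) ^ k * norm (\<psi> x)))"
    by (intro integrable_mult_right integrable_schwartz_moment \<psi>)
  show "AE x in lborel. norm (\<psi> x * f x) \<le> norm (C * ((1 + norm x) ^ k * norm (\<psi> x)))"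
    using mult_left_mono[OF f(2) norm_ge_zero]
    by (intro AE_I2) (auto simp: norm_mult mult_ac intro: order_trans[OF _ abs_ge_self])
  show "(\<lambda>x. \<psi> x * f x) \<in> borel_measurable lborel" using \<psi> f(1) by measurable
qed

section \<open>Taylor remainders of the Fourier integral\<close>

definition exp_rem :: "nat \<Rightarrow> real \<Rightarrow> complex" where
  "exp_rem q s = iexp s - (\<Sum>k<q. (\<i> * of_real s) ^ k / fact k)"

lemma exp_rem_0 [simp]: "exp_rem 0 s = iexp s"
  by (simp add: exp_rem_def)

lemma exp_rem_Suc: "exp_rem (Suc q) s = exp_rem q s - (\<i> * of_real s) ^ q / fact q"
  by (simp add: exp_rem_def algebra_simps)

lemma norm_exp_rem_le: "norm (exp_rem q s) \<le> \<bar>s\<bar> ^ q"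
proof (cases q)
  case (Suc n)
  have "norm (exp_rem q s) \<le> \<bar>s\<bar> ^ q / fact q"
    using iexp_approx1[of s n] by (simp add: exp_rem_def Suc lessThan_Suc_atMost)
  also have "\<dots> \<le> \<bar>s\<bar> ^ q"
    by (rule divide_le_eq[THEN iffD2]) (auto simp: mult_le_cancel_left1 fact_ge_1)
  finally show ?thesis .
qed simp

lemma continuous_exp_rem [continuous_intros]:
  "continuous_on S f \<Longrightarrow> continuous_on S (\<lambda>x. exp_rem q (f x))"
  unfolding exp_rem_def by (intro continuous_intros) auto

lemma exp_rem_measurable [measurable]: "exp_rem q \<in> borel_measurable borel"
  by (intro borel_measurable_continuous_onI continuous_intros)

lemma power_second_order:
  fixes z w :: complex
  shows "norm ((z + w) ^ q - z ^ q - of_nat q * w * z ^ (q - 1)) \<le> (real q)\<^sup>2 * (norm w)\<^sup>2 * (1 + norm z + norm w) ^ q"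
proof (induction q)
  case (Suc q)
  define M where "M = 1 + norm z + norm w"
  have M: "1 \<le> M" "norm (z + w) \<le> M" "norm z \<le> M"
    using norm_triangle_ineq[of z w] by (auto simp: M_def)
  have "(z + w) ^ Suc q - z ^ Suc q - of_nat (Suc q) * w * z ^ (Suc q - 1)
      = (z + w) * ((z + w) ^ q - z ^ q - of_nat q * w * z ^ (q - 1)) + of_nat q * w ^ 2 * z ^ (q - 1)"
    by (cases q) (auto simp: algebra_simps power2_eq_square)
  also have "norm \<dots> \<le> M * ((real q)\<^sup>2 * (norm w)\<^sup>2 * M ^ q) + real q * (norm w)\<^sup>2 * M ^ (q - 1)"
    using Suc.IH M
    by (intro order_trans[OF norm_triangle_ineq] add_mono)
      (auto simp: norm_mult norm_power M_def[symmetric] intro!: mult_mono power_mono)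
  also have "M ^ (q - 1) \<le> M ^ Suc q" using M by (intro power_increasing) auto
  then have "M * ((real q)\<^sup>2 * (norm w)\<^sup>2 * M ^ q) + real q * (norm w)\<^sup>2 * M ^ (q - 1)
      \<le> (real q)\<^sup>2 * (norm w)\<^sup>2 * M ^ Suc q + real q * (norm w)\<^sup>2 * M ^ Suc q"
    by (intro add_mono mult_left_mono) auto
  also have "\<dots> = ((real q)\<^sup>2 + real q) * ((norm w)\<^sup>2 * M ^ Suc q)"
    by (simp add: algebra_simps)
  also have "\<dots> \<le> (real (Suc q))\<^sup>2 * ((norm w)\<^sup>2 * M ^ Suc q)"
    using M by (intro mult_right_mono) (auto simp: power2_eq_square algebra_simps)
  finally show ?case by (simp add: M_def mult.assoc)
qed simp

lemma exp_rem_second_order: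
  "\<exists>K\<ge>0. \<forall>s t. norm (exp_rem q (s + t) - exp_rem q s - \<i> * of_real t * exp_rem (q - 1) s)
     \<le> K * t\<^sup>2 * (1 + \<bar>s\<bar> + \<bar>t\<bar>) ^ q"
proof (induction q)
  case 0
  have "norm (iexp (s + t) - iexp s - \<i> * of_real t * iexp s) \<le> t\<^sup>2" for s t
  proof -
    have "iexp (s + t) - iexp s - \<i> * of_real t * iexp s = iexp s * (iexp t - (\<Sum>k\<le>1. (\<i> * of_real t) ^ k / fact k))"
      by (simp add: algebra_simps exp_add)
    also have "norm \<dots> \<le> t\<^sup>2"
      using iexp_approx1[of t 1] norm_ge_zero[of "iexp t - (\<Sum>k\<le>1. (\<i> * of_real t) ^ k / fact k)"]
      by (simp add: norm_mult numeral_2_eq_2 del: norm_ge_zero)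
    finally show ?thesis .
  qed
  then show ?case by (intro exI[of _ 1]) simp
next
  case (Suc q)
  then obtain K where K: "K \<ge> 0" "\<And>s t. norm (exp_rem q (s + t) - exp_rem q s - \<i> * of_real t * exp_rem (q - 1) s)
     \<le> K * t\<^sup>2 * (1 + \<bar>s\<bar> + \<bar>t\<bar>) ^ q" by blast
  show ?case
  proof (intro exI[of _ "K + (real q)\<^sup>2"] conjI allI)
    fix s t
    define z w where "z = \<i> * complex_of_real s" and "w = \<i> * complex_of_real t"
    define M where "M = 1 + \<bar>s\<bar> + \<bar>t\<bar>"
    have M: "1 \<le> M" "M = 1 + norm z + norm w" by (auto simp: M_def z_def w_def norm_mult)
    have "exp_rem (Suc q) (s + t) - exp_rem (Suc q) s - \<i> * of_real t * exp_rem (Suc q - 1) s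
      = (exp_rem q (s + t) - exp_rem q s - \<i> * of_real t * exp_rem (q - 1) s)
        - ((z + w) ^ q - z ^ q - of_nat q * w * z ^ (q - 1)) / fact q"
    proof (cases q)
      case (Suc n)
      have "of_nat q * w * z ^ n / fact q = w * z ^ n / fact n"
        unfolding Suc using of_nat_neq_0[where 'a=complex, of n] by (simp add: divide_simps del: of_nat_Suc)
      then show ?thesis
        unfolding Suc diff_Suc_1 exp_rem_Suc diff_divide_distrib
        by (simp add: z_def w_def algebra_simps del: fact_Suc of_nat_Suc power_Suc)
    qed (simp add: exp_rem_Suc)
    also have "norm \<dots> \<le> K * t\<^sup>2 * M ^ q + (real q)\<^sup>2 * t\<^sup>2 * M ^ q"
    proof (rule order_trans[OF norm_triangle_ineq4], rule add_mono)
      have "norm (((z + w) ^ q - z ^ q - of_nat q * w * z ^ (q - 1)) / fact q)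
          \<le> norm ((z + w) ^ q - z ^ q - of_nat q * w * z ^ (q - 1))"
        by (simp add: norm_divide divide_le_eq mult_le_cancel_left1 fact_ge_1)
      also have "\<dots> \<le> (real q)\<^sup>2 * t\<^sup>2 * M ^ q"
        using power_second_order[of z w q] by (simp add: M(2) w_def norm_mult)
      finally show "norm (((z + w) ^ q - z ^ q - of_nat q * w * z ^ (q - 1)) / fact q) \<le> (real q)\<^sup>2 * t\<^sup>2 * M ^ q" .
    qed (use K(2)[of s t] in \<open>simp add: M_def\<close>)
    also have "\<dots> = (K + (real q)\<^sup>2) * t\<^sup>2 * M ^ q" by (simp add: algebra_simps)
    also have "\<dots> \<le> (K + (real q)\<^sup>2) * t\<^sup>2 * M ^ Suc q"
      using M(1) K(1) by (intro mult_left_mono power_increasing) auto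
    finally show "norm (exp_rem (Suc q) (s + t) - exp_rem (Suc q) s - \<i> * of_real t * exp_rem (Suc q - 1) s)
      \<le> (K + (real q)\<^sup>2) * t\<^sup>2 * (1 + \<bar>s\<bar> + \<bar>t\<bar>) ^ Suc q" by (simp add: M_def)
  qed (use K in auto)
qed

abbreviation fourier_const :: "'n::finite itself \<Rightarrow> real" where
  "fourier_const _ \<equiv> (2 * pi) powr (- real CARD('n) / 2)"

text \<open>The remainder of order \<open>q\<close> of the Taylor expansion of \<^term>\<open>inv_fourier \<theta>\<close> at \<open>0\<close>.
  Truncated subtraction is convenient: differentiation turns \<open>q\<close> into \<open>q - 1\<close>, for \<open>q = 0\<close> as well.\<close>

definition fourier_rem :: "nat \<Rightarrow> (real^'n::finite \<Rightarrow> complex) \<Rightarrow> real^'n \<Rightarrow> complex" where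
  "fourier_rem q \<theta> \<xi> = of_real (fourier_const TYPE('n)) * (LINT x|lborel. \<theta> x * exp_rem q (x \<bullet> \<xi>))"

lemma fourier_rem_0: "fourier_rem 0 \<theta> = inv_fourier \<theta>"
  by (simp add: fourier_rem_def inv_fourier_def fun_eq_iff inner_commute)

lemma norm_exp_rem_inner_le: "norm (exp_rem q (x \<bullet> \<xi>)) \<le> norm \<xi> ^ q * (1 + norm x) ^ q"
proof -
  have "norm (exp_rem q (x \<bullet> \<xi>)) \<le> (norm x * norm \<xi>) ^ q"
    by (rule order_trans[OF norm_exp_rem_le]) (intro power_mono Cauchy_Schwarz_ineq2, simp)
  also have "\<dots> \<le> norm \<xi> ^ q * (1 + norm x) ^ q"
    unfolding power_mult_distrib[symmetric] mult.commute[of "norm \<xi>"]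
    by (intro power_mono mult_mono) auto
  finally show ?thesis .
qed

lemma integrable_fourier_rem: "\<theta> \<in> schwartz \<Longrightarrow> integrable lborel (\<lambda>x. \<theta> x * exp_rem q (x \<bullet> \<xi>))"
  by (rule integrable_schwartz_mult[OF _ _ norm_exp_rem_inner_le]) auto

lemma norm_fourier_rem_le:
  assumes "\<theta> \<in> schwartz"
  shows "norm (fourier_rem q \<theta> \<xi>) \<le>
    fourier_const TYPE('n) * (LINT x::real^'n::finite|lborel. (1 + norm x) ^ q * norm (\<theta> x)) * norm \<xi> ^ q"
proof -
  have "norm (LINT x|lborel. \<theta> x * exp_rem q (x \<bullet> \<xi>)) \<le> (LINT x|lborel. norm (\<theta> x * exp_rem q (x \<bullet> \<xi>)))"
    by (rule integral_norm_bound)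
  also have "\<dots> \<le> (LINT x|lborel. norm \<xi> ^ q * ((1 + norm x) ^ q * norm (\<theta> x)))"
    using mult_left_mono[OF norm_exp_rem_inner_le norm_ge_zero]
    by (intro integral_mono integrable_norm integrable_fourier_rem integrable_mult_right
        integrable_schwartz_moment assms) (simp add: norm_mult mult_ac)
  finally have "norm (LINT x|lborel. \<theta> x * exp_rem q (x \<bullet> \<xi>)) \<le> norm \<xi> ^ q * (LINT x|lborel. (1 + norm x) ^ q * norm (\<theta> x))"
    by (simp only: integral_mult_right_zero)
  then show ?thesis
    by (simp add: fourier_rem_def norm_mult mult.assoc mult_left_mono mult.commute[of _ "norm \<xi> ^ q"])
qed

lemma has_derivative_quadratic:
  fixes f :: "'a::real_normed_vector \<Rightarrow> 'b::real_normed_vector"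
  assumes "bounded_linear D" "\<And>h. norm h \<le> 1 \<Longrightarrow> norm (f (x + h) - f x - D h) \<le> K * (norm h)\<^sup>2"
  shows "(f has_derivative D) (at x)"
  unfolding has_derivative_at
proof (rule conjI[OF assms(1)], rule Lim_null_comparison)
  have "norm (norm (f (x + h) - f x - D h) / norm h) \<le> K * norm h" if "h \<noteq> 0" "norm h < 1" for h
    using assms(2)[of h] that by (simp add: pos_divide_le_eq power2_eq_square mult.assoc)
  then show "\<forall>\<^sub>F h in at 0. norm (norm (f (x + h) - f x - D h) / norm h) \<le> K * norm h"
    unfolding eventually_at by (intro exI[of _ 1]) simp
  show "((\<lambda>h. K * norm h) \<longlongrightarrow> 0) (at 0)"
    by (rule tendsto_mult_right_zero) (rule tendsto_norm_zero, rule tendsto_ident_at)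
qed

lemma fourier_rem_has_derivative:
  fixes \<theta> :: "real^'n::finite \<Rightarrow> complex"
  assumes \<theta>: "\<theta> \<in> schwartz"
  defines "c \<equiv> complex_of_real (fourier_const TYPE('n))"
  shows "(fourier_rem q \<theta> has_derivative
    (\<lambda>\<eta>. c * (LINT x|lborel. \<theta> x * (\<i> * of_real (x \<bullet> \<eta>) * exp_rem (q - 1) (x \<bullet> \<xi>))))) (at \<xi>)"
proof -
  obtain K where K: "K \<ge> 0" "\<And>s t. norm (exp_rem q (s + t) - exp_rem q s - \<i> * of_real t * exp_rem (q - 1) s)
     \<le> K * t\<^sup>2 * (1 + \<bar>s\<bar> + \<bar>t\<bar>) ^ q"
    using exp_rem_second_order by blast
  have bd: "norm (\<i> * of_real (x \<bullet> \<eta>) * exp_rem (q - 1) (x \<bullet> \<xi>))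
      \<le> norm \<eta> * norm \<xi> ^ (q - 1) * (1 + norm x) ^ Suc (q - 1)" for x \<eta> :: "real^'n"
  proof -
    have "norm (\<i> * of_real (x \<bullet> \<eta>) * exp_rem (q - 1) (x \<bullet> \<xi>))
      \<le> ((1 + norm x) * norm \<eta>) * (norm \<xi> ^ (q - 1) * (1 + norm x) ^ (q - 1))"
      using order_trans[OF Cauchy_Schwarz_ineq2[of x \<eta>] mult_right_mono[of "norm x" "1 + norm x" "norm \<eta>"]]
      by (subst norm_mult) (intro mult_mono norm_exp_rem_inner_le; simp add: norm_mult)
    then show ?thesis by (simp add: mult_ac)
  qed
  have i1: "integrable lborel (\<lambda>x. \<theta> x * (\<i> * of_real (x \<bullet> \<eta>) * exp_rem (q - 1) (x \<bullet> \<xi>)))" for \<eta>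
    by (rule integrable_schwartz_mult[OF \<theta> _ bd]) measurable
  define D where "D \<eta> = c * (LINT x|lborel. \<theta> x * (\<i> * of_real (x \<bullet> \<eta>) * exp_rem (q - 1) (x \<bullet> \<xi>)))" for \<eta>
  have "linear D"
  proof (rule linearI)
    fix \<eta> \<zeta> :: "real^'n" and r :: real
    have "D (\<eta> + \<zeta>) = c * (LINT x|lborel. \<theta> x * (\<i> * of_real (x \<bullet> \<eta>) * exp_rem (q - 1) (x \<bullet> \<xi>))
        + \<theta> x * (\<i> * of_real (x \<bullet> \<zeta>) * exp_rem (q - 1) (x \<bullet> \<xi>)))"
      by (simp add: D_def inner_add_right algebra_simps)
    then show "D (\<eta> + \<zeta>) = D \<eta> + D \<zeta>"
      by (simp only: Bochner_Integration.integral_add[OF i1 i1] D_def distrib_left)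
    have "D (r *\<^sub>R \<eta>) = c * (LINT x|lborel. of_real r * (\<theta> x * (\<i> * of_real (x \<bullet> \<eta>) * exp_rem (q - 1) (x \<bullet> \<xi>))))"
      by (simp add: D_def mult_ac)
    then show "D (r *\<^sub>R \<eta>) = r *\<^sub>R D \<eta>"
      by (simp only: integral_mult_right_zero D_def) (simp add: scaleR_conv_of_real mult_ac)
  qed
  then have bl: "bounded_linear D" by (simp add: linear_conv_bounded_linear)
  define m where "m = (2 + norm \<xi>) ^ q"
  have bq: "norm (exp_rem q (x \<bullet> (\<xi> + \<eta>)) - exp_rem q (x \<bullet> \<xi>) - \<i> * of_real (x \<bullet> \<eta>) * exp_rem (q - 1) (x \<bullet> \<xi>))
      \<le> K * (norm \<eta>)\<^sup>2 * m * (1 + norm x) ^ (q + 2)" if "norm \<eta> \<le> 1" for x \<eta>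
  proof -
    have a: "\<bar>x \<bullet> \<eta>\<bar> \<le> norm x * norm \<eta>" "\<bar>x \<bullet> \<xi>\<bar> \<le> norm x * norm \<xi>"
      by (rule Cauchy_Schwarz_ineq2)+
    have "norm x * norm \<eta> \<le> norm x" using that by (simp add: mult_left_le)
    then have "1 + \<bar>x \<bullet> \<xi>\<bar> + \<bar>x \<bullet> \<eta>\<bar> \<le> 1 + norm x * norm \<xi> + norm x"
      using a by linarith
    also have "\<dots> \<le> (2 + norm \<xi>) * (1 + norm x)"
      by (simp add: algebra_simps add_increasing2)
    finally have "1 + \<bar>x \<bullet> \<xi>\<bar> + \<bar>x \<bullet> \<eta>\<bar> \<le> (2 + norm \<xi>) * (1 + norm x)" .
    then have 1: "(1 + \<bar>x \<bullet> \<xi>\<bar> + \<bar>x \<bullet> \<eta>\<bar>) ^ q \<le> m * (1 + norm x) ^ q"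
      unfolding m_def power_mult_distrib[symmetric] by (intro power_mono) auto
    have "(x \<bullet> \<eta>)\<^sup>2 \<le> ((1 + norm x) * norm \<eta>)\<^sup>2"
      using order_trans[OF a(1) mult_right_mono[of "norm x" "1 + norm x" "norm \<eta>"]]
      by (intro abs_le_square_iff[THEN iffD1]) (auto simp: abs_mult)
    then have 2: "(x \<bullet> \<eta>)\<^sup>2 \<le> (norm \<eta>)\<^sup>2 * (1 + norm x) ^ 2"
      by (simp add: power_mult_distrib mult.commute)
    have "norm (exp_rem q (x \<bullet> (\<xi> + \<eta>)) - exp_rem q (x \<bullet> \<xi>) - \<i> * of_real (x \<bullet> \<eta>) * exp_rem (q - 1) (x \<bullet> \<xi>))
      \<le> K * (x \<bullet> \<eta>)\<^sup>2 * (1 + \<bar>x \<bullet> \<xi>\<bar> + \<bar>x \<bullet> \<eta>\<bar>) ^ q"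
      using K(2)[of "x \<bullet> \<xi>" "x \<bullet> \<eta>"] by (simp add: inner_add_right)
    also have "\<dots> \<le> K * ((norm \<eta>)\<^sup>2 * (1 + norm x) ^ 2) * (m * (1 + norm x) ^ q)"
      using 1 2 K(1) by (intro mult_mono) auto
    finally show ?thesis by (simp only: power_add mult_ac)
  qed
  define I where "I = (LINT x|lborel. (1 + norm x) ^ (q + 2) * norm (\<theta> x))"
  have dist: "a * A - a * B - a * C = a * (A - B - C)" for a A B C :: complex
    by (simp add: algebra_simps)
  have "(fourier_rem q \<theta> has_derivative D) (at \<xi>)"
  proof (rule has_derivative_quadratic[OF bl])
    fix \<eta> :: "real^'n" assume \<eta>: "norm \<eta> \<le> 1"
    define r where "r x = exp_rem q (x \<bullet> (\<xi> + \<eta>)) - exp_rem q (x \<bullet> \<xi>) - \<i> * of_real (x \<bullet> \<eta>) * exp_rem (q - 1) (x \<bullet> \<xi>)" for x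
    have "fourier_rem q \<theta> (\<xi> + \<eta>) - fourier_rem q \<theta> \<xi> - D \<eta>
      = c * ((LINT x|lborel. \<theta> x * exp_rem q (x \<bullet> (\<xi> + \<eta>))) - (LINT x|lborel. \<theta> x * exp_rem q (x \<bullet> \<xi>))
        - (LINT x|lborel. \<theta> x * (\<i> * of_real (x \<bullet> \<eta>) * exp_rem (q - 1) (x \<bullet> \<xi>))))"
      unfolding D_def fourier_rem_def c_def[symmetric] by (rule dist)
    also have "\<dots> = c * (LINT x|lborel. \<theta> x * r x)"
      by (simp only: r_def right_diff_distrib Bochner_Integration.integral_diff
          Bochner_Integration.integrable_diff i1 integrable_fourier_rem[OF \<theta>])
    also have "norm \<dots> \<le> norm c * (LINT x|lborel. (K * (norm \<eta>)\<^sup>2 * m) * ((1 + norm x) ^ (q + 2) * norm (\<theta> x)))"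
      unfolding norm_mult
    proof (rule mult_left_mono[OF order_trans[OF integral_norm_bound integral_mono]])
      show "integrable lborel (\<lambda>x. norm (\<theta> x * r x))"
        unfolding r_def right_diff_distrib
        by (rule integrable_norm[OF Bochner_Integration.integrable_diff[OF Bochner_Integration.integrable_diff]])
          (rule i1 integrable_fourier_rem[OF \<theta>])+
      show "integrable lborel (\<lambda>x. (K * (norm \<eta>)\<^sup>2 * m) * ((1 + norm x) ^ (q + 2) * norm (\<theta> x)))"
        by (rule integrable_mult_right[OF integrable_schwartz_moment[OF \<theta>]])
      fix x
      show "norm (\<theta> x * r x) \<le> (K * (norm \<eta>)\<^sup>2 * m) * ((1 + norm x) ^ (q + 2) * norm (\<theta> x))"
        using mult_left_mono[OF bq[OF \<eta>, of x] norm_ge_zero[of "\<theta> x"]]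
        unfolding r_def[symmetric] by (simp only: norm_mult mult_ac)
    qed simp
    also have "\<dots> = norm c * K * m * I * (norm \<eta>)\<^sup>2"
      unfolding integral_mult_right_zero I_def[symmetric] by (simp only: mult_ac)
    finally show "norm (fourier_rem q \<theta> (\<xi> + \<eta>) - fourier_rem q \<theta> \<xi> - D \<eta>) \<le> norm c * K * m * I * (norm \<eta>)\<^sup>2" .
  qed
  then show ?thesis unfolding D_def .
qed

lemma partial_fourier_rem:
  assumes "\<theta> \<in> schwartz"
  shows "partial i (fourier_rem q \<theta>) = fourier_rem (q - 1) (\<lambda>x. \<i> * (of_real (x $ i) * \<theta> x))"
proof
  fix \<xi>
  show "partial i (fourier_rem q \<theta>) \<xi> = fourier_rem (q - 1) (\<lambda>x. \<i> * (of_real (x $ i) * \<theta> x)) \<xi>"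
    unfolding partial_eqI[OF fourier_rem_has_derivative[OF assms]] fourier_rem_def
    by (rule arg_cong[where f = "\<lambda>g. of_real (fourier_const TYPE('a)) * integral\<^sup>L lborel g"])
      (simp add: fun_eq_iff inner_axis)
qed

lemma partials_fourier_rem:
  "\<theta> \<in> schwartz \<Longrightarrow> partials is (fourier_rem q \<theta>) =
     fourier_rem (q - length is) (\<lambda>x. \<i> ^ length is * (coord_power is x * \<theta> x))"
proof (induction "is" arbitrary: q)
  case (Cons i "is")
  have "partials (i # is) (fourier_rem q \<theta>)
      = partial i (fourier_rem (q - length is) (\<lambda>x. \<i> ^ length is * (coord_power is x * \<theta> x)))"
    by (simp only: partials_Cons Cons.IH[OF Cons.prems])
  also have "\<dots> = fourier_rem (q - length is - 1)
      (\<lambda>x. \<i> * (of_real (x $ i) * (\<i> ^ length is * (coord_power is x * \<theta> x))))"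
    by (intro partial_fourier_rem schwartz_cmult schwartz_coord_power Cons.prems)
  finally show ?case by (simp add: mult_ac)
qed simp

lemma smooth_on_fourier_rem: "\<theta> \<in> schwartz \<Longrightarrow> smooth_on UNIV (fourier_rem q \<theta>)"
  unfolding smooth_on_def diff_upto_def differentiable_def
  using fourier_rem_has_derivative[OF schwartz_cmult[OF schwartz_coord_power]]
  by (simp only: partials_fourier_rem) blast

lemma jet_fourier_rem:
  assumes "\<theta> \<in> schwartz"
  obtains B where "0 \<le> B"
    "\<And>is \<xi>. length is \<le> m \<Longrightarrow> norm (partials is (fourier_rem q \<theta>) \<xi>) \<le> B * norm \<xi> ^ (q - length is)"
proof -
  define b where "b is = fourier_const TYPE('a) * (LINT x|lborel. (1 + norm x) ^ (q - length is) *
      norm (\<i> ^ length is * (coord_power is x * \<theta> x)))" for "is"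
  have b: "norm (partials is (fourier_rem q \<theta>) \<xi>) \<le> b is * norm \<xi> ^ (q - length is)" for "is" \<xi>
    unfolding partials_fourier_rem[OF assms] b_def
    by (rule norm_fourier_rem_le) (intro schwartz_cmult schwartz_coord_power assms)
  have b0: "0 \<le> b is" for "is" unfolding b_def by (intro mult_nonneg_nonneg integral_nonneg_AE) auto
  let ?I = "{is :: 'a list. length is \<le> m}"
  show ?thesis
  proof (rule that[of "\<Sum>is\<in>?I. b is"])
    fix "is" :: "'a list" and \<xi> assume "length is \<le> m"
    then have "b is \<le> (\<Sum>is\<in>?I. b is)" using b0 by (intro member_le_sum finite_lists_le) auto
    then show "norm (partials is (fourier_rem q \<theta>) \<xi>) \<le> (\<Sum>is\<in>?I. b is) * norm \<xi> ^ (q - length is)"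
      by (intro order_trans[OF b] mult_right_mono) auto
  qed (simp add: sum_nonneg b0)
qed

section \<open>Continuity of the Fourier transform on Schwartz space\<close>

lemma
  fixes f :: "'a::euclidean_space \<Rightarrow> 'b::{banach,second_countable_topology}"
  assumes "f \<in> borel_measurable borel"
  shows lborel_integral_scale: "c \<noteq> 0 \<Longrightarrow> integral\<^sup>L lborel f = \<bar>c\<bar> ^ DIM('a) *\<^sub>R (LINT x|lborel. f (t + c *\<^sub>R x))"
    and lborel_integrable_scale_iff: "c \<noteq> 0 \<Longrightarrow> integrable lborel (\<lambda>x. f (t + c *\<^sub>R x)) \<longleftrightarrow> integrable lborel f"
proof -
  assume c: "c \<noteq> 0"
  have f': "(\<lambda>x. f (t + c *\<^sub>R x)) \<in> borel_measurable borel"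
    using measurable_compose[OF _ assms, of "\<lambda>x. t + c *\<^sub>R x" borel] by measurable
  have "integral\<^sup>L lborel f = integral\<^sup>L (density (distr lborel borel (\<lambda>x. t + c *\<^sub>R x)) (\<lambda>_. ennreal (\<bar>c\<bar> ^ DIM('a)))) f"
    using lborel_affine[OF c, of t] by (simp add: ennreal_power)
  also have "\<dots> = \<bar>c\<bar> ^ DIM('a) *\<^sub>R (LINT x|lborel. f (t + c *\<^sub>R x))"
    using assms by (subst integral_density) (auto simp: integral_distr)
  finally show "integral\<^sup>L lborel f = \<bar>c\<bar> ^ DIM('a) *\<^sub>R (LINT x|lborel. f (t + c *\<^sub>R x))" .
  have "integrable lborel f \<longleftrightarrow> integrable (density (distr lborel borel (\<lambda>x. t + c *\<^sub>R x)) (\<lambda>_. ennreal (\<bar>c\<bar> ^ DIM('a)))) f"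
    using lborel_affine[OF c, of t] by (simp add: ennreal_power)
  also have "\<dots> \<longleftrightarrow> integrable lborel (\<lambda>x. \<bar>c\<bar> ^ DIM('a) *\<^sub>R f (t + c *\<^sub>R x))"
    using assms by (subst integrable_density) (auto simp: integrable_distr_eq)
  also have "\<dots> \<longleftrightarrow> integrable lborel (\<lambda>x. f (t + c *\<^sub>R x))"
    using c integrable_scaleR_right[of "inverse (\<bar>c\<bar> ^ DIM('a))" lborel "\<lambda>x. \<bar>c\<bar> ^ DIM('a) *\<^sub>R f (t + c *\<^sub>R x)"]
    by auto
  finally show "integrable lborel (\<lambda>x. f (t + c *\<^sub>R x)) \<longleftrightarrow> integrable lborel f" by simp
qed

lemma integral_partial_eq_0:
  fixes F :: "real^'n::finite \<Rightarrow> complex"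
  assumes d: "\<And>x. F differentiable (at x)"
    and F: "\<And>x. norm (F x) \<le> B / (1 + norm x) ^ (2 * CARD('n))"
    and F': "\<And>x. norm (partial i F x) \<le> B / (1 + norm x) ^ (2 * CARD('n))"
  shows "(LINT x|lborel. partial i F x) = 0"
proof -
  let ?w = "\<lambda>x::real^'n. 1 / (1 + norm x) ^ (2 * CARD('n))"
  define e :: "real^'n" where "e = axis i 1"
  have ne: "norm e = 1" by (simp add: e_def)
  define t where "t k = 1 / real (Suc k)" for k
  have t: "0 < t k" "t k \<le> 1" for k by (auto simp: t_def)
  define g where "g k x = (F (t k *\<^sub>R e + x) - F x) / of_real (t k)" for k x
  have "B \<ge> 0" using order_trans[OF norm_ge_zero F[of 0]] by simp
  have Fm [measurable]: "F \<in> borel_measurable borel"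
    using d by (intro borel_measurable_continuous_onI continuous_at_imp_continuous_on)
      (auto intro: differentiable_imp_continuous_within)
  have gm [measurable]: "g k \<in> borel_measurable borel" for k
    unfolding g_def by measurable
  have line: "((\<lambda>s. F (x + s *\<^sub>R e)) has_vector_derivative partial i F (x + s *\<^sub>R e)) (at s within S)" for x s S
  proof -
    have "((\<lambda>s. x + s *\<^sub>R e) has_derivative (\<lambda>r. r *\<^sub>R e)) (at s within S)"
      by (auto intro!: derivative_eq_intros)
    moreover have "(F has_derivative frechet_derivative F (at (x + s *\<^sub>R e))) (at (x + s *\<^sub>R e))"
      using d by (simp add: frechet_derivative_works)
    ultimately have "((\<lambda>s. F (x + s *\<^sub>R e)) has_derivative (\<lambda>r. frechet_derivative F (at (x + s *\<^sub>R e)) (r *\<^sub>R e))) (at s within S)"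
      by (rule has_derivative_compose)
    then show ?thesis
      using d by (simp add: has_vector_derivative_def partial_def e_def linear_cmul linear_frechet_derivative)
  qed
  have lim: "(\<lambda>k. g k x) \<longlonglongrightarrow> partial i F x" for x
  proof -
    have eq: "norm (F (x + h *\<^sub>R e) - F x - h *\<^sub>R partial i F x) / \<bar>h\<bar>
        = norm ((F (x + h *\<^sub>R e) - F x) / of_real h - partial i F x)" if "h \<noteq> 0" for h
    proof -
      have "(F (x + h *\<^sub>R e) - F x) / of_real h - partial i F x
        = (F (x + h *\<^sub>R e) - F x - h *\<^sub>R partial i F x) / of_real h"
        using that by (simp only: diff_divide_distrib scaleR_conv_of_real nonzero_mult_div_cancel_left of_real_eq_0_iff not_False_eq_True)
      then show ?thesis by (simp only: norm_divide norm_of_real real_norm_def)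
    qed
    have "((\<lambda>h. norm (F (x + h *\<^sub>R e) - F x - h *\<^sub>R partial i F x) / norm h) \<longlongrightarrow> 0) (at 0)"
      using line[of x 0 UNIV] unfolding has_vector_derivative_def has_derivative_at by simp
    then have "((\<lambda>h. norm ((F (x + h *\<^sub>R e) - F x) / of_real h - partial i F x)) \<longlongrightarrow> 0) (at 0)"
      by (rule Lim_transform_eventually) (auto simp: eventually_at_filter eq intro!: always_eventually)
    then have "((\<lambda>h. (F (x + h *\<^sub>R e) - F x) / of_real h) \<longlongrightarrow> partial i F x) (at 0)"
      by (simp only: tendsto_norm_zero_iff LIM_zero_iff)
    moreover have "filterlim t (at 0) sequentially"
      unfolding filterlim_at using LIMSEQ_inverse_real_of_nat t
      by (auto simp: t_def[abs_def] inverse_eq_divide)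
    ultimately show ?thesis
      unfolding g_def add.commute[of "t _ *\<^sub>R e"] by (rule filterlim_compose)
  qed
  have bound: "norm (g k x) \<le> B * 4 ^ CARD('n) / (1 + norm x) ^ (2 * CARD('n))" for k x
  proof -
    have "norm (F (x + t k *\<^sub>R e) - F (x + 0 *\<^sub>R e)) \<le> (B * 4 ^ CARD('n) / (1 + norm x) ^ (2 * CARD('n))) * norm (t k - 0)"
    proof (rule differentiable_bound[of "{0..1}" "\<lambda>s. F (x + s *\<^sub>R e)" "\<lambda>s r. r *\<^sub>R partial i F (x + s *\<^sub>R e)"])
      fix s :: real assume s: "s \<in> {0..1}"
      show "((\<lambda>s. F (x + s *\<^sub>R e)) has_derivative (\<lambda>r. r *\<^sub>R partial i F (x + s *\<^sub>R e))) (at s within {0..1})"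
        using line by (simp add: has_vector_derivative_def)
      have "norm x \<le> norm (x + s *\<^sub>R e) + norm (s *\<^sub>R e)"
        using norm_triangle_ineq4[of "x + s *\<^sub>R e" "s *\<^sub>R e"] by simp
      then have "1 + norm x \<le> 2 * (1 + norm (x + s *\<^sub>R e))"
        using s ne norm_ge_zero[of "x + s *\<^sub>R e"] by (simp del: norm_ge_zero)
      then have "(1 + norm x) ^ (2 * CARD('n)) \<le> (2 * (1 + norm (x + s *\<^sub>R e))) ^ (2 * CARD('n))"
        by (intro power_mono) auto
      also have "\<dots> = 4 ^ CARD('n) * (1 + norm (x + s *\<^sub>R e)) ^ (2 * CARD('n))"
        unfolding power_mult_distrib by (simp add: power_mult)
      finally have "B * (1 + norm x) ^ (2 * CARD('n)) \<le> B * 4 ^ CARD('n) * (1 + norm (x + s *\<^sub>R e)) ^ (2 * CARD('n))"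
        using \<open>B \<ge> 0\<close> by (simp only: mult.assoc mult_left_mono)
      moreover have "0 < (1 + norm x) ^ (2 * CARD('n))" "0 < (1 + norm (x + s *\<^sub>R e)) ^ (2 * CARD('n))"
        by (intro zero_less_power add_pos_nonneg; simp)+
      ultimately have "B / (1 + norm (x + s *\<^sub>R e)) ^ (2 * CARD('n)) \<le> B * 4 ^ CARD('n) / (1 + norm x) ^ (2 * CARD('n))"
        by (simp only: pos_le_divide_eq times_divide_eq_left pos_divide_le_eq)
      with F'[of "x + s *\<^sub>R e"] have "norm (partial i F (x + s *\<^sub>R e)) \<le> B * 4 ^ CARD('n) / (1 + norm x) ^ (2 * CARD('n))"
        by (rule order_trans)
      then show "onorm (\<lambda>r. r *\<^sub>R partial i F (x + s *\<^sub>R e)) \<le> B * 4 ^ CARD('n) / (1 + norm x) ^ (2 * CARD('n))"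
        by (intro onorm_le, unfold norm_scaleR real_norm_def, subst mult.commute) (rule mult_right_mono, simp_all)
    qed (use t[of k] in \<open>auto simp: less_imp_le\<close>)
    then show ?thesis
      using t[of k] by (simp add: g_def norm_divide divide_le_eq add.commute)
  qed
  have iw: "integrable lborel (\<lambda>x::real^'n. B * 4 ^ CARD('n) / (1 + norm x) ^ (2 * CARD('n)))"
    by (rule integrable_bound_decay(1)[where B = "B * 4 ^ CARD('n)"]) (use \<open>B \<ge> 0\<close> in auto)
  have "(\<lambda>k. LINT x|lborel. g k x) \<longlonglongrightarrow> (LINT x|lborel. partial i F x)"
  proof (rule integral_dominated_convergence[OF _ _ iw])
    show "partial i F \<in> borel_measurable lborel"
      using borel_measurable_LIMSEQ_metric[of g lborel "partial i F"] lim by simp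
  qed (use lim bound in auto)
  moreover have "(LINT x|lborel. g k x) = 0" for k
  proof -
    have FI: "integrable lborel F" by (rule integrable_bound_decay(1)[OF Fm F])
    have "integrable lborel (\<lambda>x. F (t k *\<^sub>R e + x))"
      using lborel_integrable_scale_iff[OF Fm, of 1 "t k *\<^sub>R e"] FI by simp
    then have "(LINT x|lborel. g k x) = ((LINT x|lborel. F (t k *\<^sub>R e + x)) - (LINT x|lborel. F x)) / of_real (t k)"
      unfolding g_def integral_divide_zero by (simp only: Bochner_Integration.integral_diff FI)
    also have "(LINT x|lborel. F (t k *\<^sub>R e + x)) = (LINT x|lborel. F x)"
      using lborel_integral_scale[OF Fm, of 1 "t k *\<^sub>R e"] by simp
    finally show ?thesis by simp
  qed
  ultimately show ?thesis using LIMSEQ_unique[OF _ tendsto_const, of 0] by simp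
qed

lemma has_derivative_iexp_inner:
  "((\<lambda>x::'a::real_inner. iexp (x \<bullet> \<xi>)) has_derivative (\<lambda>h. \<i> * of_real (h \<bullet> \<xi>) * iexp (x \<bullet> \<xi>))) (at x)"
proof -
  have "((\<lambda>x::'a. \<i> * complex_of_real (x \<bullet> \<xi>)) has_derivative (\<lambda>h. \<i> * of_real (h \<bullet> \<xi>))) (at x)"
    by (auto intro!: derivative_eq_intros)
  from has_derivative_compose[OF this DERIV_exp[unfolded has_field_derivative_def]]
  show ?thesis by (simp add: mult.commute)
qed

lemma inv_fourier_by_parts:
  fixes \<theta> :: "real^'n::finite \<Rightarrow> complex"
  assumes \<theta>: "\<theta> \<in> schwartz"
  shows "inv_fourier (partial k \<theta>) \<xi> = - (\<i> * of_real (\<xi> $ k)) * inv_fourier \<theta> \<xi>"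
proof -
  let ?d = "2 * CARD('n)"
  define F where "F x = \<theta> x * iexp (x \<bullet> \<xi>)" for x
  have \<theta>': "partial k \<theta> \<in> schwartz"
    using schwartz_partials[OF \<theta>, of "[k]"] by (simp add: partials_def)
  have d: "\<theta> differentiable (at x)" for x
    using smooth_on_differentiable[of UNIV \<theta>] \<theta> by auto
  have e: "(\<lambda>x. iexp (x \<bullet> \<xi>)) differentiable (at x)" for x
    using has_derivative_iexp_inner by (auto simp: differentiable_def)
  have pe: "partial k (\<lambda>x. iexp (x \<bullet> \<xi>)) x = \<i> * of_real (\<xi> $ k) * iexp (x \<bullet> \<xi>)" for x
    using partial_eqI[OF has_derivative_iexp_inner, of k \<xi> x] by (simp add: inner_axis')
  have pF: "partial k F x = partial k \<theta> x * iexp (x \<bullet> \<xi>) + \<i> * of_real (\<xi> $ k) * (\<theta> x * iexp (x \<bullet> \<xi>))" for x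
    unfolding F_def partial_mult[OF d e] pe by (simp add: mult_ac)
  define s where "s = schwartz_seminorm ?d 0 (partial k \<theta>) + (1 + norm \<xi>) * schwartz_seminorm ?d 0 \<theta>"
  have b: "norm (\<theta> x) \<le> schwartz_seminorm ?d 0 \<theta> / (1 + norm x) ^ ?d"
    "norm (partial k \<theta> x) \<le> schwartz_seminorm ?d 0 (partial k \<theta>) / (1 + norm x) ^ ?d" for x
    using schwartz_decay[OF \<theta>, of x 0] schwartz_decay[OF \<theta>', of x 0] by simp_all
  have nn: "0 \<le> schwartz_seminorm ?d 0 \<theta>" "0 \<le> schwartz_seminorm ?d 0 (partial k \<theta>)"
    using schwartz_seminorm_nonneg[OF \<theta>] schwartz_seminorm_nonneg[OF \<theta>'] by auto
  have i: "integrable lborel (\<lambda>x. partial k \<theta> x * iexp (x \<bullet> \<xi>))" "integrable lborel (\<lambda>x. \<theta> x * iexp (x \<bullet> \<xi>))"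
    using integrable_fourier_rem[OF \<theta>, of 0] integrable_fourier_rem[OF \<theta>', of 0] by simp_all
  have "0 = (LINT x|lborel. partial k F x)"
  proof (rule integral_partial_eq_0[symmetric, where B = s])
    show "F differentiable (at x)" for x
      unfolding F_def using d e by (intro differentiable_mult)
    show "norm (F x) \<le> s / (1 + norm x) ^ ?d" for x
    proof -
      have "norm (F x) \<le> schwartz_seminorm ?d 0 \<theta> / (1 + norm x) ^ ?d"
        using b(1)[of x] by (simp add: F_def norm_mult)
      also have "\<dots> \<le> s / (1 + norm x) ^ ?d"
        using nn by (intro divide_right_mono) (auto simp: s_def algebra_simps)
      finally show ?thesis .
    qed
    show "norm (partial k F x) \<le> s / (1 + norm x) ^ ?d" for x
    proof -
      have "norm (partial k F x) \<le> norm (partial k \<theta> x) + \<bar>\<xi> $ k\<bar> * norm (\<theta> x)"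
        unfolding pF by (rule order_trans[OF norm_triangle_ineq]) (simp add: norm_mult)
      also have "\<dots> \<le> schwartz_seminorm ?d 0 (partial k \<theta>) / (1 + norm x) ^ ?d
          + (1 + norm \<xi>) * (schwartz_seminorm ?d 0 \<theta> / (1 + norm x) ^ ?d)"
        using component_le_norm_cart[of \<xi> k] by (intro add_mono mult_mono b) auto
      also have "\<dots> = s / (1 + norm x) ^ ?d" by (simp add: s_def add_divide_distrib)
      finally show ?thesis .
    qed
  qed
  also have "\<dots> = (LINT x|lborel. partial k \<theta> x * iexp (x \<bullet> \<xi>))
      + \<i> * of_real (\<xi> $ k) * (LINT x|lborel. \<theta> x * iexp (x \<bullet> \<xi>))"
    unfolding pF using i by (simp only: Bochner_Integration.integral_add integrable_mult_right integral_mult_right_zero)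
  finally have "(LINT x|lborel. partial k \<theta> x * iexp (x \<bullet> \<xi>))
      = - (\<i> * of_real (\<xi> $ k)) * (LINT x|lborel. \<theta> x * iexp (x \<bullet> \<xi>))"
    by (simp only: mult_minus_left eq_neg_iff_add_eq_0)
  then show ?thesis
    by (simp only: fourier_rem_0[symmetric] fourier_rem_def exp_rem_0 mult_ac)
qed

lemma norm_inv_fourier_power:
  assumes "\<theta> \<in> schwartz"
  shows "\<bar>\<xi> $ k\<bar> ^ N * norm (inv_fourier \<theta> \<xi>) = norm (inv_fourier (partials (replicate N k) \<theta>) \<xi>)"
proof (induction N)
  case (Suc N)
  then show ?case
    using inv_fourier_by_parts[OF schwartz_partials[OF assms], of k "replicate N k" \<xi>]
    by (simp add: partials_Cons norm_mult)
qed simp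

lemma norm_inv_fourier_le:
  obtains B where "0 \<le> B" "\<And>(\<theta> :: real^'n::finite \<Rightarrow> complex) \<xi>. \<theta> \<in> schwartz \<Longrightarrow>
    norm (inv_fourier \<theta> \<xi>) \<le> B * schwartz_seminorm (2 * CARD('n)) 0 \<theta>"
proof -
  let ?W = "LINT x::real^'n|lborel. 1 / (1 + norm x) ^ (2 * CARD('n))"
  have "norm (inv_fourier \<theta> \<xi>) \<le> (fourier_const TYPE('n) * ?W) * schwartz_seminorm (2 * CARD('n)) 0 \<theta>"
    if \<theta>: "\<theta> \<in> schwartz" for \<theta> :: "real^'n \<Rightarrow> complex" and \<xi>
  proof -
    have "norm (LINT x|lborel. norm (\<theta> x)) \<le> schwartz_seminorm (2 * CARD('n)) 0 \<theta> * ?W"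
      using schwartz_decay[OF \<theta>, of _ 0] schwartz_measurable[OF \<theta>]
      by (intro integrable_bound_decay(2)) auto
    then have "fourier_const TYPE('n) * (LINT x|lborel. norm (\<theta> x)) \<le> fourier_const TYPE('n) * (schwartz_seminorm (2 * CARD('n)) 0 \<theta> * ?W)"
      by (intro mult_left_mono) auto
    moreover have "norm (inv_fourier \<theta> \<xi>) \<le> fourier_const TYPE('n) * (LINT x|lborel. norm (\<theta> x))"
      using norm_fourier_rem_le[OF \<theta>, of 0 \<xi>] by (simp add: fourier_rem_0)
    ultimately show ?thesis by (simp only: mult_ac)
  qed
  then show ?thesis using that[of "fourier_const TYPE('n) * ?W"] by simp
qed

lemma power_norm_le_sum:
  fixes \<xi> :: "real^'n::finite"
  shows "(1 + norm \<xi>) ^ N \<le> (1 + real CARD('n)) ^ N * (1 + (\<Sum>k\<in>UNIV. \<bar>\<xi> $ k\<bar> ^ N))"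
proof -
  obtain k where k: "\<And>i. \<bar>\<xi> $ i\<bar> \<le> \<bar>\<xi> $ k\<bar>"
    using Max_in[of "range (\<lambda>i. \<bar>\<xi> $ i\<bar>)"] Max_ge[of "range (\<lambda>i. \<bar>\<xi> $ i\<bar>)"] by fastforce
  define M where "M = max 1 \<bar>\<xi> $ k\<bar>"
  have "norm \<xi> \<le> (\<Sum>i\<in>UNIV. \<bar>\<xi> $ i\<bar>)" by (rule norm_le_l1_cart)
  also have "\<dots> \<le> (\<Sum>i\<in>(UNIV::'n set). M)" using k by (intro sum_mono) (auto simp: M_def le_max_iff_disj)
  also have "\<dots> = real CARD('n) * M" by simp
  finally have "1 + norm \<xi> \<le> (1 + real CARD('n)) * M"
    by (simp add: algebra_simps M_def)
  then have "(1 + norm \<xi>) ^ N \<le> (1 + real CARD('n)) ^ N * M ^ N"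
    unfolding power_mult_distrib[symmetric] by (intro power_mono) auto
  also have "M ^ N \<le> 1 + \<bar>\<xi> $ k\<bar> ^ N" by (auto simp: M_def max_def)
  also have "\<bar>\<xi> $ k\<bar> ^ N \<le> (\<Sum>k\<in>UNIV. \<bar>\<xi> $ k\<bar> ^ N)" by (rule member_le_sum) auto
  finally show ?thesis by (simp add: mult_left_mono)
qed

lemma continuous_op_inv_fourier: "continuous_op (inv_fourier :: (real^'n::finite \<Rightarrow> complex) \<Rightarrow> _)"
proof (rule continuous_opI)
  fix \<psi> :: "real^'n \<Rightarrow> complex" assume "\<psi> \<in> schwartz"
  then show "smooth_on UNIV (inv_fourier \<psi>)"
    unfolding fourier_rem_0[symmetric] by (rule smooth_on_fourier_rem)
next
  fix N and "is" :: "'n list"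
  let ?d = "2 * CARD('n)"
  let ?T = "\<lambda>\<psi> (x::real^'n). \<i> ^ length is * (coord_power is x * \<psi> x)"
  obtain B where B: "0 \<le> B" "\<And>(\<theta> :: real^'n \<Rightarrow> complex) \<xi>. \<theta> \<in> schwartz \<Longrightarrow>
    norm (inv_fourier \<theta> \<xi>) \<le> B * schwartz_seminorm ?d 0 \<theta>"
    using norm_inv_fourier_le by blast
  have "continuous_op ?T"
    by (rule continuous_op_comp[OF continuous_op_coord_power continuous_op_mult[OF slow_growth_const]])
  then obtain M C where C: "0 \<le> C"
    "\<And>\<psi>. \<psi> \<in> schwartz \<Longrightarrow> schwartz_seminorm ?d N (?T \<psi>) \<le> C * schwartz_seminorm M M \<psi>"
    by (rule continuous_opE[where N = ?d and m = N]) blast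
  let ?K = "(1 + real CARD('n)) ^ N * (1 + real CARD('n)) * B * C"
  have "(1 + norm \<xi>) ^ N * norm (partials is (inv_fourier \<psi>) \<xi>) \<le> ?K * schwartz_seminorm M M \<psi>"
    if \<psi>: "\<psi> \<in> schwartz" for \<psi> \<xi>
  proof -
    define \<theta> where "\<theta> = ?T \<psi>"
    have \<theta>: "\<theta> \<in> schwartz" unfolding \<theta>_def by (intro schwartz_cmult schwartz_coord_power \<psi>)
    have p: "partials is (inv_fourier \<psi>) = inv_fourier \<theta>"
      using partials_fourier_rem[OF \<psi>, of "is" 0] by (simp add: fourier_rem_0 \<theta>_def)
    have le: "schwartz_seminorm ?d 0 (partials js \<theta>) \<le> schwartz_seminorm ?d N \<theta>" if "length js \<le> N" for js
      by (rule schwartz_seminorm_le) (use schwartz_seminorm_ge[OF \<theta> that] in simp)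
    have 1: "\<bar>\<xi> $ k\<bar> ^ N * norm (inv_fourier \<theta> \<xi>) \<le> B * schwartz_seminorm ?d N \<theta>" for k
      unfolding norm_inv_fourier_power[OF \<theta>]
      by (rule order_trans[OF B(2)[OF schwartz_partials[OF \<theta>]]]) (intro mult_left_mono le B, simp)
    have 0: "norm (inv_fourier \<theta> \<xi>) \<le> B * schwartz_seminorm ?d N \<theta>"
      by (rule order_trans[OF B(2)[OF \<theta>]]) (intro mult_left_mono schwartz_seminorm_mono \<theta> B; simp)
    have "(1 + norm \<xi>) ^ N * norm (inv_fourier \<theta> \<xi>)
      \<le> (1 + real CARD('n)) ^ N * (1 + (\<Sum>k\<in>UNIV. \<bar>\<xi> $ k\<bar> ^ N)) * norm (inv_fourier \<theta> \<xi>)"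
      by (intro mult_right_mono power_norm_le_sum) simp
    also have "\<dots> = (1 + real CARD('n)) ^ N * (norm (inv_fourier \<theta> \<xi>) + (\<Sum>k\<in>UNIV. \<bar>\<xi> $ k\<bar> ^ N * norm (inv_fourier \<theta> \<xi>)))"
      by (simp add: distrib_left distrib_right sum_distrib_right mult.assoc)
    also have "\<dots> \<le> (1 + real CARD('n)) ^ N * (B * schwartz_seminorm ?d N \<theta> + (\<Sum>k\<in>(UNIV::'n set). B * schwartz_seminorm ?d N \<theta>))"
      by (intro mult_left_mono add_mono sum_mono 0 1) simp
    also have "\<dots> = (1 + real CARD('n)) ^ N * (1 + real CARD('n)) * B * schwartz_seminorm ?d N \<theta>"
      by (simp add: algebra_simps)
    also have "\<dots> \<le> (1 + real CARD('n)) ^ N * (1 + real CARD('n)) * B * (C * schwartz_seminorm M M \<psi>)"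
      unfolding \<theta>_def by (intro mult_left_mono C \<psi>) (use B in auto)
    finally show ?thesis by (simp add: p mult.assoc)
  qed
  then show "\<exists>N' C. \<forall>\<psi>\<in>schwartz. \<forall>x. (1 + norm x) ^ N * norm (partials is (inv_fourier \<psi>) x)
      \<le> C * schwartz_seminorm N' N' \<psi>" by blast
qed

lemma fourier_eq_inv_fourier: "fourier \<psi> \<xi> = inv_fourier \<psi> (- \<xi>)"
  by (simp add: fourier_def inv_fourier_def inner_commute)

lemma continuous_op_fourier: "continuous_op (fourier :: (real^'n::finite \<Rightarrow> complex) \<Rightarrow> _)"
  using continuous_op_comp[OF continuous_op_inv_fourier continuous_op_reflect]
  by (simp add: fourier_eq_inv_fourier[abs_def])

section \<open>Fourier inversion\<close>

lemma
  shows integrable_gauss_real: "integrable lborel (\<lambda>x. iexp (t * x) * of_real (exp (- x\<^sup>2 / 2)))"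
    and integral_gauss_real: "(LINT x|lborel. iexp (t * x) * of_real (exp (- x\<^sup>2 / 2)))
      = of_real (sqrt (2 * pi) * exp (- t\<^sup>2 / 2))"
proof -
  have eq: "iexp (t * x) * of_real (exp (- x\<^sup>2 / 2)) = of_real (sqrt (2 * pi)) * (std_normal_density x *\<^sub>R iexp (t * x))" for x
    by (simp add: std_normal_density_def scaleR_conv_of_real)
  interpret real_distribution std_normal_distribution by (rule real_dist_normal_dist)
  have "integrable std_normal_distribution (\<lambda>x. iexp (t * x))"
    by (rule integrable_iexp) simp_all
  then have i: "integrable lborel (\<lambda>x. std_normal_density x *\<^sub>R iexp (t * x))"
    by (subst (asm) integrable_density) auto
  then show "integrable lborel (\<lambda>x. iexp (t * x) * of_real (exp (- x\<^sup>2 / 2)))"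
    unfolding eq by (intro integrable_mult_right)
  have "(LINT x|lborel. std_normal_density x *\<^sub>R iexp (t * x)) = of_real (exp (- t\<^sup>2 / 2))"
    using char_std_normal_distribution unfolding char_def fun_eq_iff
    by (subst (asm) integral_density) auto
  then show "(LINT x|lborel. iexp (t * x) * of_real (exp (- x\<^sup>2 / 2)))
      = of_real (sqrt (2 * pi) * exp (- t\<^sup>2 / 2))"
    unfolding eq integral_mult_right_zero by simp
qed

definition gauss :: "'a::euclidean_space \<Rightarrow> real" where
  "gauss x = exp (- (norm x)\<^sup>2 / 2)"

lemma gauss_measurable [measurable]: "gauss \<in> borel_measurable borel"
  unfolding gauss_def by measurable

lemma gauss_bounds: "0 < gauss x" "gauss x \<le> 1"
  by (simp_all add: gauss_def)

lemma abs_gauss [simp]: "\<bar>gauss x\<bar> = gauss x"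
  by (simp add: gauss_def)

lemma gauss_prod: "gauss x = (\<Prod>b\<in>Basis. exp (- (x \<bullet> b)\<^sup>2 / 2))"
proof -
  have "- (norm x)\<^sup>2 / 2 = (\<Sum>b\<in>Basis. - (x \<bullet> b)\<^sup>2 / 2)"
    unfolding power2_norm_eq_inner euclidean_inner[of x x]
    by (simp add: sum_negf sum_divide_distrib power2_eq_square)
  then show ?thesis by (simp add: gauss_def exp_sum)
qed

lemma
  fixes u :: "'a::euclidean_space"
  shows integrable_iexp_gauss: "integrable lborel (\<lambda>x. iexp (u \<bullet> x) * of_real (gauss x))"
    and integral_iexp_gauss: "(LINT x|lborel. iexp (u \<bullet> x) * of_real (gauss x))
      = of_real (sqrt (2 * pi) ^ DIM('a) * gauss u)"
proof -
  have eq: "iexp (u \<bullet> x) * of_real (gauss x)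
      = (\<Prod>b\<in>Basis. iexp ((u \<bullet> b) * (x \<bullet> b)) * of_real (exp (- (x \<bullet> b)\<^sup>2 / 2)))" for x
    unfolding euclidean_inner[of u x] gauss_prod
    by (simp only: of_real_sum sum_distrib_left exp_sum finite_Basis prod.distrib of_real_prod)
  have "(\<Prod>b\<in>(Basis::'a set). complex_of_real (sqrt (2 * pi) * exp (- (u \<bullet> b)\<^sup>2 / 2)))
      = of_real (sqrt (2 * pi) ^ DIM('a) * gauss u)"
    unfolding gauss_prod by (simp only: of_real_prod prod.distrib of_real_mult prod_constant of_real_power)
  moreover note prod = integrable_lborel_prod integral_lborel_prod
  note prod = prod[where f = "\<lambda>b s. iexp ((u \<bullet> b) * s) * of_real (exp (- s\<^sup>2 / 2))", OF integrable_gauss_real]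
  ultimately show "integrable lborel (\<lambda>x. iexp (u \<bullet> x) * of_real (gauss x))"
    "(LINT x|lborel. iexp (u \<bullet> x) * of_real (gauss x)) = of_real (sqrt (2 * pi) ^ DIM('a) * gauss u)"
    unfolding eq using prod by (simp_all only: integral_gauss_real)
qed

lemma integrable_gauss: "integrable lborel (gauss :: 'a::euclidean_space \<Rightarrow> real)"
  using integrable_norm[OF integrable_iexp_gauss[of "0::'a"]] by (simp add: gauss_def[abs_def])

lemma fourier_const_inverse: "fourier_const TYPE('n::finite) * sqrt (2 * pi) ^ DIM(real^'n) = 1"
proof -
  have "sqrt (2 * pi) ^ DIM(real^'n) = (2 * pi) powr (1/2 * real CARD('n))"
    by (simp add: powr_half_sqrt[symmetric] powr_powr powr_realpow[symmetric])
  then show ?thesis by (simp add: powr_add[symmetric])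
qed

theorem fourier_inversion:
  fixes \<psi> :: "real^'n::finite \<Rightarrow> complex"
  assumes \<psi>: "\<psi> \<in> schwartz"
  shows "fourier (inv_fourier \<psi>) = \<psi>"
proof
  fix y
  let ?c = "complex_of_real (fourier_const TYPE('n))"
  let ?G = "complex_of_real (sqrt (2 * pi) ^ DIM(real^'n))"
  have cG: "?c * ?G = 1"
    using fourier_const_inverse[where 'n='n] by (simp only: of_real_mult[symmetric] of_real_1)
  define w where "w = inv_fourier \<psi>"
  have w: "w \<in> schwartz" unfolding w_def by (rule continuous_op_schwartz[OF continuous_op_inv_fourier \<psi>])
  note [measurable] = schwartz_measurable[OF \<psi>] schwartz_measurable[OF w]
  define e where "e k = 1 / real (Suc k)" for k
  have e: "e k > 0" for k by (simp add: e_def)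
  have e0: "e \<longlonglongrightarrow> 0" using LIMSEQ_inverse_real_of_nat by (simp add: e_def[abs_def] inverse_eq_divide)
  have main: "(LINT \<xi>|lborel. w \<xi> * iexp (- (y \<bullet> \<xi>)) * of_real (gauss (e k *\<^sub>R \<xi>)))
      = (LINT z|lborel. \<psi> (y + e k *\<^sub>R z) * of_real (gauss z))" for k
  proof -
    define \<epsilon> where "\<epsilon> = e k"
    have \<epsilon>: "\<epsilon> > 0" "\<epsilon> \<noteq> 0" using e[of k] by (simp_all add: \<epsilon>_def)
    define f where "f x \<xi> = \<psi> x * (iexp ((x - y) \<bullet> \<xi>) * of_real (gauss (\<epsilon> *\<^sub>R \<xi>)))" for x \<xi>
    have ig: "integrable lborel (\<lambda>\<xi>::real^'n. gauss (\<epsilon> *\<^sub>R \<xi>))"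
      using lborel_integrable_scale_iff[of "gauss :: real^'n \<Rightarrow> real" \<epsilon> 0] integrable_gauss \<epsilon> by simp
    have f2: "integrable lborel (f x)" for x
      unfolding f_def
      by (intro integrable_mult_right Bochner_Integration.integrable_bound[OF ig])
        (auto simp: norm_mult)
    have nf: "norm (f x \<xi>) = norm (\<psi> x) * gauss (\<epsilon> *\<^sub>R \<xi>)" for x \<xi>
      using gauss_bounds(1)[of "\<epsilon> *\<^sub>R \<xi>"] by (simp add: f_def norm_mult)
    have "integrable (lborel \<Otimes>\<^sub>M lborel) (case_prod f)"
    proof (rule lborel_pair.Fubini_integrable)
      show "case_prod f \<in> borel_measurable (lborel \<Otimes>\<^sub>M lborel)"
        unfolding f_def by measurable
      show "integrable lborel (\<lambda>x. LINT \<xi>|lborel. norm (case (x, \<xi>) of (x, \<xi>) \<Rightarrow> f x \<xi>))"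
        unfolding prod.case nf integral_mult_right_zero
        using integrable_schwartz_moment[OF \<psi>, of 0] by (intro integrable_mult_left) simp
    qed (use f2 in auto)
    then have fub: "(LINT \<xi>|lborel. LINT x|lborel. f x \<xi>) = (LINT x|lborel. LINT \<xi>|lborel. f x \<xi>)"
      by (rule lborel_pair.Fubini_integral)
    have "w \<xi> * iexp (- (y \<bullet> \<xi>)) * of_real (gauss (\<epsilon> *\<^sub>R \<xi>)) = ?c * (LINT x|lborel. f x \<xi>)" for \<xi>
    proof -
      have "f x \<xi> = (\<psi> x * iexp (x \<bullet> \<xi>)) * (iexp (- (y \<bullet> \<xi>)) * of_real (gauss (\<epsilon> *\<^sub>R \<xi>)))" for x
        by (simp add: f_def inner_diff_left algebra_simps exp_diff exp_minus divide_inverse)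
      then have "(LINT x|lborel. f x \<xi>)
          = (LINT x|lborel. \<psi> x * iexp (x \<bullet> \<xi>)) * (iexp (- (y \<bullet> \<xi>)) * of_real (gauss (\<epsilon> *\<^sub>R \<xi>)))"
        by (simp only: integral_mult_left_zero)
      then show ?thesis
        by (simp only: w_def fourier_rem_0[symmetric] fourier_rem_def exp_rem_0 mult.assoc)
    qed
    then have s1: "(LINT \<xi>|lborel. w \<xi> * iexp (- (y \<bullet> \<xi>)) * of_real (gauss (\<epsilon> *\<^sub>R \<xi>)))
      = ?c * (LINT x|lborel. LINT \<xi>|lborel. f x \<xi>)"
      by (simp only: integral_mult_right_zero fub)
    have s2: "(LINT \<xi>|lborel. f x \<xi>) = of_real (inverse \<epsilon> ^ DIM(real^'n)) * (?G * (\<psi> x * of_real (gauss ((x - y) /\<^sub>R \<epsilon>))))" for x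
    proof -
      have "(LINT \<xi>|lborel. iexp ((x - y) \<bullet> \<xi>) * of_real (gauss (\<epsilon> *\<^sub>R \<xi>)))
        = \<bar>inverse \<epsilon>\<bar> ^ DIM(real^'n) *\<^sub>R (LINT \<xi>|lborel. iexp ((x - y) \<bullet> (0 + inverse \<epsilon> *\<^sub>R \<xi>)) * of_real (gauss (\<epsilon> *\<^sub>R (0 + inverse \<epsilon> *\<^sub>R \<xi>))))"
        by (rule lborel_integral_scale) (use \<epsilon> in \<open>measurable, simp\<close>)
      also have "\<dots> = of_real (inverse \<epsilon> ^ DIM(real^'n)) * (LINT \<xi>|lborel. iexp (((x - y) /\<^sub>R \<epsilon>) \<bullet> \<xi>) * of_real (gauss \<xi>))"
        using \<epsilon> by (subst scaleR_conv_of_real) simp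
      also have "(LINT \<xi>|lborel. iexp (((x - y) /\<^sub>R \<epsilon>) \<bullet> \<xi>) * of_real (gauss \<xi>)) = ?G * of_real (gauss ((x - y) /\<^sub>R \<epsilon>))"
        unfolding integral_iexp_gauss by simp
      finally show ?thesis unfolding f_def integral_mult_right_zero by (simp only: mult_ac)
    qed
    have s3: "?c * (LINT x|lborel. of_real (inverse \<epsilon> ^ DIM(real^'n)) * (?G * (\<psi> x * of_real (gauss ((x - y) /\<^sub>R \<epsilon>)))))
      = of_real (inverse \<epsilon> ^ DIM(real^'n)) * (LINT x|lborel. \<psi> x * of_real (gauss ((x - y) /\<^sub>R \<epsilon>)))"
      unfolding integral_mult_right_zero using cG by (simp add: mult_ac)
    have s4: "(LINT x|lborel. \<psi> x * of_real (gauss ((x - y) /\<^sub>R \<epsilon>)))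
      = \<bar>\<epsilon>\<bar> ^ DIM(real^'n) *\<^sub>R (LINT z|lborel. \<psi> (y + \<epsilon> *\<^sub>R z) * of_real (gauss ((y + \<epsilon> *\<^sub>R z - y) /\<^sub>R \<epsilon>)))"
    proof (rule lborel_integral_scale)
      have "(\<lambda>x::real^'n. gauss ((x - y) /\<^sub>R \<epsilon>)) \<in> borel_measurable borel"
        by (rule measurable_compose[OF _ gauss_measurable]) simp
      then show "(\<lambda>x. \<psi> x * of_real (gauss ((x - y) /\<^sub>R \<epsilon>))) \<in> borel_measurable borel"
        by measurable
    qed (use \<epsilon> in simp)
    have s5: "of_real (inverse \<epsilon> ^ DIM(real^'n)) * (\<bar>\<epsilon>\<bar> ^ DIM(real^'n) *\<^sub>R (LINT z|lborel. \<psi> (y + \<epsilon> *\<^sub>R z) * of_real (gauss ((y + \<epsilon> *\<^sub>R z - y) /\<^sub>R \<epsilon>))))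
      = (LINT z|lborel. \<psi> (y + \<epsilon> *\<^sub>R z) * of_real (gauss z))"
      using \<epsilon> by (subst scaleR_conv_of_real) (simp add: power_inverse)
    show ?thesis
      using s1 unfolding s2 s3 s4 s5 by (simp only: \<epsilon>_def)
  qed
  have g0: "(\<lambda>k. gauss (e k *\<^sub>R \<xi>)) \<longlonglongrightarrow> 1" for \<xi> :: "real^'n"
    unfolding gauss_def by (rule tendsto_eq_intros refl e0 | simp)+
  have "(\<lambda>k. LINT \<xi>|lborel. w \<xi> * iexp (- (y \<bullet> \<xi>)) * of_real (gauss (e k *\<^sub>R \<xi>)))
      \<longlonglongrightarrow> (LINT \<xi>|lborel. w \<xi> * iexp (- (y \<bullet> \<xi>)) * of_real 1)"
  proof (rule integral_dominated_convergence[where w = "\<lambda>\<xi>. norm (w \<xi>)"])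
    show "integrable lborel (\<lambda>\<xi>. norm (w \<xi>))"
      using integrable_schwartz_moment[OF w, of 0] by simp
    show "AE \<xi> in lborel. (\<lambda>k. w \<xi> * iexp (- (y \<bullet> \<xi>)) * of_real (gauss (e k *\<^sub>R \<xi>))) \<longlonglongrightarrow> w \<xi> * iexp (- (y \<bullet> \<xi>)) * of_real 1"
      by (intro AE_I2 tendsto_intros tendsto_of_real g0)
    show "AE \<xi> in lborel. norm (w \<xi> * iexp (- (y \<bullet> \<xi>)) * of_real (gauss (e k *\<^sub>R \<xi>))) \<le> norm (w \<xi>)" for k
      by (intro AE_I2) (simp add: norm_mult mult_left_le gauss_bounds)
  qed measurable
  moreover have "(\<lambda>k. LINT z|lborel. \<psi> (y + e k *\<^sub>R z) * of_real (gauss z)) \<longlonglongrightarrow> (LINT z::real^'n|lborel. \<psi> y * of_real (gauss z))"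
  proof (rule integral_dominated_convergence[where w = "\<lambda>z::real^'n. schwartz_seminorm 0 0 \<psi> * gauss z"])
    show "integrable lborel (\<lambda>z::real^'n. schwartz_seminorm 0 0 \<psi> * gauss z)"
      by (intro integrable_mult_right integrable_gauss)
    have "(\<lambda>k. y + e k *\<^sub>R z) \<longlonglongrightarrow> y" for z
      by (rule tendsto_eq_intros refl e0 | simp)+
    then have "(\<lambda>k. \<psi> (y + e k *\<^sub>R z)) \<longlonglongrightarrow> \<psi> y" for z
      by (rule isCont_tendsto_compose[OF schwartz_isCont[OF \<psi>]])
    then show "AE z::real^'n in lborel. (\<lambda>k. \<psi> (y + e k *\<^sub>R z) * of_real (gauss z)) \<longlonglongrightarrow> \<psi> y * of_real (gauss z)"
      by (intro AE_I2 tendsto_mult tendsto_const)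
    show "AE z::real^'n in lborel. norm (\<psi> (y + e k *\<^sub>R z) * of_real (gauss z)) \<le> schwartz_seminorm 0 0 \<psi> * gauss z" for k
      using schwartz_seminorm_ge[OF \<psi>, of "[]" 0 _ 0]
      by (intro AE_I2) (simp add: norm_mult mult_right_mono less_imp_le gauss_bounds)
  qed measurable
  ultimately have "(LINT \<xi>|lborel. w \<xi> * iexp (- (y \<bullet> \<xi>)) * of_real 1) = (LINT z::real^'n|lborel. \<psi> y * of_real (gauss z))"
    unfolding main by (rule LIMSEQ_unique)
  moreover have "(LINT z|lborel. complex_of_real (gauss (z::real^'n))) = ?G"
    using integral_iexp_gauss[of "0::real^'n"] by (simp add: gauss_def)
  ultimately have "(LINT \<xi>|lborel. w \<xi> * iexp (- (y \<bullet> \<xi>))) = \<psi> y * ?G"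
    unfolding integral_mult_right_zero by simp
  then have "?c * (LINT \<xi>|lborel. w \<xi> * iexp (- (y \<bullet> \<xi>))) = \<psi> y * (?c * ?G)"
    by (simp only: mult_ac)
  then show "fourier (inv_fourier \<psi>) y = \<psi> y"
    unfolding cG fourier_def w_def by (simp add: inner_commute[of y])
qed

section \<open>Tempered distributions\<close>

lemma temperedD:
  assumes "u \<in> tempered"
  shows "u \<in> extensional schwartz"
    and "\<psi> \<in> schwartz \<Longrightarrow> \<theta> \<in> schwartz \<Longrightarrow> u (\<lambda>x. \<psi> x + \<theta> x) = u \<psi> + u \<theta>"
    and "\<psi> \<in> schwartz \<Longrightarrow> u (\<lambda>x. c * \<psi> x) = c * u \<psi>"
  using assms by (auto simp: tempered_def)

lemma temperedE:
  assumes "u \<in> tempered"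
  obtains N C where "0 \<le> C" "\<And>\<psi>. \<psi> \<in> schwartz \<Longrightarrow> norm (u \<psi>) \<le> C * schwartz_seminorm N N \<psi>"
proof -
  obtain N C where NC: "\<And>\<psi>. \<psi> \<in> schwartz \<Longrightarrow> norm (u \<psi>) \<le> C * schwartz_seminorm N N \<psi>"
    using assms unfolding tempered_def by blast
  show ?thesis
  proof (rule that[of "\<bar>C\<bar>" N])
    fix \<psi> :: "real^'a \<Rightarrow> complex" assume \<psi>: "\<psi> \<in> schwartz"
    show "norm (u \<psi>) \<le> \<bar>C\<bar> * schwartz_seminorm N N \<psi>"
      by (rule order_trans[OF NC[OF \<psi>]]) (intro mult_right_mono schwartz_seminorm_nonneg \<psi>, simp)
  qed simp
qed

lemma temperedI:
  assumes "u \<in> extensional schwartz"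
    and "\<And>\<psi> \<theta>. \<psi> \<in> schwartz \<Longrightarrow> \<theta> \<in> schwartz \<Longrightarrow> u (\<lambda>x. \<psi> x + \<theta> x) = u \<psi> + u \<theta>"
    and "\<And>c \<psi>. \<psi> \<in> schwartz \<Longrightarrow> u (\<lambda>x. c * \<psi> x) = c * u \<psi>"
    and "\<And>\<psi>. \<psi> \<in> schwartz \<Longrightarrow> norm (u \<psi>) \<le> C * schwartz_seminorm N N \<psi>"
  shows "u \<in> tempered"
  using assms unfolding tempered_def by blast

lemma tempered_sum:
  assumes u: "u \<in> tempered" and \<psi>: "\<And>k. k \<in> F \<Longrightarrow> \<psi> k \<in> schwartz"
  shows "u (\<lambda>x. \<Sum>k\<in>F. \<psi> k x) = (\<Sum>k\<in>F. u (\<psi> k))"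
  using \<psi>
proof (induction F rule: infinite_finite_induct)
  have "u (\<lambda>x. 0 * 0) = 0 * u (\<lambda>x. 0)"
    by (rule temperedD(3)[OF u]) (auto simp: schwartz_iff partials_const)
  then have z: "u (\<lambda>x. 0) = 0" by simp
  {
    case (infinite A)
    then show ?case using z by simp
  next
    case empty
    then show ?case using z by simp
  next
    case (insert k F)
    then show ?case
      using temperedD(2)[OF u, of "\<psi> k" "\<lambda>x. \<Sum>k\<in>F. \<psi> k x"] by (simp add: schwartz_sum)
  }
qed

lemma tempered_diff:
  assumes u: "u \<in> tempered" and \<psi>: "\<psi> \<in> schwartz" and \<theta>: "\<theta> \<in> schwartz"
  shows "u (\<lambda>x. \<psi> x - \<theta> x) = u \<psi> - u \<theta>"
  using temperedD(2)[OF u \<psi> schwartz_cmult[OF \<theta>, of "-1"]] temperedD(3)[OF u \<theta>, of "-1"] by simp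

lemma tempered_comp:
  assumes u: "u \<in> tempered" and T: "continuous_op T"
    and add: "\<And>\<psi> \<theta>. \<psi> \<in> schwartz \<Longrightarrow> \<theta> \<in> schwartz \<Longrightarrow> T (\<lambda>x. \<psi> x + \<theta> x) = (\<lambda>x. T \<psi> x + T \<theta> x)"
    and scale: "\<And>c \<psi>. \<psi> \<in> schwartz \<Longrightarrow> T (\<lambda>x. c * \<psi> x) = (\<lambda>x. c * T \<psi> x)"
  shows "(\<lambda>\<psi>\<in>schwartz. u (T \<psi>)) \<in> tempered"
proof -
  obtain N C where C: "0 \<le> C" "\<And>\<psi>. \<psi> \<in> schwartz \<Longrightarrow> norm (u \<psi>) \<le> C * schwartz_seminorm N N \<psi>"
    by (rule temperedE[OF u]) (rule that)
  obtain M D where D: "0 \<le> D"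
    "\<And>\<psi>. \<psi> \<in> schwartz \<Longrightarrow> schwartz_seminorm N N (T \<psi>) \<le> D * schwartz_seminorm M M \<psi>"
    by (rule continuous_opE[OF T, where N = N and m = N]) (rule that)
  show ?thesis
  proof (rule temperedI)
    fix \<psi> :: "real^'a \<Rightarrow> complex" assume \<psi>: "\<psi> \<in> schwartz"
    have "norm (u (T \<psi>)) \<le> C * (D * schwartz_seminorm M M \<psi>)"
      by (rule order_trans[OF C(2)[OF continuous_op_schwartz[OF T \<psi>]] mult_left_mono[OF D(2)[OF \<psi>] C(1)]])
    then show "norm ((\<lambda>\<psi>\<in>schwartz. u (T \<psi>)) \<psi>) \<le> (C * D) * schwartz_seminorm M M \<psi>"
      using \<psi> by (simp add: mult.assoc)
  qed (simp_all add: add scale temperedD[OF u] continuous_op_schwartz[OF T] schwartz_add schwartz_cmult)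
qed

lemma integrable_schwartz: "\<theta> \<in> schwartz \<Longrightarrow> integrable lborel (\<lambda>x. \<theta> x * iexp (x \<bullet> \<xi>))"
  using integrable_fourier_rem[of \<theta> 0] by simp

lemma inv_fourier_add:
  "\<psi> \<in> schwartz \<Longrightarrow> \<theta> \<in> schwartz \<Longrightarrow> inv_fourier (\<lambda>x. \<psi> x + \<theta> x) = (\<lambda>x. inv_fourier \<psi> x + inv_fourier \<theta> x)"
  unfolding fourier_rem_0[symmetric] fourier_rem_def
  by (simp add: distrib_right integrable_schwartz distrib_left)

lemma inv_fourier_cmult: "inv_fourier (\<lambda>x. c * \<psi> x) = (\<lambda>x. c * inv_fourier \<psi> x)"
  unfolding inv_fourier_def by (simp add: mult.assoc mult.left_commute[of _ c])

lemma dist_fourier_tempered: "f \<in> tempered \<Longrightarrow> dist_fourier f \<in> tempered"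
  unfolding dist_fourier_def
  by (rule tempered_comp[OF _ continuous_op_fourier])
    (simp_all add: fourier_eq_inv_fourier[abs_def] inv_fourier_add inv_fourier_cmult)

lemma inv_fourier_schwartz: "\<psi> \<in> schwartz \<Longrightarrow> inv_fourier \<psi> \<in> schwartz"
  by (rule continuous_op_schwartz[OF continuous_op_inv_fourier])

lemma fourier_multiplier_apply:
  assumes "slow_growth (\<lambda>x. of_real (m x))" "\<psi> \<in> schwartz"
  shows "fourier_multiplier m f \<psi> = dist_fourier f (\<lambda>x. of_real (m x) * inv_fourier \<psi> x)"
  using assms by (simp add: fourier_multiplier_def dist_inv_fourier_def dist_mult_def inv_fourier_schwartz)

lemma fourier_multiplier_tempered:
  assumes m: "slow_growth (\<lambda>x. of_real (m x))" and f: "f \<in> tempered"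
  shows "fourier_multiplier m f \<in> tempered"
proof -
  have "fourier_multiplier m f = (\<lambda>\<psi>\<in>schwartz. dist_fourier f (\<lambda>x. of_real (m x) * inv_fourier \<psi> x))"
  proof
    fix \<psi>
    show "fourier_multiplier m f \<psi> = (\<lambda>\<psi>\<in>schwartz. dist_fourier f (\<lambda>x. of_real (m x) * inv_fourier \<psi> x)) \<psi>"
      using fourier_multiplier_apply[OF m]
      by (cases "\<psi> \<in> schwartz") (simp_all add: fourier_multiplier_def dist_inv_fourier_def)
  qed
  also have "\<dots> \<in> tempered"
    by (rule tempered_comp[OF dist_fourier_tempered[OF f]
          continuous_op_comp[OF continuous_op_inv_fourier continuous_op_mult[OF m]]])
      (simp_all add: inv_fourier_add inv_fourier_cmult algebra_simps)
  finally show ?thesis .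
qed

lemma dist_fourier_inv_fourier:
  "\<psi> \<in> schwartz \<Longrightarrow> dist_fourier f (inv_fourier \<psi>) = f \<psi>"
  by (simp add: dist_fourier_def inv_fourier_schwartz fourier_inversion)

lemma dist_add_tempered:
  assumes u: "u \<in> tempered" and v: "v \<in> tempered" shows "u \<oplus>\<^sub>D v \<in> tempered"
proof -
  obtain N C where C: "0 \<le> C" "\<And>\<psi>. \<psi> \<in> schwartz \<Longrightarrow> norm (u \<psi>) \<le> C * schwartz_seminorm N N \<psi>"
    by (rule temperedE[OF u]) (rule that)
  obtain M D where D: "0 \<le> D" "\<And>\<psi>. \<psi> \<in> schwartz \<Longrightarrow> norm (v \<psi>) \<le> D * schwartz_seminorm M M \<psi>"
    by (rule temperedE[OF v]) (rule that)
  show ?thesis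
    unfolding dist_add_def
  proof (rule temperedI)
    fix \<psi> :: "real^'a \<Rightarrow> complex" assume \<psi>: "\<psi> \<in> schwartz"
    have "norm (u \<psi> + v \<psi>) \<le> C * schwartz_seminorm N N \<psi> + D * schwartz_seminorm M M \<psi>"
      by (rule norm_triangle_le[OF add_mono[OF C(2)[OF \<psi>] D(2)[OF \<psi>]]])
    also have "\<dots> \<le> C * schwartz_seminorm (N + M) (N + M) \<psi> + D * schwartz_seminorm (N + M) (N + M) \<psi>"
      using C(1) D(1) by (intro add_mono mult_left_mono schwartz_seminorm_mono \<psi>) auto
    finally show "norm ((\<lambda>\<psi>\<in>schwartz. u \<psi> + v \<psi>) \<psi>) \<le> (C + D) * schwartz_seminorm (N + M) (N + M) \<psi>"
      using \<psi> by (simp add: distrib_right)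
  qed (simp_all add: temperedD[OF u] temperedD[OF v] schwartz_add schwartz_cmult algebra_simps)
qed

definition moderate_growth :: "(real^'n::finite \<Rightarrow> complex) \<Rightarrow> bool" where
  "moderate_growth g \<longleftrightarrow> g \<in> borel_measurable borel \<and> (\<exists>C k. \<forall>x. norm (g x) \<le> C * (1 + norm x) ^ k)"

lemma integrable_moderate_growth:
  "moderate_growth g \<Longrightarrow> \<psi> \<in> schwartz \<Longrightarrow> integrable lborel (\<lambda>x. g x * \<psi> x)"
  unfolding moderate_growth_def mult.commute[of "g _"] by (auto intro: integrable_schwartz_mult)

lemma dist_of_fun_tempered:
  assumes "moderate_growth (g :: real^'n::finite \<Rightarrow> complex)"
  shows "dist_of_fun g \<in> tempered"
proof -
  obtain C k where C: "\<And>x. norm (g x) \<le> C * (1 + norm x) ^ k" and g: "g \<in> borel_measurable borel"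
    using assms by (auto simp: moderate_growth_def)
  have C0: "0 \<le> C" using order_trans[OF norm_ge_zero C[of 0]] by simp
  let ?d = "2 * CARD('n)"
  let ?W = "LINT x::real^'n|lborel. 1 / (1 + norm x) ^ ?d"
  have W0: "0 \<le> ?W" by (intro integral_nonneg_AE) auto
  show ?thesis
    unfolding dist_of_fun_def
  proof (rule temperedI)
    fix \<psi> :: "real^'n \<Rightarrow> complex" assume \<psi>: "\<psi> \<in> schwartz"
    have "norm (g x * \<psi> x) \<le> (C * schwartz_seminorm (k + ?d) 0 \<psi>) / (1 + norm x) ^ ?d" for x
    proof -
      have "norm (g x * \<psi> x) \<le> C * (1 + norm x) ^ k * norm (\<psi> x)"
        unfolding norm_mult by (intro mult_right_mono C) simp
      also have "\<dots> \<le> C * (schwartz_seminorm (k + ?d) 0 \<psi> / (1 + norm x) ^ ?d)"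
        unfolding mult.assoc by (intro mult_left_mono schwartz_decay \<psi> C0)
      finally show ?thesis by simp
    qed
    then have "norm (LINT x|lborel. g x * \<psi> x) \<le> (C * schwartz_seminorm (k + ?d) 0 \<psi>) * ?W"
      using g schwartz_measurable[OF \<psi>] by (intro integrable_bound_decay(2)) auto
    also have "\<dots> \<le> (C * schwartz_seminorm (k + ?d) (k + ?d) \<psi>) * ?W"
      using C0 W0 by (intro mult_right_mono mult_left_mono schwartz_seminorm_mono \<psi>) auto
    finally show "norm ((\<lambda>\<psi>\<in>schwartz. LINT x|lborel. g x * \<psi> x) \<psi>) \<le> (C * ?W) * schwartz_seminorm (k + ?d) (k + ?d) \<psi>"
      using \<psi> by (simp add: mult_ac)
  qed (simp_all add: schwartz_add schwartz_cmult distrib_left integrable_moderate_growth[OF assms]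
      mult.left_commute[of "g _"])
qed

lemma dist_of_fun_add:
  assumes "moderate_growth g" "moderate_growth h" "\<psi> \<in> schwartz"
  shows "dist_of_fun (\<lambda>x. g x + h x) \<psi> = dist_of_fun g \<psi> + dist_of_fun h \<psi>"
  using assms by (simp add: dist_of_fun_def distrib_right integrable_moderate_growth)

lemma real_polynomial_growth:
  "real_polynomial_function p \<Longrightarrow> \<exists>C k. C \<ge> 0 \<and> (\<forall>x. \<bar>p x\<bar> \<le> C * (1 + norm (x::'a::real_normed_vector)) ^ k)"
proof (induction p rule: real_polynomial_function.induct)
  case (linear p)
  obtain K where "K \<ge> 0 \<and> (\<forall>x. norm (p x) \<le> norm x * K)"
    using bounded_linear.nonneg_bounded[OF linear] by (elim exE)
  then have K: "K \<ge> 0" "norm (p x) \<le> norm x * K" for x by simp_all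
  have "\<bar>p x\<bar> \<le> K * (1 + norm x) ^ 1" for x
    using K(2)[of x] K(1) by (simp add: algebra_simps)
  then show ?case using K(1) by blast
next
  case (const c)
  then show ?case by (intro exI[of _ "\<bar>c\<bar>"] exI[of _ 0]) auto
next
  case (add f g)
  obtain C k where f: "C \<ge> 0 \<and> (\<forall>x. \<bar>f x\<bar> \<le> C * (1 + norm x) ^ k)" using add.IH(1) by (elim exE)
  obtain D l where g: "D \<ge> 0 \<and> (\<forall>x. \<bar>g x\<bar> \<le> D * (1 + norm x) ^ l)" using add.IH(2) by (elim exE)
  have *: "C \<ge> 0" "D \<ge> 0" "\<bar>f x\<bar> \<le> C * (1 + norm x) ^ k" "\<bar>g x\<bar> \<le> D * (1 + norm x) ^ l" for x
    using f g by simp_all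
  have "\<bar>f x + g x\<bar> \<le> (C + D) * (1 + norm x) ^ (k + l)" for x
  proof -
    have "C * (1 + norm x) ^ k \<le> C * (1 + norm x) ^ (k + l)" "D * (1 + norm x) ^ l \<le> D * (1 + norm x) ^ (k + l)"
      using * by (auto intro!: mult_left_mono power_increasing)
    then show ?thesis using *(3,4)[of x] by (simp add: distrib_right)
  qed
  then show ?case using *(1,2) by (intro exI[of _ "C + D"] exI[of _ "k + l"]) auto
next
  case (mult f g)
  obtain C k where f: "C \<ge> 0 \<and> (\<forall>x. \<bar>f x\<bar> \<le> C * (1 + norm x) ^ k)" using mult.IH(1) by (elim exE)
  obtain D l where g: "D \<ge> 0 \<and> (\<forall>x. \<bar>g x\<bar> \<le> D * (1 + norm x) ^ l)" using mult.IH(2) by (elim exE)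
  have *: "C \<ge> 0" "D \<ge> 0" "\<bar>f x\<bar> \<le> C * (1 + norm x) ^ k" "\<bar>g x\<bar> \<le> D * (1 + norm x) ^ l" for x
    using f g by simp_all
  have "\<bar>f x * g x\<bar> \<le> (C * D) * (1 + norm x) ^ (k + l)" for x
  proof -
    have "\<bar>f x\<bar> * \<bar>g x\<bar> \<le> (C * (1 + norm x) ^ k) * (D * (1 + norm x) ^ l)"
      using * by (intro mult_mono) auto
    then show ?thesis by (simp add: abs_mult power_add mult_ac)
  qed
  then show ?case using *(1,2) by (intro exI[of _ "C * D"] exI[of _ "k + l"]) auto
qed

lemma moderate_growth_polynomial:
  fixes P :: "real^'n::finite \<Rightarrow> complex"
  assumes "polynomial_function P"
  shows "moderate_growth P"
proof -
  have re: "real_polynomial_function (Re \<circ> P)" and im: "real_polynomial_function (Im \<circ> P)"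
    using assms bounded_linear_Re bounded_linear_Im by (auto simp: polynomial_function_def)
  obtain C k where C: "C \<ge> 0 \<and> (\<forall>x. \<bar>(Re \<circ> P) x\<bar> \<le> C * (1 + norm x) ^ k)"
    using real_polynomial_growth[OF re] by (elim exE)
  obtain D l where D: "D \<ge> 0 \<and> (\<forall>x. \<bar>(Im \<circ> P) x\<bar> \<le> D * (1 + norm x) ^ l)"
    using real_polynomial_growth[OF im] by (elim exE)
  have *: "C \<ge> 0" "D \<ge> 0" "\<bar>Re (P x)\<bar> \<le> C * (1 + norm x) ^ k" "\<bar>Im (P x)\<bar> \<le> D * (1 + norm x) ^ l" for x
    using C D by simp_all
  have "norm (P x) \<le> (C + D) * (1 + norm x) ^ (k + l)" for x
  proof -
    have "C * (1 + norm x) ^ k \<le> C * (1 + norm x) ^ (k + l)" "D * (1 + norm x) ^ l \<le> D * (1 + norm x) ^ (k + l)"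
      using * by (auto intro!: mult_left_mono power_increasing)
    then show ?thesis using *(3,4)[of x] cmod_le[of "P x"] by (simp add: distrib_right)
  qed
  moreover have "P \<in> borel_measurable borel"
    by (intro borel_measurable_continuous_onI continuous_on_polymonial_function assms)
  ultimately show ?thesis unfolding moderate_growth_def by blast
qed

lemma dist_add_polynomials:
  assumes "polynomial_function P" "polynomial_function P'"
  shows "u \<oplus>\<^sub>D dist_of_fun P \<oplus>\<^sub>D dist_of_fun P' = u \<oplus>\<^sub>D dist_of_fun (\<lambda>x. P x + P' x)"
  unfolding dist_add_def
  by (rule restrict_ext)
    (simp add: dist_of_fun_add moderate_growth_polynomial[OF assms(1)] moderate_growth_polynomial[OF assms(2)] add.assoc)

lemma mod_poly_add_polynomial:
  assumes P: "polynomial_function P"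
  shows "mod_poly (u \<oplus>\<^sub>D dist_of_fun P) = mod_poly u"
proof (intro equalityI subsetI)
  fix v assume "v \<in> mod_poly (u \<oplus>\<^sub>D dist_of_fun P)"
  then show "v \<in> mod_poly u"
    unfolding mod_poly_def using dist_add_polynomials[OF P] polynomial_function_add[OF P] by auto
next
  fix v assume "v \<in> mod_poly u"
  then obtain R where R: "polynomial_function R" "v = u \<oplus>\<^sub>D dist_of_fun R" by (auto simp: mod_poly_def)
  have "polynomial_function (\<lambda>x. R x - P x)" by (intro polynomial_function_diff R P)
  moreover from this have "u \<oplus>\<^sub>D dist_of_fun P \<oplus>\<^sub>D dist_of_fun (\<lambda>x. R x - P x) = v"
    by (simp add: dist_add_polynomials[OF P] R(2))
  ultimately show "v \<in> mod_poly (u \<oplus>\<^sub>D dist_of_fun P)" unfolding mod_poly_def by blast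
qed

lemma limitin_tempered_topology:
  assumes "l \<in> tempered" "\<And>n. s n \<in> tempered"
  shows "limitin tempered_topology s l F \<longleftrightarrow> (\<forall>\<psi>\<in>schwartz. ((\<lambda>n. s n \<psi>) \<longlongrightarrow> l \<psi>) F)"
  using assms temperedD(1)
  by (auto simp: tempered_topology_def limitin_subtopology limitin_componentwise PiE_def intro!: always_eventually)

lemma limitin_tempered_mod_poly:
  assumes "limitin tempered_topology s l F"
  shows "limitin tempered_mod_poly_topology (\<lambda>n. mod_poly (s n)) (mod_poly l) F"
  unfolding limitin_def
proof (intro conjI allI impI)
  have l: "l \<in> topspace tempered_topology" using assms by (rule limitin_topspace)
  have "openin tempered_mod_poly_topology (mod_poly ` topspace tempered_topology)"
    unfolding tempered_mod_poly_topology_def openin_quotient_topology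
    by (auto intro: openin_subopen[THEN iffD2])
  then show "mod_poly l \<in> topspace tempered_mod_poly_topology"
    using l openin_subset by blast
  fix U assume U: "openin tempered_mod_poly_topology U \<and> mod_poly l \<in> U"
  then have "openin tempered_topology {x \<in> topspace tempered_topology. mod_poly x \<in> U}"
    by (simp add: tempered_mod_poly_topology_def openin_quotient_topology)
  then have "\<forall>\<^sub>F n in F. s n \<in> {x \<in> topspace tempered_topology. mod_poly x \<in> U}"
    using assms[unfolded limitin_def, THEN conjunct2, rule_format,
        of "{x \<in> topspace tempered_topology. mod_poly x \<in> U}"] l U by simp
  then show "\<forall>\<^sub>F n in F. mod_poly (s n) \<in> U" by (rule eventually_mono) simp
qed

lemma schwartz_compact_support:
  assumes s: "smooth_on UNIV f" and z: "\<And>x. norm x > r \<Longrightarrow> f x = 0"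
  shows "f \<in> schwartz"
  unfolding schwartz_iff
proof (intro conjI s allI)
  fix N and "is" :: "'a list"
  have "compact ((\<lambda>x. (1 + norm x) ^ N * norm (partials is f x)) ` cball 0 r)"
    by (intro compact_continuous_image continuous_intros compact_cball continuous_at_imp_continuous_on ballI
        smooth_on_isCont[OF s]) simp
  then have "bdd_above ((\<lambda>x. (1 + norm x) ^ N * norm (partials is f x)) ` cball 0 r)"
    by (intro bounded_imp_bdd_above compact_imp_bounded)
  then obtain B where "\<forall>x\<in>cball 0 r. (1 + norm x) ^ N * norm (partials is f x) \<le> B"
    by (auto simp only: bdd_above_def ball_simps)
  then have B: "(1 + norm x) ^ N * norm (partials is f x) \<le> B" if "norm x \<le> r" for x
    using that by simp
  have "(1 + norm x) ^ N * norm (partials is f x) \<le> max B 0" for x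
  proof (cases "norm x > r")
    case True
    have "open {x::real^'a. norm x > r}" by (intro open_Collect_less continuous_intros)
    then have "partials is f x = partials is (\<lambda>x. 0) x"
      by (rule partials_cong_open) (use z True in auto)
    then show ?thesis by (simp add: partials_const)
  next
    case False
    then show ?thesis using B[of x] by simp
  qed
  then show "\<exists>B. \<forall>x. (1 + norm x) ^ N * norm (partials is f x) \<le> B" by blast
qed

section \<open>Taylor polynomials of the inverse Fourier transform\<close>

lemma inner_power_eq_sum:
  "complex_of_real (x \<bullet> \<xi>) ^ k = (\<Sum>is | length is = k. coord_power is x * coord_power is \<xi>)"
proof (induction k)
  case (Suc k)
  have eq: "{is :: 'a list. length is = Suc k} = (\<lambda>(i, is). i # is) ` (UNIV \<times> {is. length is = k})"
    by (auto simp: length_Suc_conv image_iff)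
  have "complex_of_real (x \<bullet> \<xi>) ^ Suc k
      = (\<Sum>i\<in>UNIV. of_real (x $ i) * of_real (\<xi> $ i)) * (\<Sum>is | length is = k. coord_power is x * coord_power is \<xi>)"
    unfolding power_Suc Suc.IH by (simp add: inner_vec_def)
  also have "\<dots> = (\<Sum>(i, is)\<in>UNIV \<times> {is. length is = k}. coord_power (i # is) x * coord_power (i # is) \<xi>)"
    unfolding sum_product sum.cartesian_product by (simp add: mult_ac)
  also have "\<dots> = (\<Sum>is | length is = Suc k. coord_power is x * coord_power is \<xi>)"
    unfolding eq by (subst sum.reindex) (auto simp: inj_on_def case_prod_beta)
  finally show ?case .
qed simp

definition taylor_coeff :: "'n::finite itself \<Rightarrow> nat \<Rightarrow> complex" where
  "taylor_coeff _ k = of_real (fourier_const TYPE('n)) * (\<i> ^ k / fact k)"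

lemma moderate_growth_coord_power: "moderate_growth (coord_power is)"
proof -
  have "norm (coord_power is x) \<le> 1 * (1 + norm x) ^ length is" for x
  proof (induction "is")
    case (Cons i "is")
    have "norm (of_real (x $ i) * coord_power is x) \<le> (1 + norm x) * (1 + norm x) ^ length is"
      unfolding norm_mult using component_le_norm_cart[of x i] Cons by (intro mult_mono) auto
    then show ?case by simp
  qed simp
  moreover have "coord_power is \<in> borel_measurable borel"
    unfolding coord_power_def by (induction "is") auto
  ultimately show ?thesis unfolding moderate_growth_def by blast
qed

lemma finite_lists_less: "finite {is :: 'n::finite list. length is < q}"
  by (rule finite_subset[OF _ finite_lists_le[of q]]) auto

lemma fourier_rem_eq:
  fixes \<psi> :: "real^'n::finite \<Rightarrow> complex"
  assumes \<psi>: "\<psi> \<in> schwartz"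
  shows "fourier_rem q \<psi> \<xi> = inv_fourier \<psi> \<xi> -
    (\<Sum>is | length is < q. taylor_coeff TYPE('n) (length is) * dist_of_fun (coord_power is) \<psi> * coord_power is \<xi>)"
proof (induction q)
  case 0
  show ?case by (simp add: fourier_rem_0)
next
  case (Suc q)
  let ?S = "\<Sum>is | length is = q. taylor_coeff TYPE('n) (length is) * dist_of_fun (coord_power is) \<psi> * coord_power is \<xi>"
  have fin: "finite {is :: 'n list. length is = q}"
    by (rule finite_subset[OF _ finite_lists_le[of q]]) auto
  have i: "integrable lborel (\<lambda>x. coord_power is x * \<psi> x)" for "is"
    by (rule integrable_moderate_growth[OF moderate_growth_coord_power \<psi>])
  have eq: "\<psi> x * ((\<i> * of_real (x \<bullet> \<xi>)) ^ q / fact q)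
      = (\<Sum>is | length is = q. (\<i> ^ q / fact q * coord_power is \<xi>) * (coord_power is x * \<psi> x))" for x
    unfolding power_mult_distrib inner_power_eq_sum sum_distrib_left sum_distrib_right sum_divide_distrib
    by (rule sum.cong) (simp_all add: mult_ac)
  have I: "integrable lborel (\<lambda>x. \<psi> x * ((\<i> * of_real (x \<bullet> \<xi>)) ^ q / fact q))"
    unfolding eq by (intro Bochner_Integration.integrable_sum integrable_mult_right i)
  have "(LINT x|lborel. \<psi> x * ((\<i> * of_real (x \<bullet> \<xi>)) ^ q / fact q))
      = (\<Sum>is | length is = q. (\<i> ^ q / fact q * coord_power is \<xi>) * dist_of_fun (coord_power is) \<psi>)"
    unfolding eq using i \<psi> by (subst Bochner_Integration.integral_sum) (auto simp: dist_of_fun_def)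
  then have S: "of_real (fourier_const TYPE('n)) * (LINT x|lborel. \<psi> x * ((\<i> * of_real (x \<bullet> \<xi>)) ^ q / fact q)) = ?S"
    by (simp add: sum_distrib_left taylor_coeff_def mult_ac)
  have "fourier_rem (Suc q) \<psi> \<xi> = fourier_rem q \<psi> \<xi> - ?S"
    unfolding S[symmetric] fourier_rem_def exp_rem_Suc right_diff_distrib
    by (simp only: Bochner_Integration.integral_diff[OF integrable_fourier_rem[OF \<psi>] I] right_diff_distrib)
  moreover have "{is :: 'n list. length is < Suc q} = {is. length is < q} \<union> {is. length is = q}" by auto
  then have "(\<Sum>is | length is < Suc q. h is) = (\<Sum>is | length is < q. h is) + (\<Sum>is | length is = q. h is)"
    for h :: "'n list \<Rightarrow> complex"
    using sum.union_disjoint[OF finite_lists_less[of q] fin, of h] by (simp add: disjoint_iff)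
  ultimately show ?case
    unfolding Suc.IH by (simp only: diff_diff_eq)
qed

text \<open>The sign makes this the correction to be added to a Fourier multiplier.\<close>

definition taylor_poly :: "nat \<Rightarrow> ((real^'n::finite \<Rightarrow> complex) \<Rightarrow> complex) \<Rightarrow> (real^'n \<Rightarrow> real) \<Rightarrow> real^'n \<Rightarrow> complex" where
  "taylor_poly q u m x = (\<Sum>is | length is < q.
     - (taylor_coeff TYPE('n) (length is) * u (\<lambda>\<xi>. of_real (m \<xi>) * coord_power is \<xi>)) * coord_power is x)"

lemma polynomial_function_coord_power: "polynomial_function (\<lambda>x::real^'n::finite. c * coord_power is x)"
proof (induction "is")
  case (Cons i "is")
  have "polynomial_function (\<lambda>x::real^'n. x $ i)"
    by (intro polynomial_function_bounded_linear bounded_linear_vec_nth)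
  from polynomial_function_mult[OF this Cons]
  show ?case by (simp add: scaleR_conv_of_real mult_ac)
qed simp

lemma polynomial_function_taylor_poly: "polynomial_function (taylor_poly q u m)"
  unfolding taylor_poly_def[abs_def]
  by (intro polynomial_function_sum polynomial_function_coord_power finite_lists_less)

lemma finite_multiindices: "finite {\<alpha> :: 'n::finite \<Rightarrow> nat. sum \<alpha> UNIV \<le> p}"
proof (rule finite_subset)
  have "\<alpha> i \<le> sum \<alpha> UNIV" for \<alpha> :: "'n \<Rightarrow> nat" and i
    by (rule member_le_sum) auto
  then show "{\<alpha> :: 'n \<Rightarrow> nat. sum \<alpha> UNIV \<le> p} \<subseteq> (UNIV :: 'n set) \<rightarrow>\<^sub>E {..p}"
    by (auto simp: PiE_def extensional_def intro: order_trans)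
qed (auto intro: finite_PiE)

lemma poly_degree_le_sum:
  assumes "finite F" "\<And>k. k \<in> F \<Longrightarrow> poly_degree_le p (P k)"
  shows "poly_degree_le p (\<lambda>x. \<Sum>k\<in>F. P k x)"
proof -
  have "\<forall>k\<in>F. \<exists>c. P k = (\<lambda>x. \<Sum>\<alpha> | (\<Sum>i\<in>UNIV. \<alpha> i) \<le> p. c \<alpha> * of_real (\<Prod>i\<in>UNIV. (x $ i) ^ \<alpha> i))"
    unfolding poly_degree_le_def[symmetric] by (intro ballI assms(2))
  from bchoice[OF this] obtain c where
    c: "\<forall>k\<in>F. P k = (\<lambda>x. \<Sum>\<alpha> | (\<Sum>i\<in>UNIV. \<alpha> i) \<le> p. c k \<alpha> * of_real (\<Prod>i\<in>UNIV. (x $ i) ^ \<alpha> i))"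
    by (elim exE)
  have "(\<lambda>x. \<Sum>k\<in>F. P k x) = (\<lambda>x. \<Sum>\<alpha> | (\<Sum>i\<in>UNIV. \<alpha> i) \<le> p. (\<Sum>k\<in>F. c k \<alpha>) * of_real (\<Prod>i\<in>UNIV. (x $ i) ^ \<alpha> i))"
    unfolding sum_distrib_right by (subst sum.swap) (simp add: c)
  then show ?thesis
    unfolding poly_degree_le_def by (intro exI[of _ "\<lambda>\<alpha>. \<Sum>k\<in>F. c k \<alpha>"])
qed

lemma poly_degree_le_coord_power:
  assumes "length is \<le> p"
  shows "poly_degree_le p (\<lambda>x::real^'n::finite. c * coord_power is x)"
proof -
  have cp: "coord_power is x = of_real (\<Prod>i\<in>UNIV. (x $ i) ^ count_list is i)" for x :: "real^'n"
  proof (induction "is")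
    case (Cons j "is")
    have "(\<Prod>i\<in>UNIV. (x $ i) ^ count_list (j # is) i) = (\<Prod>i\<in>UNIV. (if i = j then x $ i else 1) * (x $ i) ^ count_list is i)"
      by (rule prod.cong) auto
    also have "\<dots> = x $ j * (\<Prod>i\<in>UNIV. (x $ i) ^ count_list is i)"
      by (simp add: prod.distrib)
    finally show ?case using Cons by simp
  qed simp
  have "(\<Sum>i\<in>UNIV. count_list is i) = length is"
    by (rule sum_count_set) auto
  then have "count_list is \<in> {\<alpha>. (\<Sum>i\<in>UNIV. \<alpha> i) \<le> p}" using assms by simp
  then have "(\<lambda>x::real^'n. c * coord_power is x)
      = (\<lambda>x. \<Sum>\<alpha> | (\<Sum>i\<in>UNIV. \<alpha> i) \<le> p. (if \<alpha> = count_list is then c else 0) * of_real (\<Prod>i\<in>UNIV. (x $ i) ^ \<alpha> i))"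
    by (simp add: cp if_distrib[of "\<lambda>c. c * _"] sum.delta finite_multiindices cong: if_cong)
  then show ?thesis unfolding poly_degree_le_def by (intro exI)
qed

lemma poly_degree_le_taylor_poly: "poly_degree_le p (taylor_poly (Suc p) u m)"
  unfolding taylor_poly_def[abs_def]
  by (intro poly_degree_le_sum poly_degree_le_coord_power finite_lists_less) auto

lemma slow_growth_schwartz: "f \<in> schwartz \<Longrightarrow> slow_growth f"
  unfolding slow_growth_def
proof (intro conjI allI)
  assume f: "f \<in> schwartz"
  then show "smooth_on UNIV f" by auto
  fix n
  have "jet n (schwartz_seminorm 0 n f * (1 + norm x) ^ 0) 1 f x" for x
    using schwartz_seminorm_ge[OF f, of _ n x 0] by (simp add: jet_def)
  then show "\<exists>C K. \<forall>x. jet n (C * (1 + norm x) ^ K) 1 f x" by blast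
qed

lemma dist_of_fun_taylor_poly:
  fixes \<psi> :: "real^'n::finite \<Rightarrow> complex"
  assumes \<psi>: "\<psi> \<in> schwartz"
  shows "dist_of_fun (taylor_poly q u m) \<psi> = (\<Sum>is | length is < q.
     - (taylor_coeff TYPE('n) (length is) * u (\<lambda>\<xi>. of_real (m \<xi>) * coord_power is \<xi>)) * dist_of_fun (coord_power is) \<psi>)"
proof -
  define c where "c is = - (taylor_coeff TYPE('n) (length is) * u (\<lambda>\<xi>. of_real (m \<xi>) * coord_power is \<xi>))" for "is" :: "'n list"
  have i: "integrable lborel (\<lambda>x. coord_power is x * \<psi> x)" for "is"
    by (rule integrable_moderate_growth[OF moderate_growth_coord_power \<psi>])
  have "dist_of_fun (taylor_poly q u m) \<psi> = (LINT x|lborel. (\<Sum>is | length is < q. c is * (coord_power is x * \<psi> x)))"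
    using \<psi> by (simp add: dist_of_fun_def taylor_poly_def c_def sum_distrib_right mult.assoc)
  also have "\<dots> = (\<Sum>is | length is < q. c is * dist_of_fun (coord_power is) \<psi>)"
    using i \<psi> by (subst Bochner_Integration.integral_sum) (auto simp: dist_of_fun_def)
  finally show ?thesis by (simp only: c_def)
qed

text \<open>Correcting a multiplier by a polynomial replaces \<^term>\<open>inv_fourier \<psi>\<close> by a function that
  vanishes to order \<open>q\<close> at the origin.\<close>

lemma corrected_multiplier:
  fixes \<psi> :: "real^'n::finite \<Rightarrow> complex"
  assumes m: "(\<lambda>x. of_real (m x)) \<in> schwartz" and f: "f \<in> tempered" and \<psi>: "\<psi> \<in> schwartz"
  shows "(fourier_multiplier m f \<oplus>\<^sub>D dist_of_fun (taylor_poly q (dist_fourier f) m)) \<psi>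
    = dist_fourier f (\<lambda>x. of_real (m x) * fourier_rem q \<psi> x)"
proof -
  define v where "v = dist_fourier f"
  have v: "v \<in> tempered" unfolding v_def by (rule dist_fourier_tempered[OF f])
  have sg: "slow_growth (\<lambda>x. complex_of_real (m x))" by (rule slow_growth_schwartz[OF m])
  define c where "c is = taylor_coeff TYPE('n) (length is) * dist_of_fun (coord_power is) \<psi>" for "is" :: "'n list"
  define \<theta> where "\<theta> is x = c is * (of_real (m x) * coord_power is x)" for "is" and x :: "real^'n"
  have mc: "(\<lambda>x. of_real (m x) * coord_power is x) \<in> schwartz" for "is"
    using schwartz_coord_power[OF m, of "is"] by (simp add: mult.commute)
  have \<theta>: "\<theta> is \<in> schwartz" for "is" unfolding \<theta>_def by (rule schwartz_cmult[OF mc])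
  have "(\<lambda>x. of_real (m x) * fourier_rem q \<psi> x)
      = (\<lambda>x. of_real (m x) * inv_fourier \<psi> x - (\<Sum>is | length is < q. \<theta> is x))"
    by (simp add: fun_eq_iff fourier_rem_eq[OF \<psi>] right_diff_distrib sum_distrib_left \<theta>_def c_def mult_ac)
  then have 1: "v (\<lambda>x. of_real (m x) * fourier_rem q \<psi> x)
      = v (\<lambda>x. of_real (m x) * inv_fourier \<psi> x) - (\<Sum>is | length is < q. v (\<theta> is))"
    by (simp add: tempered_diff[OF v] tempered_sum[OF v] \<theta> schwartz_sum schwartz_mult[OF sg] inv_fourier_schwartz[OF \<psi>])
  have 2: "v (\<theta> is) = c is * v (\<lambda>x. of_real (m x) * coord_power is x)" for "is"
    unfolding \<theta>_def by (rule temperedD(3)[OF v mc])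
  have 3: "v (\<lambda>x. of_real (m x) * inv_fourier \<psi> x) = fourier_multiplier m f \<psi>"
    unfolding v_def by (rule fourier_multiplier_apply[OF sg \<psi>, symmetric])
  show ?thesis
    using 1 unfolding 2 3
    using \<psi> by (simp add: dist_add_def dist_of_fun_taylor_poly v_def c_def sum_negf mult_ac)
qed

lemma order_at_most_dist_order:
  assumes v: "v \<in> tempered"
  shows "order_at_most v (dist_order v)"
proof -
  obtain N C where C: "0 \<le> C" "\<And>\<psi>. \<psi> \<in> schwartz \<Longrightarrow> norm (v \<psi>) \<le> C * schwartz_seminorm N N \<psi>"
    by (rule temperedE[OF v]) (rule that)
  have "order_at_most v N"
    unfolding order_at_most_def
  proof (intro allI impI)
    fix K :: "(real^'a) set" assume K: "compact K"
    obtain r where "r > 0 \<and> (\<forall>x\<in>K. norm x \<le> r)"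
      using compact_imp_bounded[OF K] unfolding bounded_pos by (elim exE)
    then have r: "r > 0" "x \<in> K \<Longrightarrow> norm x \<le> r" for x by auto
    show "\<exists>C. \<forall>\<psi>. smooth \<psi> \<and> supp \<psi> \<subseteq> K \<longrightarrow> norm (v \<psi>) \<le> C * schwartz_seminorm 0 N \<psi>"
    proof (intro exI[of _ "C * (1 + r) ^ N"] allI impI)
      fix \<psi> :: "real^'a \<Rightarrow> complex" assume \<psi>: "smooth \<psi> \<and> supp \<psi> \<subseteq> K"
      have z: "\<psi> x = 0" if "x \<notin> K" for x
        using \<psi> that closure_subset[of "{x. \<psi> x \<noteq> 0}"] by (auto simp: supp_def)
      have z': "\<psi> x = 0" if "norm x > r" for x
        by (rule z) (use r(2)[of x] that in auto)
      have S: "\<psi> \<in> schwartz"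
        by (rule schwartz_compact_support[OF _ z']) (use \<psi> in \<open>simp add: smooth_iff_smooth_on\<close>)
      have "schwartz_seminorm N N \<psi> \<le> (1 + r) ^ N * schwartz_seminorm 0 N \<psi>"
      proof (rule schwartz_seminorm_le)
        fix "is" :: "'a list" and x assume l: "length is \<le> N"
        show "(1 + norm x) ^ N * norm (partials is \<psi> x) \<le> (1 + r) ^ N * schwartz_seminorm 0 N \<psi>"
        proof (cases "norm x \<le> r")
          case True
          then show ?thesis
            using schwartz_seminorm_ge[OF S l, of x 0] r(1) by (intro mult_mono power_mono) auto
        next
          case False
          have "open {x::real^'a. norm x > r}" by (intro open_Collect_less continuous_intros)
          then have "partials is \<psi> x = partials is (\<lambda>x. 0) x"
            by (rule partials_cong_open) (use z' False in auto)
          then show ?thesis using schwartz_seminorm_nonneg[OF S, of 0 N] r(1) by (simp add: partials_const)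
        qed
      qed
      then have "C * schwartz_seminorm N N \<psi> \<le> C * ((1 + r) ^ N * schwartz_seminorm 0 N \<psi>)"
        using C(1) by (rule mult_left_mono)
      then show "norm (v \<psi>) \<le> C * (1 + r) ^ N * schwartz_seminorm 0 N \<psi>"
        using C(2)[OF S] by (simp add: mult.assoc)
    qed
  qed
  then show ?thesis unfolding dist_order_def by (rule LeastI)
qed

section \<open>Anisotropic geometry\<close>

lemma dilation_nth [simp]: "(dilation a t *v \<xi>) $ i = t powr (a $ i) * \<xi> $ i"
proof -
  have "(dilation a t *v \<xi>) $ i = (\<Sum>l\<in>UNIV. if i = l then t powr (a $ i) * \<xi> $ l else 0)"
    unfolding dilation_def matrix_vector_mult_def by (simp add: if_distrib[of "\<lambda>c. c * _"] cong: if_cong)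
  then show ?thesis by simp
qed

lemma norm_dilation_le:
  assumes "\<And>i. t powr (a $ i) \<le> c" shows "norm (dilation a t *v \<xi>) \<le> c * norm \<xi>"
proof -
  have "c \<ge> 0" using assms[of undefined] powr_ge_zero order_trans by blast
  have "norm (dilation a t *v \<xi>) \<le> norm (c *\<^sub>R \<xi>)"
    by (rule norm_le_componentwise_cart) (use assms \<open>c \<ge> 0\<close> in \<open>simp add: abs_mult mult_right_mono\<close>)
  then show ?thesis using \<open>c \<ge> 0\<close> by simp
qed

lemma norm_dilation_ge:
  assumes "\<And>i. c \<le> t powr (a $ i)" "c \<ge> 0" shows "c * norm \<xi> \<le> norm (dilation a t *v \<xi>)"
proof -
  have "norm (c *\<^sub>R \<xi>) \<le> norm (dilation a t *v \<xi>)"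
    by (rule norm_le_componentwise_cart) (use assms in \<open>simp add: abs_mult mult_right_mono\<close>)
  then show ?thesis using assms by simp
qed

lemma dilation_mult:
  "s > 0 \<Longrightarrow> t > 0 \<Longrightarrow> dilation a s *v (dilation a t *v \<xi>) = dilation a (s * t) *v \<xi>"
  by (simp add: vec_eq_iff powr_mult)

locale anisotropy =
  fixes a :: "real^'n::finite" and amin amax :: real
  assumes amin: "amin > 0" "\<And>i. amin \<le> a $ i" and amax: "\<And>i. a $ i \<le> amax"
begin

lemma norm_dilation_strict_mono:
  assumes "0 < s" "s < t" "\<xi> \<noteq> 0"
  shows "norm (dilation a s *v \<xi>) < norm (dilation a t *v \<xi>)"
proof -
  define r where "r = t / s"
  have r: "r > 1" "t = r * s" using assms by (auto simp: r_def)
  have nz: "dilation a s *v \<xi> \<noteq> 0"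
    using assms by (auto simp: vec_eq_iff)
  have "r powr amin > 1" using r amin by simp
  then have "norm (dilation a s *v \<xi>) < r powr amin * norm (dilation a s *v \<xi>)" using nz by simp
  also have "\<dots> \<le> norm (dilation a r *v (dilation a s *v \<xi>))"
    using r amin(2) by (intro norm_dilation_ge powr_mono) auto
  also have "\<dots> = norm (dilation a t *v \<xi>)"
    using r assms by (simp add: dilation_mult)
  finally show ?thesis .
qed

lemma norm_dilation_eq_1_ex:
  assumes "\<xi> \<noteq> 0"
  shows "\<exists>s>0. norm (dilation a s *v \<xi>) = 1"
proof -
  obtain i where i: "\<xi> $ i \<noteq> 0" using assms by (auto simp: vec_eq_iff)
  define s where "s = min 1 ((1 / norm \<xi>) powr (1 / amin))"
  define t where "t = max s ((1 / \<bar>\<xi> $ i\<bar>) powr (1 / (a $ i)))"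
  have ai: "a $ i > 0" using amin(1) amin(2)[of i] by linarith
  have s: "0 < s" "s \<le> 1" using assms by (auto simp: s_def)
  have "s powr amin \<le> ((1 / norm \<xi>) powr (1 / amin)) powr amin"
    using s amin by (intro powr_mono2) (auto simp: s_def)
  also have "\<dots> = 1 / norm \<xi>" using amin assms by (simp add: powr_powr)
  finally have "s powr (a $ k) \<le> 1 / norm \<xi>" for k
    using powr_mono'[OF amin(2), of s k] s by simp
  from norm_dilation_le[OF this, of \<xi>] have le: "norm (dilation a s *v \<xi>) \<le> 1" using assms by simp
  have "1 = ((1 / \<bar>\<xi> $ i\<bar>) powr (1 / (a $ i))) powr (a $ i) * \<bar>\<xi> $ i\<bar>"
    using i ai by (simp add: powr_powr)
  also have "\<dots> \<le> t powr (a $ i) * \<bar>\<xi> $ i\<bar>"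
    using ai by (intro mult_right_mono powr_mono2) (auto simp: t_def)
  also have "\<dots> = \<bar>(dilation a t *v \<xi>) $ i\<bar>" by (simp add: abs_mult)
  also have "\<dots> \<le> norm (dilation a t *v \<xi>)" by (rule component_le_norm_cart)
  finally have ge: "1 \<le> norm (dilation a t *v \<xi>)" .
  have st: "s \<le> t" by (simp add: t_def)
  have "continuous_on {s..t} (\<lambda>r. norm (dilation a r *v \<xi>))"
  proof -
    have "continuous_on {s..t} (\<lambda>r. \<chi> i. r powr (a $ i) * \<xi> $ i)"
      using s by (intro continuous_on_vec_lambda continuous_intros) auto
    then have "continuous_on {s..t} (\<lambda>r. dilation a r *v \<xi>)"
      by (rule continuous_on_eq) (simp add: vec_eq_iff)
    then show ?thesis by (rule continuous_on_norm)
  qed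
  from IVT'[OF le ge st this] show ?thesis using s(1) by (auto intro: less_le_trans)
qed

lemma anorm_works:
  assumes "\<xi> \<noteq> 0"
  shows "anorm a \<xi> > 0" "norm (dilation a (1 / anorm a \<xi>) *v \<xi>) = 1"
proof -
  obtain s where s: "s > 0" "norm (dilation a s *v \<xi>) = 1" using norm_dilation_eq_1_ex[OF assms] by blast
  have "\<exists>!t. t > 0 \<and> norm (dilation a (1 / t) *v \<xi>) = 1"
  proof (rule ex1I[of _ "1 / s"])
    fix t assume t: "t > 0 \<and> norm (dilation a (1 / t) *v \<xi>) = 1"
    have "\<not> 1 / t < s" "\<not> s < 1 / t"
      using norm_dilation_strict_mono[of "1 / t" s \<xi>] norm_dilation_strict_mono[of s "1 / t" \<xi>] s t assms by auto
    then have "1 / t = s" by linarith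
    then show "t = 1 / s" by auto
  qed (use s in auto)
  from theI'[OF this] show "anorm a \<xi> > 0" "norm (dilation a (1 / anorm a \<xi>) *v \<xi>) = 1"
    using assms by (auto simp: anorm_def)
qed

lemma anorm_minus [simp]: "anorm a (- \<xi>) = anorm a \<xi>"
proof -
  have "dilation a t *v - \<xi> = - (dilation a t *v \<xi>)" for t by (simp add: vec_eq_iff)
  then show ?thesis by (simp add: anorm_def)
qed

lemma dilation_anorm:
  assumes "\<xi> \<noteq> 0"
  shows "dilation a (anorm a \<xi>) *v (dilation a (1 / anorm a \<xi>) *v \<xi>) = \<xi>"
  using anorm_works(1)[OF assms] by (simp add: dilation_mult vec_eq_iff)

lemma norm_le_powr_amax:
  assumes "anorm a \<xi> \<le> T" "1 \<le> T" shows "norm \<xi> \<le> T powr amax"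
proof (cases "\<xi> = 0")
  case False
  have "anorm a \<xi> powr (a $ i) \<le> T powr amax" for i
  proof -
    have "anorm a \<xi> powr (a $ i) \<le> T powr (a $ i)"
      using anorm_works(1)[OF False] assms amin(1) amin(2)[of i] by (intro powr_mono2) auto
    also have "\<dots> \<le> T powr amax" using assms amax by (intro powr_mono) auto
    finally show ?thesis .
  qed
  from norm_dilation_le[of "anorm a \<xi>" a, OF this, of "dilation a (1 / anorm a \<xi>) *v \<xi>"]
  show ?thesis using anorm_works(2)[OF False] dilation_anorm[OF False] by simp
qed (use assms in simp)

lemma norm_le_powr_amin:
  assumes "\<xi> \<noteq> 0" "anorm a \<xi> \<le> 1" shows "norm \<xi> \<le> anorm a \<xi> powr amin"
proof -
  have "anorm a \<xi> powr (a $ i) \<le> anorm a \<xi> powr amin" for i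
    using anorm_works(1)[OF assms(1)] assms amin(2) by (intro powr_mono') auto
  from norm_dilation_le[of "anorm a \<xi>" a, OF this, of "dilation a (1 / anorm a \<xi>) *v \<xi>"]
  show ?thesis using anorm_works(2)[OF assms(1)] dilation_anorm[OF assms(1)] by simp
qed

lemma anorm_less:
  assumes "norm \<xi> < (min 1 C) powr amax" "C > 0" shows "anorm a \<xi> < C"
proof (rule ccontr)
  assume "\<not> anorm a \<xi> < C"
  then have *: "C \<le> anorm a \<xi>" "\<xi> \<noteq> 0" using assms(2) by (auto simp: anorm_def)
  have "(min 1 C) powr amax \<le> anorm a \<xi> powr (a $ i)" for i
  proof -
    have "(min 1 C) powr amax \<le> (min 1 C) powr (a $ i)" using assms amax by (intro powr_mono') auto
    also have "\<dots> \<le> anorm a \<xi> powr (a $ i)"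
      using * assms amin(1) amin(2)[of i] by (intro powr_mono2) auto
    finally show ?thesis .
  qed
  from norm_dilation_ge[of _ "anorm a \<xi>" a, OF this, of "dilation a (1 / anorm a \<xi>) *v \<xi>"]
  show False using anorm_works(2)[OF *(2)] dilation_anorm[OF *(2)] assms by simp
qed

lemma min_norm_powr_le:
  assumes "\<xi> \<noteq> 0" shows "(min 1 (norm \<xi>)) powr (1 / amin) \<le> min 1 (anorm a \<xi>)"
proof -
  have 1: "(min 1 (norm \<xi>)) powr (1 / amin) \<le> 1"
    using amin assms by (intro powr_le1) auto
  show ?thesis
  proof (cases "anorm a \<xi> \<le> 1")
    case True
    have "(min 1 (norm \<xi>)) powr (1 / amin) \<le> (anorm a \<xi> powr amin) powr (1 / amin)"
      using norm_le_powr_amin[OF assms True] amin assms by (intro powr_mono2) auto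
    then show ?thesis using 1 anorm_works(1)[OF assms] amin by (simp add: powr_powr)
  qed (use 1 in simp)
qed

end

lemma hybrid_regulation_bounds:
  assumes "hybrid_regulation a \<rho> h\<^sub>1 h\<^sub>2 \<delta>\<^sub>1 \<delta>\<^sub>2 c\<^sub>1 h" and an: "\<And>\<xi>. \<xi> \<noteq> 0 \<Longrightarrow> anorm a \<xi> > 0"
  obtains c r d where "0 < c" "0 \<le> r" "0 < d"
    "\<And>\<xi>. \<xi> \<noteq> 0 \<Longrightarrow> c * (min 1 (anorm a \<xi>)) powr r \<le> h \<xi>"
    "\<And>\<xi>. \<xi> \<noteq> 0 \<Longrightarrow> h \<xi> \<le> d * anorm a \<xi>"
proof -
  obtain c\<^sub>0 r where c0: "c\<^sub>0 > 0" "r \<ge> 1" "\<forall>\<xi>. 0 < anorm a \<xi> \<and> anorm a \<xi> \<le> 4/3 \<longrightarrow>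
        c\<^sub>0 * anorm a \<xi> powr r \<le> h\<^sub>1 \<xi> \<and> h\<^sub>1 \<xi> \<le> c\<^sub>1 * anorm a \<xi>"
    using assms(1) unfolding hybrid_regulation_def by (elim conjE exE)
  obtain c\<^sub>2 c\<^sub>3 where c2: "c\<^sub>2 > 0" "c\<^sub>3 > 0" "\<forall>\<xi>. anorm a \<xi> \<ge> 2/3 \<longrightarrow>
        c\<^sub>2 \<le> h\<^sub>2 \<xi> \<and> h\<^sub>2 \<xi> \<le> c\<^sub>3 * anorm a \<xi>"
    using assms(1) unfolding hybrid_regulation_def by (elim conjE exE)
  have \<rho>: "\<xi> \<noteq> 0 \<Longrightarrow> 0 \<le> \<rho> \<xi> \<and> \<rho> \<xi> \<le> 1" "0 < anorm a \<xi> \<Longrightarrow> anorm a \<xi> \<le> 2/3 \<Longrightarrow> \<rho> \<xi> = 1"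
    "anorm a \<xi> \<ge> 4/3 \<Longrightarrow> \<rho> \<xi> = 0" for \<xi>
    using assms(1) by (auto simp: hybrid_regulation_def ramp_def)
  have h: "\<xi> \<noteq> 0 \<Longrightarrow> h \<xi> = \<rho> \<xi> * h\<^sub>1 \<xi> + (1 - \<rho> \<xi>) * h\<^sub>2 \<xi>" for \<xi>
    using assms(1) by (auto simp: hybrid_regulation_def)
  have c1: "c\<^sub>1 > 0" using assms(1) by (simp add: hybrid_regulation_def)
  define c d where "c = min c\<^sub>0 c\<^sub>2" and "d = max c\<^sub>1 c\<^sub>3"
  have "c * (min 1 (anorm a \<xi>)) powr r \<le> h \<xi> \<and> h \<xi> \<le> d * anorm a \<xi>" if \<xi>: "\<xi> \<noteq> 0" for \<xi>
  proof -
    define t where "t = anorm a \<xi>"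
    have t: "t > 0" using an[OF \<xi>] by (simp add: t_def)
    define m where "m = (min 1 t) powr r"
    have m: "m \<le> t powr r" "m \<le> 1" "0 \<le> m"
      using t c0(2) by (auto simp: m_def intro!: powr_mono2 powr_le1)
    have A: "c * m \<le> h\<^sub>1 \<xi>" "h\<^sub>1 \<xi> \<le> d * t" if "t \<le> 4/3"
    proof -
      have "c * m \<le> c\<^sub>0 * t powr r" using m c0 c2 by (intro mult_mono) (auto simp: c_def)
      then show "c * m \<le> h\<^sub>1 \<xi>" using c0(3)[rule_format, of \<xi>] t that unfolding t_def by linarith
      have "c\<^sub>1 * t \<le> d * t" using t by (intro mult_right_mono) (auto simp: d_def)
      then show "h\<^sub>1 \<xi> \<le> d * t" using c0(3)[rule_format, of \<xi>] t that unfolding t_def by linarith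
    qed
    have B: "c * m \<le> h\<^sub>2 \<xi>" "h\<^sub>2 \<xi> \<le> d * t" if "2/3 \<le> t"
    proof -
      have "c * m \<le> c\<^sub>2 * 1" using m c0 c2 by (intro mult_mono) (auto simp: c_def)
      then show "c * m \<le> h\<^sub>2 \<xi>" using c2(3)[rule_format, of \<xi>] that unfolding t_def by linarith
      have "c\<^sub>3 * t \<le> d * t" using t by (intro mult_right_mono) (auto simp: d_def)
      then show "h\<^sub>2 \<xi> \<le> d * t" using c2(3)[rule_format, of \<xi>] that unfolding t_def by linarith
    qed
    consider "t \<le> 2/3" | "2/3 \<le> t" "t \<le> 4/3" | "4/3 \<le> t" by linarith
    then have "c * m \<le> h \<xi> \<and> h \<xi> \<le> d * t"
    proof cases
      case 1
      then show ?thesis using h[OF \<xi>] \<rho>(2)[of \<xi>] t A unfolding t_def by simp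
    next
      case 2
      have r: "0 \<le> \<rho> \<xi>" "\<rho> \<xi> \<le> 1" using \<rho>(1)[OF \<xi>] by auto
      have "c * m = \<rho> \<xi> * (c * m) + (1 - \<rho> \<xi>) * (c * m)" by (simp add: algebra_simps)
      also have "\<dots> \<le> h \<xi>"
        unfolding h[OF \<xi>] using A(1)[OF 2(2)] B(1)[OF 2(1)] r by (intro add_mono mult_left_mono) auto
      finally have 3: "c * m \<le> h \<xi>" .
      have "h \<xi> \<le> \<rho> \<xi> * (d * t) + (1 - \<rho> \<xi>) * (d * t)"
        unfolding h[OF \<xi>] using A(2)[OF 2(2)] B(2)[OF 2(1)] r by (intro add_mono mult_left_mono) auto
      then show ?thesis using 3 by (simp add: algebra_simps)
    next
      case 3
      then show ?thesis using h[OF \<xi>] \<rho>(3)[of \<xi>] B unfolding t_def by simp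
    qed
    then show ?thesis by (simp add: t_def m_def)
  qed
  then show ?thesis using c0 c2 c1 by (intro that[of c r d]) (auto simp: c_def d_def)
qed

lemma moderateE:
  assumes "moderate a \<delta>\<^sub>0 h" "0 < \<delta>" "\<delta> < \<delta>\<^sub>0"
  obtains R where "R > 0" "\<And>\<xi> \<zeta>. \<xi> \<noteq> 0 \<Longrightarrow> \<zeta> \<noteq> 0 \<Longrightarrow> adist a \<xi> \<zeta> < \<delta> * h \<xi> \<Longrightarrow> h \<zeta> \<le> R * h \<xi> \<and> h \<xi> \<le> R * h \<zeta>"
proof -
  obtain R where R: "R > 0" "\<forall>\<xi> \<zeta>. \<xi> \<noteq> 0 \<and> \<zeta> \<noteq> 0 \<and> adist a \<xi> \<zeta> \<le> \<delta>\<^sub>0 * h \<xi> \<longrightarrow>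
        inverse R \<le> h \<xi> / h \<zeta> \<and> h \<xi> / h \<zeta> \<le> R" and pos: "\<forall>\<xi>. \<xi> \<noteq> 0 \<longrightarrow> h \<xi> > 0"
    using assms(1) unfolding moderate_def by (elim conjE exE)
  show ?thesis
  proof (rule that[OF R(1)])
    fix \<xi> \<zeta> assume *: "\<xi> \<noteq> 0" "\<zeta> \<noteq> 0" "adist a \<xi> \<zeta> < \<delta> * h \<xi>"
    have h: "h \<xi> > 0" "h \<zeta> > 0" using pos * by auto
    have "\<delta> * h \<xi> \<le> \<delta>\<^sub>0 * h \<xi>" using h assms(3) by (intro mult_right_mono) auto
    then have "adist a \<xi> \<zeta> \<le> \<delta>\<^sub>0 * h \<xi>" using * by linarith
    then have "inverse R \<le> h \<xi> / h \<zeta>" "h \<xi> / h \<zeta> \<le> R" using R(2) * by auto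
    then show "h \<zeta> \<le> R * h \<xi> \<and> h \<xi> \<le> R * h \<zeta>"
      using h R(1) by (simp add: field_simps)
  qed
qed

lemma (in anisotropy) dilation_parameter_bound:
  assumes hybrid: "hybrid_regulation a \<rho> h\<^sub>1 h\<^sub>2 \<delta>\<^sub>1 \<delta>\<^sub>2 c\<^sub>1 h"
    and h_moderate: "moderate a \<delta>\<^sub>0 h" and \<delta>: "0 < \<delta>" "\<delta> < \<delta>\<^sub>0"
  obtains B M where "0 < B"
    "\<And>\<xi> \<zeta> i. \<xi> \<noteq> 0 \<Longrightarrow> \<zeta> \<noteq> 0 \<Longrightarrow> adist a \<xi> \<zeta> < \<delta> * h \<xi> \<Longrightarrow>
      (\<delta> * h \<xi>) powr (- (a $ i)) \<le> B * (1 + (1 / norm \<zeta>) ^ M)"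
proof -
  obtain c r d where c: "0 < c" "0 \<le> r" "\<And>\<xi>. \<xi> \<noteq> 0 \<Longrightarrow> c * (min 1 (anorm a \<xi>)) powr r \<le> h \<xi>"
    using hybrid_regulation_bounds[OF hybrid anorm_works(1)] by metis
  obtain R where R: "R > 0" "\<And>\<xi> \<zeta>. \<xi> \<noteq> 0 \<Longrightarrow> \<zeta> \<noteq> 0 \<Longrightarrow> adist a \<xi> \<zeta> < \<delta> * h \<xi> \<Longrightarrow> h \<zeta> \<le> R * h \<xi> \<and> h \<xi> \<le> R * h \<zeta>"
    by (rule moderateE[OF h_moderate \<delta>]) (rule that)
  define b where "b = min 1 (\<delta> * c / R)"
  have b: "0 < b" "b \<le> 1" "b \<le> \<delta> * c / R" using \<delta> c R by (auto simp: b_def)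
  define e where "e = r / amin"
  have e: "e \<ge> 0" using c amin by (simp add: e_def)
  define M where "M = nat \<lceil>e * amax\<rceil>"
  have M: "e * amax \<le> real M" by (simp add: M_def real_nat_ceiling_ge)
  show ?thesis
  proof (rule that[of "b powr (- amax)" M])
    show "0 < b powr (- amax)" using b by simp
    fix \<xi> \<zeta> :: "real^'n" and i
    assume *: "\<xi> \<noteq> 0" "\<zeta> \<noteq> 0" "adist a \<xi> \<zeta> < \<delta> * h \<xi>"
    define z where "z = min 1 (norm \<zeta>)"
    have z: "0 < z" "z \<le> 1" using * by (auto simp: z_def)
    have ze: "0 < z powr e" "z powr e \<le> 1" using z e by (auto intro: powr_le1)
    have "z powr e = (z powr (1 / amin)) powr r" by (simp add: powr_powr e_def)
    also have "\<dots> \<le> (min 1 (anorm a \<zeta>)) powr r"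
      using min_norm_powr_le[OF *(2)] c(2) by (intro powr_mono2) (auto simp: z_def)
    finally have "c * z powr e \<le> c * (min 1 (anorm a \<zeta>)) powr r" using c by simp
    also have "\<dots> \<le> h \<zeta>" by (rule c(3)[OF *(2)])
    also have "\<dots> \<le> R * h \<xi>" using R(2)[OF *] by simp
    finally have "\<delta> * (c * z powr e) \<le> \<delta> * (R * h \<xi>)" using \<delta> by simp
    then have "\<delta> * c / R * z powr e \<le> \<delta> * h \<xi>" using R(1) by (simp add: field_simps)
    moreover have "b * z powr e \<le> \<delta> * c / R * z powr e" using b(3) by (intro mult_right_mono) auto
    ultimately have s: "b * z powr e \<le> \<delta> * h \<xi>" by linarith
    have bz: "0 < b * z powr e" "b * z powr e \<le> 1" using b ze by (auto intro: mult_le_one)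
    have "(\<delta> * h \<xi>) powr (- (a $ i)) \<le> (b * z powr e) powr (- (a $ i))"
      using s bz amin(1) amin(2)[of i] by (intro powr_mono2') auto
    also have "\<dots> \<le> (b * z powr e) powr (- amax)"
      using bz amax[of i] by (intro powr_mono') auto
    also have "\<dots> = b powr (- amax) * z powr (- (e * amax))"
      using b ze by (simp add: powr_mult powr_powr)
    also have "z powr (- (e * amax)) \<le> z powr (- real M)"
      using z M by (intro powr_mono') auto
    also have "z powr (- real M) = (1 / z) ^ M"
      using z by (simp add: powr_minus powr_realpow power_divide inverse_eq_divide)
    also have "(1 / z) ^ M \<le> 1 + (1 / norm \<zeta>) ^ M"
      by (auto simp: z_def min_def)
    finally show "(\<delta> * h \<xi>) powr (- (a $ i)) \<le> b powr (- amax) * (1 + (1 / norm \<zeta>) ^ M)"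
      using b by (simp add: mult_left_mono)
  qed
qed

lemma (in anisotropy) balls_meeting_origin_bounded:
  assumes hybrid: "hybrid_regulation a \<rho> h\<^sub>1 h\<^sub>2 \<delta>\<^sub>1 \<delta>\<^sub>2 c\<^sub>1 h"
    and h_moderate: "moderate a \<delta>\<^sub>0 h" and \<delta>: "0 < \<delta>" "\<delta> < \<delta>\<^sub>0"
    and \<kappa>: "\<kappa> \<ge> 1" "\<And>x y. anorm a (x + y) \<le> \<kappa> * (anorm a x + anorm a y)"
  obtains r where "\<And>\<xi> \<zeta>. \<xi> \<noteq> 0 \<Longrightarrow> 0 \<notin> aball a \<xi> (\<delta> * h \<xi>) \<Longrightarrow> aball a \<xi> (\<delta> * h \<xi>) \<inter> aball a 0 C \<noteq> {} \<Longrightarrow>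
    \<zeta> \<in> aball a \<xi> (\<delta> * h \<xi>) \<Longrightarrow> norm \<zeta> \<le> r"
proof -
  obtain c r d where d: "0 < d" "\<And>\<xi>. \<xi> \<noteq> 0 \<Longrightarrow> h \<xi> \<le> d * anorm a \<xi>"
    using hybrid_regulation_bounds[OF hybrid anorm_works(1)] by metis
  obtain R where R: "R > 0" "\<And>\<xi> \<zeta>. \<xi> \<noteq> 0 \<Longrightarrow> \<zeta> \<noteq> 0 \<Longrightarrow> adist a \<xi> \<zeta> < \<delta> * h \<xi> \<Longrightarrow> h \<zeta> \<le> R * h \<xi> \<and> h \<xi> \<le> R * h \<zeta>"
    by (rule moderateE[OF h_moderate \<delta>]) (rule that)
  define K where "K = \<delta> * (R * (d * C))"
  define T where "T = max 1 (\<kappa> * (\<kappa> * (K + C) + K))"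
  show ?thesis
  proof (rule that[of "T powr amax"])
    fix \<xi> \<zeta> assume *: "\<xi> \<noteq> 0" "0 \<notin> aball a \<xi> (\<delta> * h \<xi>)" "aball a \<xi> (\<delta> * h \<xi>) \<inter> aball a 0 C \<noteq> {}"
      "\<zeta> \<in> aball a \<xi> (\<delta> * h \<xi>)"
    then obtain \<eta> where "\<eta> \<in> aball a \<xi> (\<delta> * h \<xi>)" "\<eta> \<in> aball a 0 C" by auto
    then have \<eta>: "adist a \<xi> \<eta> < \<delta> * h \<xi>" "anorm a (- \<eta>) < C" "\<eta> \<noteq> 0"
      using *(2) by (auto simp: aball_def adist_def)
    have "h \<xi> \<le> R * h \<eta>" using R(2)[OF *(1) \<eta>(3,1)] by simp
    also have "\<dots> \<le> R * (d * C)"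
      using R(1) d(1) \<eta>(2) by (intro mult_left_mono order_trans[OF d(2)[OF \<eta>(3)]]) auto
    finally have K: "\<delta> * h \<xi> \<le> K" using \<delta> by (simp add: K_def)
    have "anorm a \<xi> \<le> \<kappa> * (anorm a (\<xi> - \<eta>) + anorm a \<eta>)" using \<kappa>(2)[of "\<xi> - \<eta>" \<eta>] by simp
    also have "\<dots> \<le> \<kappa> * (K + C)" using \<eta> K \<kappa>(1) by (intro mult_left_mono add_mono) (auto simp: adist_def)
    finally have 1: "anorm a \<xi> \<le> \<kappa> * (K + C)" .
    have "anorm a \<zeta> \<le> \<kappa> * (anorm a \<xi> + anorm a (- (\<xi> - \<zeta>)))" using \<kappa>(2)[of \<xi> "- (\<xi> - \<zeta>)"] by simp
    also have "\<dots> \<le> \<kappa> * (\<kappa> * (K + C) + K)"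
      using *(4) K \<kappa>(1) unfolding anorm_minus by (intro mult_left_mono add_mono 1) (auto simp: aball_def adist_def)
    also have "\<dots> \<le> T" by (simp add: T_def)
    finally show "norm \<zeta> \<le> T powr amax" by (rule norm_le_powr_amax) (simp add: T_def)
  qed
qed

section \<open>The partition of unity of a square-root system\<close>

locale bump_covering =
  fixes a :: "real^'n::finite" and J :: "'j set" and s :: "'j \<Rightarrow> real" and A :: "'j \<Rightarrow> real^'n^'n"
    and b :: "'j \<Rightarrow> real^'n" and P Q :: "(real^'n) set" and \<Phi> :: "real^'n \<Rightarrow> real"
  assumes s_pos: "\<And>j. j \<in> J \<Longrightarrow> s j > 0"
    and A: "\<And>j. j \<in> J \<Longrightarrow> A j = dilation a (s j)"
    and covering: "structured_covering J A b P Q"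
    and \<Phi>: "smooth \<Phi>" "\<And>x. x \<in> P \<Longrightarrow> \<Phi> x = 1" "supp \<Phi> \<subseteq> Q"
begin

definition patch :: "'j \<Rightarrow> (real^'n) set" where
  "patch j = affine_map (A j) (b j) ` Q"

definition pullback :: "'j \<Rightarrow> real^'n \<Rightarrow> real^'n" where
  "pullback j \<zeta> = (\<chi> i. s j powr (- (a $ i)) * (\<zeta> $ i - b j $ i))"

abbreviation bump :: "'j \<Rightarrow> real^'n \<Rightarrow> real" where
  "bump \<equiv> pulled_bump A b \<Phi>"

definition sumsq :: "'j set \<Rightarrow> real^'n \<Rightarrow> real" where
  "sumsq F \<zeta> = (\<Sum>k | k \<in> F \<and> \<zeta> \<in> patch k. (bump k \<zeta>)\<^sup>2)"

definition part :: "'j set \<Rightarrow> real^'n \<Rightarrow> real" where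
  "part F \<zeta> = sumsq F \<zeta> / sumsq J \<zeta>"

lemma affine_pullback: "j \<in> J \<Longrightarrow> affine_map (A j) (b j) (pullback j \<zeta>) = \<zeta>"
  using s_pos[of j] by (simp add: affine_map_def A pullback_def vec_eq_iff powr_minus field_simps)

lemma pullback_affine: "j \<in> J \<Longrightarrow> pullback j (affine_map (A j) (b j) x) = x"
  using s_pos[of j] by (simp add: affine_map_def A pullback_def vec_eq_iff powr_minus field_simps)

lemma bump_eq:
  assumes "j \<in> J" shows "bump j \<zeta> = \<Phi> (pullback j \<zeta>)"
proof -
  have "inj (affine_map (A j) (b j))"
    by (rule inj_on_inverseI[of _ "pullback j"]) (rule pullback_affine[OF assms])
  then have "inv (affine_map (A j) (b j)) \<zeta> = pullback j \<zeta>"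
    by (rule inv_f_eq) (rule affine_pullback[OF assms])
  then show ?thesis by (simp only: pulled_bump_def)
qed

lemma mem_affine_image_iff:
  assumes "j \<in> J" shows "\<zeta> \<in> affine_map (A j) (b j) ` S \<longleftrightarrow> pullback j \<zeta> \<in> S"
proof
  assume "pullback j \<zeta> \<in> S"
  then show "\<zeta> \<in> affine_map (A j) (b j) ` S"
    by (rule image_eqI[rotated]) (simp add: affine_pullback[OF assms])
qed (auto simp: pullback_affine[OF assms])

lemma mem_patch_iff: "j \<in> J \<Longrightarrow> \<zeta> \<in> patch j \<longleftrightarrow> pullback j \<zeta> \<in> Q"
  unfolding patch_def by (rule mem_affine_image_iff)

lemma continuous_pullback: "continuous_on UNIV (pullback j)"
  unfolding pullback_def by (intro continuous_on_vec_lambda continuous_intros)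

lemma open_patch: "j \<in> J \<Longrightarrow> open (patch j)"
proof -
  assume j: "j \<in> J"
  have "patch j = pullback j -` Q" using mem_patch_iff[OF j] by auto
  moreover have "open Q" using covering by (simp add: structured_covering_def)
  ultimately show ?thesis using continuous_pullback[of j] by (simp add: continuous_on_open_vimage)
qed

lemma bounded_patch: "bounded (patch j)"
proof -
  have "bounded Q" using covering by (simp add: structured_covering_def)
  then have "compact (closure Q)" by (simp add: compact_closure)
  moreover have "continuous_on (closure Q) (affine_map (A j) (b j))"
    unfolding affine_map_def[abs_def]
    by (intro continuous_intros linear_continuous_on matrix_vector_mul_bounded_linear)
  ultimately have "bounded (affine_map (A j) (b j) ` closure Q)"
    by (intro compact_imp_bounded compact_continuous_image)
  then show ?thesis unfolding patch_def
    by (rule bounded_subset) (intro image_mono closure_subset)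
qed

lemma admissible:
  shows "admissible_covering J patch"
    and "admissible_covering J (\<lambda>j. affine_map (A j) (b j) ` P)"
proof -
  show "admissible_covering J patch"
    using covering unfolding structured_covering_def patch_def[abs_def] by (elim conjE)
  show "admissible_covering J (\<lambda>j. affine_map (A j) (b j) ` P)"
    using covering unfolding structured_covering_def by (elim conjE)
qed

lemma zero_notin_patch: "j \<in> J \<Longrightarrow> 0 \<notin> patch j"
  using admissible(1) by (auto simp: admissible_covering_def)

lemma patch_cover:
  assumes "\<zeta> \<noteq> 0" shows "\<exists>j\<in>J. \<zeta> \<in> patch j"
proof -
  have "(\<Union>j\<in>J. patch j) = - {0}" using admissible(1) by (simp add: admissible_covering_def)
  then have "\<zeta> \<in> (\<Union>j\<in>J. patch j)" using assms by simp
  then show ?thesis by simp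
qed

lemma core_cover:
  assumes "\<zeta> \<noteq> 0" shows "\<exists>j\<in>J. pullback j \<zeta> \<in> P"
proof -
  have "(\<Union>j\<in>J. affine_map (A j) (b j) ` P) = - {0}"
    using admissible(2) by (simp add: admissible_covering_def)
  then have "\<zeta> \<in> (\<Union>j\<in>J. affine_map (A j) (b j) ` P)" using assms by simp
  then obtain j where "j \<in> J" "\<zeta> \<in> affine_map (A j) (b j) ` P" by (rule UN_E)
  then show ?thesis using mem_affine_image_iff by auto
qed

lemma patch_overlap:
  obtains N where "\<And>j. j \<in> J \<Longrightarrow> finite {i\<in>J. patch i \<inter> patch j \<noteq> {}}"
    "\<And>j. j \<in> J \<Longrightarrow> card {i\<in>J. patch i \<inter> patch j \<noteq> {}} \<le> N"
proof -
  obtain N where "\<forall>j\<in>J. finite {i\<in>J. patch i \<inter> patch j \<noteq> {}} \<and> card {i\<in>J. patch i \<inter> patch j \<noteq> {}} \<le> N"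
    using admissible(1) unfolding admissible_covering_def by (elim conjE exE)
  then show ?thesis using that[of N] by simp
qed

lemma finite_overlap: "j \<in> J \<Longrightarrow> finite {i\<in>J. patch i \<inter> patch j \<noteq> {}}"
  by (rule patch_overlap)

lemma smooth_\<Phi>: "smooth_on UNIV \<Phi>"
  using \<Phi>(1) by (simp add: smooth_iff_smooth_on)

lemma \<Phi>_eq_0: "x \<notin> Q \<Longrightarrow> \<Phi> x = 0"
  using \<Phi>(3) closure_subset[of "{x. \<Phi> x \<noteq> 0}"] by (auto simp: supp_def)

lemma partials_\<Phi>_eq_0:
  assumes "x \<notin> Q" shows "partials is \<Phi> x = 0"
proof -
  have "open (- supp \<Phi>)" by (simp add: supp_def open_Compl)
  moreover have "\<Phi> y = 0" if "y \<in> - supp \<Phi>" for y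
    using that closure_subset[of "{x. \<Phi> x \<noteq> 0}"] by (auto simp: supp_def)
  ultimately have "partials is \<Phi> x = partials is (\<lambda>x. 0) x"
    by (rule partials_cong_open) (use assms \<Phi>(3) in auto)
  then show ?thesis by (simp add: partials_const)
qed

lemma \<Phi>_bound:
  obtains C where "0 \<le> C" "\<And>is x. length is \<le> n \<Longrightarrow> norm (partials is \<Phi> x) \<le> C"
proof -
  let ?f = "\<lambda>x. complex_of_real (\<Phi> x)"
  have "bounded Q" using covering by (simp add: structured_covering_def)
  then obtain r where r: "\<And>x. x \<in> Q \<Longrightarrow> norm x \<le> r" by (auto simp: bounded_iff)
  have S: "?f \<in> schwartz"
  proof (rule schwartz_compact_support)
    show "smooth_on UNIV ?f" by (intro smooth_on_of_real smooth_\<Phi>) simp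
    show "?f x = 0" if "norm x > r" for x
    proof -
      have "x \<notin> Q" using r[of x] that by auto
      then show ?thesis by (simp add: \<Phi>_eq_0)
    qed
  qed
  have p: "partials is ?f x = of_real (partials is \<Phi> x)" for "is" x
    by (rule partials_bounded_linear[OF open_UNIV bounded_linear_of_real smooth_\<Phi> UNIV_I])
  show ?thesis
  proof (rule that[of "schwartz_seminorm 0 n ?f"])
    show "0 \<le> schwartz_seminorm 0 n ?f" by (rule schwartz_seminorm_nonneg[OF S])
    show "norm (partials is \<Phi> x) \<le> schwartz_seminorm 0 n ?f" if "length is \<le> n" for "is" x
      using schwartz_seminorm_ge[OF S that, of x 0] by (simp add: p)
  qed
qed

lemma smooth_on_bump:
  assumes "j \<in> J" shows "smooth_on UNIV (bump j)"
proof -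
  have "smooth_on UNIV (\<lambda>\<zeta>. \<Phi> (pullback j \<zeta>))"
    unfolding pullback_def by (rule smooth_on_diag_affine[OF smooth_\<Phi>])
  then show ?thesis
    by (rule smooth_on_cong[OF open_UNIV, rotated]) (simp add: bump_eq[OF assms])
qed

lemma partials_bump:
  "j \<in> J \<Longrightarrow> partials is (bump j) \<zeta> = prod_list (map (\<lambda>i. s j powr (- (a $ i))) is) * partials is \<Phi> (pullback j \<zeta>)"
proof -
  assume j: "j \<in> J"
  have "partials is (bump j) = partials is (\<lambda>\<zeta>. \<Phi> (pullback j \<zeta>))"
    using bump_eq[OF j] by (intro arg_cong[where f = "partials is"]) auto
  then show ?thesis
    using partials_diag_affine[OF smooth_\<Phi>, of "is" "\<lambda>i. s j powr (- (a $ i))" "b j" \<zeta>]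
    by (simp add: pullback_def)
qed

lemma bump_eq_0: "j \<in> J \<Longrightarrow> \<zeta> \<notin> patch j \<Longrightarrow> bump j \<zeta> = 0"
  by (simp add: bump_eq mem_patch_iff \<Phi>_eq_0)

definition steepness :: "real \<Rightarrow> real^'n \<Rightarrow> bool" where
  "steepness L \<zeta> \<longleftrightarrow> 0 \<le> L \<and> (\<forall>k\<in>J. \<zeta> \<in> patch k \<longrightarrow> (\<forall>i. s k powr (- (a $ i)) \<le> L))"

lemma jet_bump:
  obtains C where "0 \<le> C" "\<And>j L \<zeta>. j \<in> J \<Longrightarrow> steepness L \<zeta> \<Longrightarrow> jet n C L (bump j) \<zeta>"
proof -
  obtain C where C: "0 \<le> C" "\<And>is x. length is \<le> n \<Longrightarrow> norm (partials is \<Phi> x) \<le> C"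
    by (rule \<Phi>_bound) (rule that)
  show ?thesis
  proof (rule that[OF C(1)])
    fix j L \<zeta> assume j: "j \<in> J" and L: "steepness L \<zeta>"
    have L0: "0 \<le> L" using L by (simp add: steepness_def)
    show "jet n C L (bump j) \<zeta>"
      unfolding jet_def
    proof (intro allI impI)
      fix "is" :: "'n list" assume l: "length is \<le> n"
      show "norm (partials is (bump j) \<zeta>) \<le> C * L ^ length is"
      proof (cases "\<zeta> \<in> patch j")
        case True
        have "\<bar>prod_list (map (\<lambda>i. s j powr (- (a $ i))) is)\<bar> \<le> L ^ length is"
        proof (induction "is")
          case (Cons i "is")
          have "s j powr (- (a $ i)) \<le> L" using L j True by (simp add: steepness_def)
          then show ?case using Cons L0 by (auto simp: abs_mult intro!: mult_mono)
        qed simp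
        then have "\<bar>prod_list (map (\<lambda>i. s j powr (- (a $ i))) is)\<bar> * norm (partials is \<Phi> (pullback j \<zeta>)) \<le> L ^ length is * C"
          using C L0 l by (intro mult_mono) auto
        then show ?thesis by (simp add: partials_bump[OF j] abs_mult mult.commute)
      next
        case False
        then show ?thesis using C L0 by (simp add: partials_bump[OF j] partials_\<Phi>_eq_0 mem_patch_iff[OF j])
      qed
    qed
  qed
qed

lemma finite_patches_at: "\<zeta> \<noteq> 0 \<Longrightarrow> finite {k \<in> J. \<zeta> \<in> patch k}"
proof -
  assume "\<zeta> \<noteq> 0"
  then obtain i where i: "i \<in> J" "\<zeta> \<in> patch i" using patch_cover by blast
  from finite_overlap[OF i(1)] show ?thesis by (rule rev_finite_subset) (use i in auto)
qed

lemma sumsq_local: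
  assumes "F \<subseteq> J" "i \<in> J" "\<zeta> \<in> patch i" "finite {k\<in>J. patch k \<inter> patch i \<noteq> {}}"
  shows "sumsq F \<zeta> = (\<Sum>k\<in>{k\<in>F. patch k \<inter> patch i \<noteq> {}}. bump k \<zeta> * bump k \<zeta>)"
proof -
  have "finite {k\<in>F. patch k \<inter> patch i \<noteq> {}}"
    by (rule finite_subset[OF _ assms(4)]) (use assms(1) in auto)
  then have "sumsq F \<zeta> = (\<Sum>k\<in>{k\<in>F. patch k \<inter> patch i \<noteq> {}}. (bump k \<zeta>)\<^sup>2)"
    unfolding sumsq_def using assms bump_eq_0 by (intro sum.mono_neutral_left) auto
  then show ?thesis by (simp add: power2_eq_square)
qed

lemma smooth_on_sumsq:
  assumes F: "F \<subseteq> J" shows "smooth_on (- {0}) (sumsq F)"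
proof (rule smooth_on_locally)
  fix x :: "real^'n" assume "x \<in> - {0}"
  then obtain i where i: "i \<in> J" "x \<in> patch i" using patch_cover by blast
  note fin = finite_overlap[OF i(1)]
  have "smooth_on (patch i) (\<lambda>\<zeta>. \<Sum>k\<in>{k\<in>F. patch k \<inter> patch i \<noteq> {}}. bump k \<zeta> * bump k \<zeta>)"
    using F by (intro smooth_on_sum smooth_on_mult open_patch i)
      (auto intro: smooth_on_mono[OF smooth_on_bump])
  then have "smooth_on (patch i) (sumsq F)"
    by (rule smooth_on_cong[OF open_patch[OF i(1)], rotated]) (simp add: sumsq_local[OF F i(1) _ fin])
  then show "\<exists>V. x \<in> V \<and> smooth_on V (sumsq F)" using i by blast
qed

lemma jet_sumsq:
  obtains C where "0 \<le> C" "\<And>F L \<zeta>. F \<subseteq> J \<Longrightarrow> \<zeta> \<noteq> 0 \<Longrightarrow> steepness L \<zeta> \<Longrightarrow> jet n C L (sumsq F) \<zeta>"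
proof -
  obtain C where C: "0 \<le> C" "\<And>j L \<zeta>. j \<in> J \<Longrightarrow> steepness L \<zeta> \<Longrightarrow> jet n C L (bump j) \<zeta>"
    by (rule jet_bump) (rule that)
  obtain N where N: "\<And>j. j \<in> J \<Longrightarrow> finite {i\<in>J. patch i \<inter> patch j \<noteq> {}}"
    "\<And>j. j \<in> J \<Longrightarrow> card {i\<in>J. patch i \<inter> patch j \<noteq> {}} \<le> N"
    by (rule patch_overlap) (rule that)
  show ?thesis
  proof (rule that[of "real N * (2 ^ n * C * C)"])
    show "0 \<le> real N * (2 ^ n * C * C)" using C by simp
    fix F L \<zeta> assume F: "F \<subseteq> J" and \<zeta>: "(\<zeta> :: real^'n) \<noteq> 0" and L: "steepness L \<zeta>"
    obtain i where i: "i \<in> J" "\<zeta> \<in> patch i" using patch_cover[OF \<zeta>] by blast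
    let ?I = "{k\<in>F. patch k \<inter> patch i \<noteq> {}}"
    have fin: "finite ?I" by (rule finite_subset[OF _ N(1)[OF i(1)]]) (use F in auto)
    have card: "card ?I \<le> N"
      by (rule order_trans[OF card_mono[OF N(1)[OF i(1)]] N(2)[OF i(1)]]) (use F in auto)
    have L0: "0 \<le> L" using L by (simp add: steepness_def)
    have "jet n (real (card ?I) * (2 ^ n * C * C)) L (\<lambda>\<zeta>. \<Sum>k\<in>?I. bump k \<zeta> * bump k \<zeta>) \<zeta>"
      using F C L L0 fin
      by (intro jet_sum[OF open_UNIV UNIV_I] jet_mult[OF open_UNIV UNIV_I] smooth_on_mult smooth_on_bump) auto
    then have "jet n (real N * (2 ^ n * C * C)) L (\<lambda>\<zeta>. \<Sum>k\<in>?I. bump k \<zeta> * bump k \<zeta>) \<zeta>"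
      by (rule jet_mono) (use card C L0 in \<open>auto intro!: mult_right_mono\<close>)
    then show "jet n (real N * (2 ^ n * C * C)) L (sumsq F) \<zeta>"
      by (subst jet_cong_open[OF open_patch[OF i(1)] _ i(2)]) (simp_all add: sumsq_local[OF F i(1) _ N(1)[OF i(1)]])
  qed
qed

lemma sumsq_nonneg: "0 \<le> sumsq F \<zeta>"
  unfolding sumsq_def by (intro sum_nonneg) simp

lemma sumsq_J_ge_1: "\<zeta> \<noteq> 0 \<Longrightarrow> 1 \<le> sumsq J \<zeta>"
proof -
  assume \<zeta>: "\<zeta> \<noteq> 0"
  then obtain j where j: "j \<in> J" "pullback j \<zeta> \<in> P" using core_cover by blast
  have PQ: "P \<subseteq> Q" using covering closure_subset[of P] by (auto simp: structured_covering_def)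
  have "(bump j \<zeta>)\<^sup>2 \<le> sumsq J \<zeta>"
    unfolding sumsq_def using finite_patches_at[OF \<zeta>] j PQ by (intro member_le_sum) (auto simp: mem_patch_iff)
  then show ?thesis using j by (simp add: bump_eq \<Phi>(2))
qed

lemma part_alt: "part F = (\<lambda>\<zeta>. sumsq F \<zeta> * inverse (sumsq J \<zeta>))"
  by (simp add: part_def fun_eq_iff divide_inverse)

lemma smooth_on_part:
  assumes "F \<subseteq> J" shows "smooth_on (- {0}) (part F)"
proof -
  have "sumsq J y \<noteq> 0" if "y \<in> - {0}" for y
    using sumsq_J_ge_1[of y] that by auto
  then show ?thesis
    unfolding part_alt using assms
    by (intro smooth_on_mult smooth_on_inverse smooth_on_sumsq) (auto simp: open_Compl)
qed

lemma jet_part: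
  obtains C where "0 \<le> C" "\<And>F L \<zeta>. F \<subseteq> J \<Longrightarrow> \<zeta> \<noteq> 0 \<Longrightarrow> steepness L \<zeta> \<Longrightarrow> jet n C L (part F) \<zeta>"
proof -
  obtain C where C: "0 \<le> C" "\<And>F L \<zeta>. F \<subseteq> J \<Longrightarrow> \<zeta> \<noteq> 0 \<Longrightarrow> steepness L \<zeta> \<Longrightarrow> jet n C L (sumsq F) \<zeta>"
    by (rule jet_sumsq) (rule that)
  obtain D where D: "0 \<le> D"
    "\<And>(f :: real^'n \<Rightarrow> real) U L x. open U \<Longrightarrow> x \<in> U \<Longrightarrow> 0 \<le> L \<Longrightarrow>
      smooth_on U f \<Longrightarrow> \<forall>y\<in>U. 1 \<le> norm (f y) \<Longrightarrow> jet n C L f x \<Longrightarrow>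
      jet n D L (\<lambda>x. inverse (f x)) x"
    by (rule jet_inverse[OF C(1), where n = n]) (rule that)
  have nz: "sumsq J y \<noteq> 0" if "y \<in> - {0}" for y
    using sumsq_J_ge_1[of y] that by auto
  have ge: "\<forall>y\<in>- {0}. 1 \<le> norm (sumsq J y)"
    using order_trans[OF sumsq_J_ge_1 abs_ge_self] by simp
  show ?thesis
  proof (rule that[of "2 ^ n * C * D"])
    show "0 \<le> 2 ^ n * C * D" using C D by simp
    fix F L \<zeta> assume F: "F \<subseteq> J" and \<zeta>: "(\<zeta> :: real^'n) \<noteq> 0" and L: "steepness L \<zeta>"
    have L0: "0 \<le> L" using L by (simp add: steepness_def)
    have o: "open (- {0::real^'n})" by (intro open_Compl) simp
    have m: "\<zeta> \<in> - {0}" using \<zeta> by simp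
    have i: "jet n D L (\<lambda>x. inverse (sumsq J x)) \<zeta>"
      by (rule D(2)[OF o m L0 smooth_on_sumsq[OF order_refl] ge C(2)[OF order_refl \<zeta> L]])
    have si: "smooth_on (- {0}) (\<lambda>x. inverse (sumsq J x))"
      by (rule smooth_on_inverse[OF o nz smooth_on_sumsq[OF order_refl]])
    show "jet n (2 ^ n * C * D) L (part F) \<zeta>"
      unfolding part_alt
      by (rule jet_mult[OF o m L0 smooth_on_sumsq[OF F] si C(2)[OF F \<zeta> L] i C(1) D(1)])
  qed
qed

lemma part_eq_0:
  assumes "\<And>k. k \<in> F \<Longrightarrow> \<zeta> \<notin> patch k" shows "part F \<zeta> = 0"
proof -
  have "{k. k \<in> F \<and> \<zeta> \<in> patch k} = {}" using assms by auto
  then show ?thesis by (simp only: part_def sumsq_def sum.empty div_0)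
qed

lemma part_0 [simp]: "F \<subseteq> J \<Longrightarrow> part F 0 = 0"
  using zero_notin_patch by (intro part_eq_0) auto

lemma part_Un:
  assumes "F \<subseteq> J" "G \<subseteq> J" "F \<inter> G = {}"
  shows "part (F \<union> G) \<zeta> = part F \<zeta> + part G \<zeta>"
proof (cases "\<zeta> = 0")
  case False
  have fin: "finite {k \<in> H. \<zeta> \<in> patch k}" if "H \<subseteq> J" for H
    by (rule finite_subset[OF _ finite_patches_at[OF False]]) (use that in auto)
  have "{k. k \<in> F \<union> G \<and> \<zeta> \<in> patch k} = {k \<in> F. \<zeta> \<in> patch k} \<union> {k \<in> G. \<zeta> \<in> patch k}" by auto
  then have "sumsq (F \<union> G) \<zeta> = sumsq F \<zeta> + sumsq G \<zeta>"
    unfolding sumsq_def using fin[OF assms(1)] fin[OF assms(2)] assms(3)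
    by (simp add: sum.union_disjoint disjoint_iff)
  then show ?thesis by (simp add: part_def add_divide_distrib)
qed (use assms in simp)

lemma part_J: "\<zeta> \<noteq> 0 \<Longrightarrow> part J \<zeta> = 1"
  using sumsq_J_ge_1[of \<zeta>] by (simp add: part_def)

lemma sqrt_system_power2:
  assumes "j \<in> J"
  shows "(sqrt_system J A b \<Phi> j \<zeta>)\<^sup>2 = part {j} \<zeta>"
proof -
  have z: "bump k \<zeta> = 0" if "k \<in> J" "\<zeta> \<notin> patch k" for k using that by (rule bump_eq_0)
  have fin: "finite {k \<in> J. \<zeta> \<in> patch k}"
  proof (cases "\<zeta> = 0")
    case True
    then have "{k \<in> J. \<zeta> \<in> patch k} = {}" using zero_notin_patch by auto
    then show ?thesis by (simp only: finite.emptyI)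
  qed (rule finite_patches_at)
  have "(\<Sum>\<^sub>\<infinity>k\<in>J. (bump k \<zeta>)\<^sup>2) = (\<Sum>\<^sub>\<infinity>k\<in>{k \<in> J. \<zeta> \<in> patch k}. (bump k \<zeta>)\<^sup>2)"
    by (rule infsum_cong_neutral) (auto simp: z)
  also have "\<dots> = sumsq J \<zeta>" using fin by (simp add: sumsq_def)
  finally have "(\<Sum>\<^sub>\<infinity>k\<in>J. (bump k \<zeta>)\<^sup>2) = sumsq J \<zeta>" .
  moreover have "sumsq {j} \<zeta> = (bump j \<zeta>)\<^sup>2"
  proof (cases "\<zeta> \<in> patch j")
    case True
    then have "{k. k \<in> {j} \<and> \<zeta> \<in> patch k} = {j}" by auto
    then show ?thesis by (simp add: sumsq_def)
  next
    case False
    then have e: "{k. k \<in> {j} \<and> \<zeta> \<in> patch k} = {}" by auto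
    show ?thesis using z[OF assms False] unfolding sumsq_def e by simp
  qed
  ultimately show ?thesis
    using sumsq_nonneg[of J \<zeta>] by (simp add: sqrt_system_def part_def power_divide)
qed

lemma part_finite_sum:
  assumes "finite F" "F \<subseteq> J"
  shows "part F \<zeta> = (\<Sum>j\<in>F. part {j} \<zeta>)"
  using assms
proof (induction F rule: finite_induct)
  case (insert j F)
  then show ?case using part_Un[of "{j}" F \<zeta>] by simp
qed (simp add: part_def sumsq_def)

lemma finite_patches_meeting:
  assumes "compact K" "0 \<notin> K"
  shows "finite {k \<in> J. patch k \<inter> K \<noteq> {}}"
proof -
  have cov: "K \<subseteq> (\<Union>i\<in>J. patch i)"
  proof
    fix x assume "x \<in> K"
    then have "x \<noteq> 0" using assms(2) by auto
    from patch_cover[OF this] show "x \<in> (\<Union>i\<in>J. patch i)" by simp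
  qed
  obtain I where I: "I \<subseteq> J" "finite I" "K \<subseteq> (\<Union>i\<in>I. patch i)"
    by (rule compactE_image[OF assms(1) _ cov]) (erule open_patch, rule that)
  have "finite (\<Union>i\<in>I. {k\<in>J. patch k \<inter> patch i \<noteq> {}})" using I finite_overlap by auto
  then show ?thesis by (rule rev_finite_subset) (use I in blast)
qed

lemma part_vanishes_near_0:
  assumes "finite F" "F \<subseteq> J"
  obtains \<epsilon> where "\<epsilon> > 0" "\<And>\<zeta>. norm \<zeta> < \<epsilon> \<Longrightarrow> part F \<zeta> = 0"
proof -
  let ?U = "\<Inter>k\<in>F. {\<zeta>. pullback k \<zeta> \<in> - supp \<Phi>}"
  have "open {\<zeta>. pullback k \<zeta> \<in> - supp \<Phi>}" for k
    using continuous_pullback[of k] open_vimage[of "- supp \<Phi>" "pullback k"]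
    by (simp add: supp_def open_Compl vimage_def)
  then have "open ?U" using assms(1) by (intro open_INT) auto
  moreover have "0 \<in> ?U"
    using zero_notin_patch mem_patch_iff \<Phi>(3) assms(2) by blast
  ultimately obtain \<epsilon> where e: "\<epsilon> > 0" "ball 0 \<epsilon> \<subseteq> ?U" using open_contains_ball by blast
  have "part F \<zeta> = 0" if "norm \<zeta> < \<epsilon>" for \<zeta>
  proof -
    have "\<zeta> \<in> ?U" using e(2) that by auto
    then have "bump k \<zeta> = 0" if "k \<in> F" for k
      using that bump_eq[of k \<zeta>, OF subsetD[OF assms(2) that]] closure_subset[of "{x. \<Phi> x \<noteq> 0}"]
      by (auto simp: supp_def)
    then show ?thesis by (simp add: part_def sumsq_def)
  qed
  then show ?thesis using that e(1) by blast
qed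

lemma smooth_on_part_UNIV:
  assumes "F \<subseteq> J" "\<epsilon> > 0" "\<And>\<zeta>. norm \<zeta> < \<epsilon> \<Longrightarrow> part F \<zeta> = 0"
  shows "smooth_on UNIV (part F)"
proof -
  have "smooth_on (ball 0 \<epsilon>) (part F)"
    by (rule smooth_on_cong[of _ "\<lambda>_. 0"]) (use assms(3) in auto)
  then have "smooth_on (- {0} \<union> ball 0 \<epsilon>) (part F)"
    by (intro smooth_on_Un smooth_on_part assms(1))
  moreover have "- {0} \<union> ball 0 \<epsilon> = (UNIV :: (real^'n) set)" using assms(2) by auto
  ultimately show ?thesis by simp
qed

end

section \<open>Convergence of the decomposition\<close>

lemma jet_weight_1:
  assumes "jet n C L f x" "0 \<le> C" "0 \<le> L" "L \<le> K" "1 \<le> K"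
  shows "jet n (C * K ^ n) 1 f x"
  unfolding jet_def
proof (intro allI impI)
  fix "is" :: "'a list" assume l: "length is \<le> n"
  have "norm (partials is f x) \<le> C * L ^ length is" by (rule jetD[OF assms(1) l])
  also have "\<dots> \<le> C * K ^ length is" using assms by (intro mult_left_mono power_mono) auto
  also have "\<dots> \<le> C * K ^ n" using assms l by (intro mult_left_mono power_increasing) auto
  finally show "norm (partials is f x) \<le> C * K ^ n * 1 ^ length is" by simp
qed

locale tame_bump_covering = bump_covering a J s A b P Q \<Phi>
  for a :: "real^'n::finite" and J :: "'j set" and s A b P Q \<Phi> +
  fixes B :: real and M :: nat
  assumes B: "1 \<le> B"
    and steep: "\<And>\<zeta>. \<zeta> \<noteq> 0 \<Longrightarrow> steepness (B * (1 + (1 / norm \<zeta>) ^ M)) \<zeta>"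
begin

lemma open_punctured: "open (- {0 :: real^'n})"
  by (simp add: open_Compl)

lemma jet_part_complex:
  obtains C where "0 \<le> C"
    "\<And>F \<zeta>. F \<subseteq> J \<Longrightarrow> \<zeta> \<noteq> 0 \<Longrightarrow> jet n C (B * (1 + (1 / norm \<zeta>) ^ M)) (\<lambda>x. complex_of_real (part F x)) \<zeta>"
proof -
  obtain C where C: "0 \<le> C" "\<And>F L \<zeta>. F \<subseteq> J \<Longrightarrow> \<zeta> \<noteq> 0 \<Longrightarrow> steepness L \<zeta> \<Longrightarrow> jet n C L (part F) \<zeta>"
    by (rule jet_part) (rule that)
  show ?thesis
  proof (rule that[OF C(1)])
    fix F \<zeta> assume F: "F \<subseteq> J" and \<zeta>: "(\<zeta> :: real^'n) \<noteq> 0"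
    show "jet n C (B * (1 + (1 / norm \<zeta>) ^ M)) (\<lambda>x. complex_of_real (part F x)) \<zeta>"
      by (rule jet_bounded_linear[OF open_punctured _ smooth_on_part[OF F] bounded_linear_of_real _ C(2)[OF F \<zeta> steep[OF \<zeta>]]])
        (use \<zeta> in auto)
  qed
qed

definition bounded_away :: "real \<Rightarrow> 'j set \<Rightarrow> bool" where
  "bounded_away \<epsilon> H \<longleftrightarrow> \<epsilon> > 0 \<and> H \<subseteq> J \<and> (\<forall>k\<in>H. \<forall>\<zeta>\<in>patch k. \<epsilon> \<le> norm \<zeta>)"

lemma bounded_away_subset: "bounded_away \<epsilon> H \<Longrightarrow> F \<subseteq> H \<Longrightarrow> bounded_away \<epsilon> F"
  unfolding bounded_away_def by auto

lemma bounded_away_part_eq_0: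
  assumes "bounded_away \<epsilon> H" "norm \<zeta> < \<epsilon>" shows "part H \<zeta> = 0"
  by (rule part_eq_0) (use assms in \<open>force simp: bounded_away_def\<close>)

lemma smooth_on_part_complex: "F \<subseteq> J \<Longrightarrow> smooth_on (- {0}) (\<lambda>x. complex_of_real (part F x))"
  by (intro smooth_on_of_real smooth_on_part open_punctured)

lemma smooth_on_part_bounded_away:
  "bounded_away \<epsilon> H \<Longrightarrow> smooth_on UNIV (\<lambda>x. complex_of_real (part H x))"
  by (intro smooth_on_of_real open_UNIV smooth_on_part_UNIV[of H \<epsilon>])
    (auto simp: bounded_away_def bounded_away_part_eq_0)

lemma jet_part_bounded_away:
  assumes "\<epsilon> > 0"
  obtains C where "0 \<le> C" "\<And>H x. bounded_away \<epsilon> H \<Longrightarrow> jet n C 1 (\<lambda>x. complex_of_real (part H x)) x"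
proof -
  obtain C where C: "0 \<le> C"
    "\<And>F \<zeta>. F \<subseteq> J \<Longrightarrow> \<zeta> \<noteq> 0 \<Longrightarrow> jet n C (B * (1 + (1 / norm \<zeta>) ^ M)) (\<lambda>x. complex_of_real (part F x)) \<zeta>"
    by (rule jet_part_complex) (rule that)
  define K where "K = B * (1 + (1 / \<epsilon>) ^ M)"
  have "1 * 1 \<le> B * (1 + (1 / \<epsilon>) ^ M)" using B assms by (intro mult_mono) auto
  then have K: "1 \<le> K" by (simp add: K_def)
  show ?thesis
  proof (rule that[of "C * K ^ n"])
    show "0 \<le> C * K ^ n" using C K by simp
    fix H x assume H: "bounded_away \<epsilon> H"
    show "jet n (C * K ^ n) 1 (\<lambda>x. complex_of_real (part H x)) x"
    proof (cases "norm x < \<epsilon>")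
      case True
      have "jet n (C * K ^ n) 1 (\<lambda>x. 0 :: complex) x" using C K by (intro jet_zero) auto
      then show ?thesis
        by (subst jet_cong_open[OF open_ball[of 0 \<epsilon>], of _ "\<lambda>x. 0"])
          (use True bounded_away_part_eq_0[OF H] in auto)
    next
      case False
      then have x: "x \<noteq> 0" using assms by auto
      have "(1 / norm x) ^ M \<le> (1 / \<epsilon>) ^ M" using False assms by (intro power_mono frac_le) auto
      then have "B * (1 + (1 / norm x) ^ M) \<le> K" unfolding K_def using B by (intro mult_left_mono) auto
      then show ?thesis
        using C(2)[OF _ x, of H] H C(1) K B by (intro jet_weight_1) (auto simp: bounded_away_def)
    qed
  qed
qed

lemma slow_growth_part:
  assumes "bounded_away \<epsilon> H" shows "slow_growth (\<lambda>x. complex_of_real (part H x))"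
  unfolding slow_growth_def
proof (intro conjI allI)
  show "smooth_on UNIV (\<lambda>x. complex_of_real (part H x))" by (rule smooth_on_part_bounded_away[OF assms])
  fix n
  have "\<epsilon> > 0" using assms by (simp add: bounded_away_def)
  then obtain C where "0 \<le> C" "\<And>H x. bounded_away \<epsilon> H \<Longrightarrow> jet n C 1 (\<lambda>x. complex_of_real (part H x)) x"
    by (rule jet_part_bounded_away) (rule that)
  then have "\<forall>x. jet n (C * (1 + norm x) ^ 0) 1 (\<lambda>x. complex_of_real (part H x)) x" using assms by simp
  then show "\<exists>C K. \<forall>x. jet n (C * (1 + norm x) ^ K) 1 (\<lambda>x. complex_of_real (part H x)) x" by (intro exI)
qed

lemma schwartz_part_finite:
  assumes F: "finite F" "F \<subseteq> J" shows "(\<lambda>x. complex_of_real (part F x)) \<in> schwartz"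
proof -
  obtain \<epsilon> where e: "\<epsilon> > 0" "\<And>\<zeta>. norm \<zeta> < \<epsilon> \<Longrightarrow> part F \<zeta> = 0"
    by (rule part_vanishes_near_0[OF F]) (rule that)
  have "bounded (\<Union>k\<in>F. patch k)" using F(1) bounded_patch by (intro bounded_UN) auto
  then obtain r where "\<forall>x\<in>\<Union>k\<in>F. patch k. norm x \<le> r" unfolding bounded_iff by (elim exE)
  then have r: "part F x = 0" if "norm x > r" for x
    using that by (intro part_eq_0) force
  show ?thesis
    by (rule schwartz_compact_support[where r = r])
      (auto simp: r intro!: smooth_on_of_real smooth_on_part_UNIV[OF F(2) e])
qed

definition exhausts :: "(nat \<Rightarrow> 'j set) \<Rightarrow> 'j set \<Rightarrow> bool" where
  "exhausts F H \<longleftrightarrow> (\<forall>k. finite (F k) \<and> F k \<subseteq> H) \<and> (\<forall>E. finite E \<and> E \<subseteq> H \<longrightarrow> (\<forall>\<^sub>F k in sequentially. E \<subseteq> F k))"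

lemma exhausts_remainder_vanishes:
  assumes F: "exhausts F H" and H: "H \<subseteq> J" and K: "compact K" "0 \<notin> K"
  shows "\<forall>\<^sub>F k in sequentially. \<forall>\<zeta>\<in>K. part (H - F k) \<zeta> = 0"
proof -
  have "finite {j \<in> H. patch j \<inter> K \<noteq> {}}"
    by (rule finite_subset[OF _ finite_patches_meeting[OF K]]) (use H in auto)
  then have "\<forall>\<^sub>F k in sequentially. {j \<in> H. patch j \<inter> K \<noteq> {}} \<subseteq> F k"
    using F unfolding exhausts_def by blast
  then show ?thesis
    by (rule eventually_mono) (auto intro!: part_eq_0)
qed

lemma compact_annulus: "compact {x::real^'n. \<epsilon> \<le> norm x \<and> norm x \<le> r}"
proof -
  have "{x::real^'n. \<epsilon> \<le> norm x \<and> norm x \<le> r} = cball 0 r \<inter> {x. \<epsilon> \<le> norm x}" by auto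
  moreover have "closed {x::real^'n. \<epsilon> \<le> norm x}" by (intro closed_Collect_le continuous_intros)
  ultimately show ?thesis by (simp add: compact_Int_closed)
qed

lemma high_frequency_convergence:
  assumes H: "bounded_away \<epsilon> H" and F: "exhausts F H" and u: "u \<in> tempered" and w: "w \<in> schwartz"
  shows "(\<lambda>k. u (\<lambda>x. of_real (part (F k) x) * w x)) \<longlonglongrightarrow> u (\<lambda>x. of_real (part H x) * w x)"
proof -
  have HJ: "H \<subseteq> J" and e: "\<epsilon> > 0" using H by (auto simp: bounded_away_def)
  obtain N D where D: "0 \<le> D" "\<And>\<psi>. \<psi> \<in> schwartz \<Longrightarrow> norm (u \<psi>) \<le> D * schwartz_seminorm N N \<psi>"
    by (rule temperedE[OF u]) (rule that)
  obtain C where C: "0 \<le> C" "\<And>H x. bounded_away \<epsilon> H \<Longrightarrow> jet N C 1 (\<lambda>x. complex_of_real (part H x)) x"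
    by (rule jet_part_bounded_away[OF e]) (rule that)
  define S where "S = schwartz_seminorm (Suc N) N w"
  have S: "0 \<le> S" unfolding S_def by (rule schwartz_seminorm_nonneg[OF w])
  define R where "R k x = complex_of_real (part (H - F k) x) * w x" for k x
  have away: "bounded_away \<epsilon> (F k)" "bounded_away \<epsilon> (H - F k)" for k
    using F by (auto intro!: bounded_away_subset[OF H] simp: exhausts_def)
  have Rs: "R k \<in> schwartz" for k
    unfolding R_def by (rule schwartz_mult[OF slow_growth_part[OF away(2)] w])
  have split: "part H x = part (F k) x + part (H - F k) x" for k x
  proof -
    have FH: "F k \<subseteq> H" using F by (simp add: exhausts_def)
    then have "F k \<union> (H - F k) = H" by auto
    then show ?thesis using part_Un[of "F k" "H - F k" x] HJ FH by auto
  qed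
  have diff: "u (\<lambda>x. of_real (part (F k) x) * w x) = u (\<lambda>x. of_real (part H x) * w x) - u (R k)" for k
  proof -
    have "(\<lambda>x. of_real (part (F k) x) * w x) = (\<lambda>x. of_real (part H x) * w x - R k x)"
      by (simp add: fun_eq_iff split[of _ k] R_def algebra_simps)
    then show ?thesis
      using tempered_diff[OF u schwartz_mult[OF slow_growth_part[OF H] w] Rs] by simp
  qed
  have bound: "(1 + norm x) ^ N * norm (partials is (R k) x) \<le> 2 ^ N * C * S / (1 + norm x)" if "length is \<le> N" for "is" k x
  proof -
    have "0 < 1 + norm x" by (rule add_pos_nonneg) auto
    then have p: "0 < (1 + norm x) ^ Suc N" "0 < 1 + norm x" by (simp_all only: zero_less_power)
    have "jet N (S / (1 + norm x) ^ Suc N) 1 w x"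
      unfolding jet_def S_def using schwartz_seminorm_ge[OF w, of _ N x "Suc N"] p
      by (simp add: pos_le_divide_eq mult.commute del: power_Suc)
    then have "jet N (2 ^ N * C * (S / (1 + norm x) ^ Suc N)) 1 (R k) x"
      unfolding R_def using C S p w
      by (intro jet_mult[OF open_UNIV UNIV_I] smooth_on_part_bounded_away[OF away(2)] C(2)[OF away(2)]) (auto simp del: power_Suc)
    from jetD[OF this that] have "(1 + norm x) ^ N * norm (partials is (R k) x)
      \<le> (1 + norm x) ^ N * (2 ^ N * C * (S / (1 + norm x) ^ Suc N))"
      by (intro mult_left_mono) auto
    also have "\<dots> = 2 ^ N * C * S / (1 + norm x)" using p(2) by simp
    finally show ?thesis .
  qed
  have "(\<lambda>k. schwartz_seminorm N N (R k)) \<longlonglongrightarrow> 0"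
  proof (rule tendstoI)
    fix \<eta> :: real assume \<eta>: "\<eta> > 0"
    define \<Lambda> where "\<Lambda> = 2 * (2 ^ N * C * S) / \<eta> + \<epsilon>"
    have \<Lambda>: "\<Lambda> > 0" "2 ^ N * C * S / (1 + \<Lambda>) \<le> \<eta> / 2"
    proof -
      have 0: "0 \<le> 2 * (2 ^ N * C * S) / \<eta>" using C(1) S \<eta> by simp
      then show pos: "\<Lambda> > 0" using e unfolding \<Lambda>_def by linarith
      have "2 * (2 ^ N * C * S) / \<eta> \<le> 1 + \<Lambda>" unfolding \<Lambda>_def using e by linarith
      then have "2 * (2 ^ N * C * S) \<le> (1 + \<Lambda>) * \<eta>" using \<eta> by (simp only: pos_divide_le_eq)
      then show "2 ^ N * C * S / (1 + \<Lambda>) \<le> \<eta> / 2" using pos by (simp add: pos_divide_le_eq mult.commute)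
    qed
    have "\<forall>\<^sub>F k in sequentially. \<forall>\<zeta>\<in>{x. \<epsilon> \<le> norm x \<and> norm x \<le> \<Lambda>}. part (H - F k) \<zeta> = 0"
      by (rule exhausts_remainder_vanishes[OF F HJ compact_annulus]) (use e in auto)
    then show "\<forall>\<^sub>F k in sequentially. dist (schwartz_seminorm N N (R k)) 0 < \<eta>"
    proof (rule eventually_mono)
      fix k assume k: "\<forall>\<zeta>\<in>{x. \<epsilon> \<le> norm x \<and> norm x \<le> \<Lambda>}. part (H - F k) \<zeta> = 0"
      have z: "R k x = 0" if "norm x < \<Lambda>" for x
        using k that bounded_away_part_eq_0[OF away(2), of x k] by (cases "norm x < \<epsilon>") (auto simp: R_def)
      have "schwartz_seminorm N N (R k) \<le> \<eta> / 2"
      proof (rule schwartz_seminorm_le)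
        fix "is" :: "'n list" and x assume l: "length is \<le> N"
        show "(1 + norm x) ^ N * norm (partials is (R k) x) \<le> \<eta> / 2"
        proof (cases "norm x < \<Lambda>")
          case True
          have "partials is (R k) x = partials is (\<lambda>x. 0) x"
            by (rule partials_cong_open[OF open_ball[of 0 \<Lambda>]]) (use z True in auto)
          then show ?thesis using \<eta> by (simp add: partials_const)
        next
          case False
          have "2 ^ N * C * S / (1 + norm x) \<le> 2 ^ N * C * S / (1 + \<Lambda>)"
            using False \<Lambda>(1) C(1) S by (intro divide_left_mono mult_pos_pos) auto
          then show ?thesis using bound[OF l, of x k] \<Lambda>(2) by linarith
        qed
      qed
      then show "dist (schwartz_seminorm N N (R k)) 0 < \<eta>"
        using \<eta> schwartz_seminorm_nonneg[OF Rs, of N N k] by simp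
    qed
  qed
  then have "(\<lambda>k. D * schwartz_seminorm N N (R k)) \<longlonglongrightarrow> 0"
    by (rule tendsto_mult_right_zero)
  then have "(\<lambda>k. u (R k)) \<longlonglongrightarrow> 0"
    by (rule Lim_null_comparison[rotated]) (simp add: D(2)[OF Rs])
  then show ?thesis
    unfolding diff using tendsto_diff[OF tendsto_const, of "\<lambda>k. u (R k)" 0 sequentially "u (\<lambda>x. of_real (part H x) * w x)"] by simp
qed

text \<open>A function vanishing to order \<open>m + M m + 1\<close> at the origin compensates for the growth of the
  derivatives of order \<open>m\<close> of the partition of unity there.\<close>

lemma low_frequency_convergence:
  fixes H :: "'j set" and r :: real
  defines "low \<equiv> J - H" and "\<chi>' \<equiv> \<lambda>x. 1 - part H x"
  assumes H: "bounded_away \<epsilon> H" and F: "exhausts F low"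
    and r: "\<And>k \<zeta>. k \<in> low \<Longrightarrow> \<zeta> \<in> patch k \<Longrightarrow> norm \<zeta> \<le> r"
    and v: "v \<in> tempered" "order_at_most v m" and \<psi>: "\<psi> \<in> schwartz"
  shows "(\<lambda>k. v (\<lambda>x. of_real (part (F k) x) * fourier_rem (Suc (m + M * m)) \<psi> x))
    \<longlonglongrightarrow> v (\<lambda>x. of_real (\<chi>' x) * fourier_rem (Suc (m + M * m)) \<psi> x)"
    and "(\<lambda>x. complex_of_real (\<chi>' x)) \<in> schwartz"
proof -
  define q where "q = Suc (m + M * m)"
  define W where "W = fourier_rem q \<psi>"
  have Ws: "smooth_on UNIV W" unfolding W_def by (rule smooth_on_fourier_rem[OF \<psi>])
  have HJ: "H \<subseteq> J" and e: "\<epsilon> > 0" using H by (auto simp: bounded_away_def)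
  have FJ: "F k \<subseteq> low" "F k \<subseteq> J" "finite (F k)" "low - F k \<subseteq> J" for k
    using F by (auto simp: exhausts_def low_def)
  have chi: "\<chi>' x = part low x" if "x \<noteq> 0" for x
    using part_Un[of H low x] part_J[OF that] HJ by (auto simp: low_def \<chi>'_def Un_absorb1)
  have split: "part low x = part (F k) x + part (low - F k) x" for k x
    using part_Un[of "F k" "low - F k" x] FJ[of k] by (simp add: Un_absorb1)
  define r' where "r' = max r 0"
  have chi0: "\<chi>' x = 0" "part (low - F k) x = 0" "part (F k) x = 0" if "norm x > r'" for x k
  proof -
    have "x \<notin> patch j" if "j \<in> low" for j
      using r[OF that, of x] \<open>norm x > r'\<close> by (auto simp: r'_def)
    then have *: "part G x = 0" if "G \<subseteq> low" for G using that by (intro part_eq_0) auto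
    have "x \<noteq> 0" using \<open>norm x > r'\<close> by (auto simp: r'_def)
    then show "\<chi>' x = 0" "part (low - F k) x = 0" "part (F k) x = 0"
      using chi * FJ by auto
  qed
  have chis: "smooth_on UNIV (\<lambda>x. complex_of_real (\<chi>' x))"
  proof -
    have "smooth_on UNIV (\<lambda>x. 1 + - complex_of_real (part H x))"
      by (intro smooth_on_add smooth_on_uminus smooth_on_part_bounded_away[OF H] smooth_on_const open_UNIV)
    then show ?thesis by (simp add: \<chi>'_def)
  qed
  show chi_schwartz: "(\<lambda>x. complex_of_real (\<chi>' x)) \<in> schwartz"
    by (rule schwartz_compact_support[OF chis, of r']) (simp add: chi0)
  define R where "R k x = complex_of_real (\<chi>' x) * W x - complex_of_real (part (F k) x) * W x" for k x
  have Fs: "(\<lambda>x. complex_of_real (part (F k) x)) \<in> schwartz" for k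
    by (rule schwartz_part_finite[OF FJ(3,2)])
  have m1: "(\<lambda>x. complex_of_real (\<chi>' x) * W x) \<in> schwartz"
    by (rule schwartz_compact_support[of _ r']) (auto intro!: smooth_on_mult chis Ws simp: chi0)
  have m2: "(\<lambda>x. complex_of_real (part (F k) x) * W x) \<in> schwartz" for k
    by (rule schwartz_compact_support[of _ r']) (use Fs in \<open>auto intro!: smooth_on_mult Ws simp: chi0\<close>)
  have Rs: "R k \<in> schwartz" for k
    using schwartz_add[OF m1 schwartz_cmult[OF m2, of "- 1" k]] by (simp add: R_def[abs_def])
  have diff: "v (\<lambda>x. of_real (part (F k) x) * W x) = v (\<lambda>x. of_real (\<chi>' x) * W x) - v (R k)" for k
    unfolding R_def tempered_diff[OF v(1) m1 m2] by simp
  have Req: "R k x = complex_of_real (part (low - F k) x) * W x" if "x \<noteq> 0" for k x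
    using chi[OF that] split[of x k] by (simp add: R_def algebra_simps)
  obtain C where C: "0 \<le> C"
    "\<And>F \<zeta>. F \<subseteq> J \<Longrightarrow> \<zeta> \<noteq> 0 \<Longrightarrow> jet m C (B * (1 + (1 / norm \<zeta>) ^ M)) (\<lambda>x. complex_of_real (part F x)) \<zeta>"
    by (rule jet_part_complex) (rule that)
  obtain b where b: "0 \<le> b"
    "\<And>is \<xi>. length is \<le> m \<Longrightarrow> norm (partials is (fourier_rem q \<psi>) \<xi>) \<le> b * norm \<xi> ^ (q - length is)"
    by (rule jet_fourier_rem[OF \<psi>, where m = m and q = q]) (rule that)
  note b = b[folded W_def]
  define K where "K = 2 ^ m * C * b * (2 * B) ^ m"
  have K0: "0 \<le> K" using C b B by (simp add: K_def)
  have near: "norm (partials is (R k) x) \<le> K * norm x" if l: "length is \<le> m" and x: "norm x \<le> 1" for "is" k x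
  proof (cases "x = 0")
    case True
    obtain d where d: "d > 0" "\<And>\<zeta>. norm \<zeta> < d \<Longrightarrow> part (F k) \<zeta> = 0"
      by (rule part_vanishes_near_0[OF FJ(3,2)]) (rule that)
    have "partials is (R k) 0 = partials is W 0"
      by (rule partials_cong_open[OF open_ball[of 0 "min d \<epsilon>"]])
        (use d e bounded_away_part_eq_0[OF H] in \<open>auto simp: R_def \<chi>'_def\<close>)
    moreover have "norm (partials is W 0) \<le> b * norm (0 :: real^'n) ^ (q - length is)" by (rule b(2)[OF l])
    moreover have "q - length is \<noteq> 0" using l by (simp add: q_def)
    ultimately show ?thesis using True by (simp add: power_0_left)
  next
    case False
    define t where "t = norm x"
    have t: "0 < t" "t \<le> 1" using False x by (auto simp: t_def)
    define L where "L = B * (1 + (1 / t) ^ M)"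
    have L1: "1 \<le> L" unfolding L_def using B t mult_mono[of 1 B 1 "1 + (1 / t) ^ M"] by simp
    have "(1::real) \<le> (1 / t) ^ M" using t by (intro one_le_power) simp
    then have "L \<le> B * (2 * (1 / t) ^ M)" unfolding L_def using B by (intro mult_left_mono) auto
    then have L2: "L \<le> 2 * B * (1 / t) ^ M" by simp
    have "jet m (b * t ^ (q - m)) L W x"
      unfolding jet_def
    proof (intro allI impI)
      fix js :: "'n list" assume js: "length js \<le> m"
      have "norm (partials js W x) \<le> b * t ^ (q - length js)" using b(2)[OF js, of x] by (simp add: t_def)
      also have "\<dots> \<le> b * t ^ (q - m)" using t b js by (intro mult_left_mono power_decreasing) auto
      also have "\<dots> \<le> b * t ^ (q - m) * L ^ length js"
        using mult_left_mono[OF one_le_power[OF L1, of "length js"], of "b * t ^ (q - m)"] b(1) t by simp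
      finally show "norm (partials js W x) \<le> b * t ^ (q - m) * L ^ length js" .
    qed
    moreover have "jet m C L (\<lambda>x. complex_of_real (part (low - F k) x)) x"
      using C(2)[OF FJ(4) False] by (simp add: L_def t_def)
    ultimately have "jet m (2 ^ m * C * (b * t ^ (q - m))) L (\<lambda>x. complex_of_real (part (low - F k) x) * W x) x"
      using False L1 C(1) b(1) t FJ(4)
      by (intro jet_mult[OF open_punctured] smooth_on_part_complex smooth_on_mono[OF Ws]) auto
    then have "jet m (2 ^ m * C * (b * t ^ (q - m))) L (R k) x"
      by (subst jet_cong_open[OF open_punctured, of _ "\<lambda>x. complex_of_real (part (low - F k) x) * W x"])
        (use False Req in auto)
    from jetD[OF this l] have "norm (partials is (R k) x) \<le> 2 ^ m * C * (b * t ^ (q - m)) * L ^ length is" .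
    also have "\<dots> \<le> 2 ^ m * C * (b * t ^ (q - m)) * L ^ m"
      using C(1) b(1) t L1 l by (intro mult_left_mono power_increasing) auto
    also have "\<dots> \<le> 2 ^ m * C * (b * t ^ (q - m)) * (2 * B * (1 / t) ^ M) ^ m"
      using C(1) b(1) t L1 L2 by (intro mult_left_mono power_mono) auto
    also have "\<dots> = K * (t ^ (q - m) * ((1 / t) ^ M) ^ m)"
      by (simp add: K_def power_mult_distrib mult_ac)
    also have "t ^ (q - m) * ((1 / t) ^ M) ^ m = t"
    proof -
      have "t ^ (q - m) = t * t ^ (M * m)" by (simp add: q_def)
      moreover have "((1 / t) ^ M) ^ m = 1 / t ^ (M * m)" by (simp add: power_mult[symmetric] power_divide)
      ultimately show ?thesis using t by simp
    qed
    finally show ?thesis by (simp add: t_def)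
  qed
  obtain D where D: "\<And>\<theta>. smooth \<theta> \<and> supp \<theta> \<subseteq> cball 0 r' \<Longrightarrow> norm (v \<theta>) \<le> D * schwartz_seminorm 0 m \<theta>"
    using v(2)[unfolded order_at_most_def, rule_format, OF compact_cball[of 0 r']] by blast
  have supR: "smooth (R k) \<and> supp (R k) \<subseteq> cball 0 r'" for k
  proof
    show "smooth (R k)" using Rs by (auto simp: smooth_iff_smooth_on)
    have "R k x = 0" if "norm x > r'" for x using that chi0 by (simp add: R_def)
    then have "{x. R k x \<noteq> 0} \<subseteq> cball 0 r'" by (force simp: not_less)
    then show "supp (R k) \<subseteq> cball 0 r'" unfolding supp_def by (rule closure_minimal) simp
  qed
  have "(\<lambda>k. schwartz_seminorm 0 m (R k)) \<longlonglongrightarrow> 0"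
  proof (rule tendstoI)
    fix \<eta> :: real assume \<eta>: "\<eta> > 0"
    define \<delta> where "\<delta> = min 1 (\<eta> / (2 * (K + 1)))"
    have \<delta>: "0 < \<delta>" "\<delta> \<le> 1" using \<eta> K0 by (auto simp: \<delta>_def)
    have "K * \<delta> \<le> (K + 1) * (\<eta> / (2 * (K + 1)))"
      using K0 \<delta> by (intro mult_mono) (auto simp: \<delta>_def)
    also have "\<dots> = \<eta> / 2" using K0 by (simp add: field_simps)
    finally have K\<delta>: "K * \<delta> \<le> \<eta> / 2" .
    have "\<forall>\<^sub>F k in sequentially. \<forall>\<zeta>\<in>{x. \<delta> \<le> norm x \<and> norm x \<le> r'}. part (low - F k) \<zeta> = 0"
      by (rule exhausts_remainder_vanishes[OF F _ compact_annulus]) (use \<delta> in \<open>auto simp: low_def\<close>)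
    then show "\<forall>\<^sub>F k in sequentially. dist (schwartz_seminorm 0 m (R k)) 0 < \<eta>"
    proof (rule eventually_mono)
      fix k assume k: "\<forall>\<zeta>\<in>{x. \<delta> \<le> norm x \<and> norm x \<le> r'}. part (low - F k) \<zeta> = 0"
      have z: "R k x = 0" if "norm x > \<delta>" for x
      proof -
        have "x \<noteq> 0" using that \<delta> by auto
        then show ?thesis using k that chi0(2)[of x k] by (cases "norm x \<le> r'") (auto simp: Req)
      qed
      have "schwartz_seminorm 0 m (R k) \<le> \<eta> / 2"
      proof (rule schwartz_seminorm_le)
        fix "is" :: "'n list" and x assume l: "length is \<le> m"
        have "norm (partials is (R k) x) \<le> \<eta> / 2"
        proof (cases "norm x \<le> \<delta>")
          case True
          have "norm (partials is (R k) x) \<le> K * norm x" using near[OF l] True \<delta> by simp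
          also have "\<dots> \<le> K * \<delta>" using True K0 by (intro mult_left_mono)
          finally show ?thesis using K\<delta> by simp
        next
          case False
          have "open {x::real^'n. norm x > \<delta>}" by (intro open_Collect_less continuous_intros)
          then have "partials is (R k) x = partials is (\<lambda>x. 0) x"
            by (rule partials_cong_open) (use z False in auto)
          then show ?thesis using \<eta> by (simp add: partials_const)
        qed
        then show "(1 + norm x) ^ 0 * norm (partials is (R k) x) \<le> \<eta> / 2" by simp
      qed
      then show "dist (schwartz_seminorm 0 m (R k)) 0 < \<eta>"
        using \<eta> schwartz_seminorm_nonneg[OF Rs, of 0 m k] by simp
    qed
  qed
  then have "(\<lambda>k. D * schwartz_seminorm 0 m (R k)) \<longlonglongrightarrow> 0"
    by (rule tendsto_mult_right_zero)
  then have "(\<lambda>k. v (R k)) \<longlonglongrightarrow> 0"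
    by (rule Lim_null_comparison[rotated]) (simp add: D[OF supR])
  then have "(\<lambda>k. v (\<lambda>x. of_real (part (F k) x) * W x)) \<longlonglongrightarrow> v (\<lambda>x. of_real (\<chi>' x) * W x)"
    unfolding diff using tendsto_diff[OF tendsto_const, of "\<lambda>k. v (R k)" 0 sequentially "v (\<lambda>x. of_real (\<chi>' x) * W x)"] by simp
  then show "(\<lambda>k. v (\<lambda>x. of_real (part (F k) x) * fourier_rem (Suc (m + M * m)) \<psi> x))
    \<longlonglongrightarrow> v (\<lambda>x. of_real (\<chi>' x) * fourier_rem (Suc (m + M * m)) \<psi> x)"
    by (simp only: W_def q_def)
qed

end

lemma exhausts_image_int:
  fixes e :: "int \<Rightarrow> 'j" and I :: "nat \<Rightarrow> int set"
  assumes bij: "bij_betw e X H" and I: "\<And>k. finite (I k)" "\<And>k. I k \<subseteq> X"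
    and ev: "\<And>n. n \<in> X \<Longrightarrow> \<forall>\<^sub>F k in sequentially. n \<in> I k"
    and E: "finite E" "E \<subseteq> H"
  shows "\<forall>\<^sub>F k in sequentially. E \<subseteq> e ` I k"
proof -
  have "\<forall>\<^sub>F k in sequentially. x \<in> e ` I k" if "x \<in> E" for x
  proof -
    obtain n where n: "n \<in> X" "x = e n" using bij E(2) \<open>x \<in> E\<close> by (auto simp: bij_betw_def)
    show ?thesis by (rule eventually_mono[OF ev[OF n(1)]]) (simp add: n(2))
  qed
  then have "\<forall>\<^sub>F k in sequentially. \<forall>x\<in>E. x \<in> e ` I k"
    using E(1) by (simp add: eventually_ball_finite)
  then show ?thesis by (simp add: subset_eq)
qed

context tame_bump_covering
begin

lemma dist_sum_multipliers:
  assumes f: "f \<in> tempered" and I: "finite I" "inj_on e I" "e ` I \<subseteq> J"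
  shows "dist_sum (\<lambda>n. fourier_multiplier (\<lambda>x. (sqrt_system J A b \<Phi> (e n) x)\<^sup>2) f) I
    = fourier_multiplier (part (e ` I)) f"
proof -
  define v where "v = dist_fourier f"
  have v: "v \<in> tempered" unfolding v_def by (rule dist_fourier_tempered[OF f])
  have sg: "slow_growth (\<lambda>x. complex_of_real (part F x))" if "finite F" "F \<subseteq> J" for F
    by (rule slow_growth_schwartz[OF schwartz_part_finite[OF that]])
  have sq: "(\<lambda>x. (sqrt_system J A b \<Phi> (e n) x)\<^sup>2) = part {e n}" if "n \<in> I" for n
    using sqrt_system_power2[of "e n"] I(3) that by (auto simp: fun_eq_iff)
  have sgn: "slow_growth (\<lambda>x. complex_of_real (part {e n} x))" if "n \<in> I" for n
    by (rule sg) (use that I(3) in auto)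
  let ?S = "dist_sum (\<lambda>n. fourier_multiplier (\<lambda>x. (sqrt_system J A b \<Phi> (e n) x)\<^sup>2) f) I"
  have "?S \<psi> = fourier_multiplier (part (e ` I)) f \<psi>" if \<psi>: "\<psi> \<in> schwartz" for \<psi>
  proof -
    note w = inv_fourier_schwartz[OF \<psi>]
    have "?S \<psi> = (\<Sum>n\<in>I. v (\<lambda>x. of_real (part {e n} x) * inv_fourier \<psi> x))"
      using \<psi> by (simp add: dist_sum_def sq fourier_multiplier_apply[OF sgn \<psi>] v_def)
    also have "\<dots> = v (\<lambda>x. \<Sum>n\<in>I. of_real (part {e n} x) * inv_fourier \<psi> x)"
      by (rule tempered_sum[OF v, symmetric]) (rule schwartz_mult[OF sgn w])
    also have "(\<lambda>x. \<Sum>n\<in>I. of_real (part {e n} x) * inv_fourier \<psi> x) = (\<lambda>x. of_real (part (e ` I) x) * inv_fourier \<psi> x)"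
      using part_finite_sum[of "e ` I"] I by (simp add: sum.reindex sum_distrib_right)
    also have "v \<dots> = fourier_multiplier (part (e ` I)) f \<psi>"
      unfolding v_def by (rule fourier_multiplier_apply[OF sg \<psi>, symmetric]) (use I in auto)
    finally show ?thesis .
  qed
  moreover have "fourier_multiplier (part (e ` I)) f \<in> extensional schwartz"
    by (rule temperedD(1)[OF fourier_multiplier_tempered[OF sg f]]) (use I in auto)
  moreover have "?S \<in> extensional schwartz"
    unfolding dist_sum_def by (rule restrict_extensional)
  ultimately show ?thesis
    by (intro extensionalityI[of ?S schwartz "fourier_multiplier (part (e ` I)) f"])
qed

theorem decomposition:
  fixes e :: "int \<Rightarrow> 'j"
  assumes H: "bounded_away \<epsilon> H"
    and r: "\<And>k \<zeta>. k \<in> J - H \<Longrightarrow> \<zeta> \<in> patch k \<Longrightarrow> norm \<zeta> \<le> r"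
    and e: "bij_betw e {..<0} (J - H)" "bij_betw e {0..} H" and f: "f \<in> tempered"
  defines "S \<equiv> dist_sum (\<lambda>n. fourier_multiplier (\<lambda>x. (sqrt_system J A b \<Phi> (e n) x)\<^sup>2) f)"
    and "m \<equiv> dist_order (dist_fourier f)"
  shows "(\<exists>u\<^sub>1 \<in> tempered. \<exists>u\<^sub>2 \<in> tempered.
       limitin tempered_mod_poly_topology (\<lambda>k. mod_poly (S {- int k..< 0})) (mod_poly u\<^sub>1) sequentially \<and>
       limitin tempered_mod_poly_topology (\<lambda>K. mod_poly (S {0..int K})) (mod_poly u\<^sub>2) sequentially \<and>
       mod_poly f = mod_poly (u\<^sub>1 \<oplus>\<^sub>D u\<^sub>2)) \<and>
    (\<exists>(P\<^sub>k :: nat \<Rightarrow> real^'n \<Rightarrow> complex) (P :: real^'n \<Rightarrow> complex). \<exists>g \<in> tempered.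
       (\<forall>k\<ge>1. poly_degree_le (m + M * m) (P\<^sub>k k)) \<and>
       polynomial_function P \<and>
       limitin tempered_topology
         (\<lambda>(k, K). S {- int k..int K} \<oplus>\<^sub>D dist_of_fun (P\<^sub>k k)) g (sequentially \<times>\<^sub>F sequentially) \<and>
       f = g \<oplus>\<^sub>D dist_of_fun P)"
proof -
  define v where "v = dist_fourier f"
  define q where "q = Suc (m + M * m)"
  have v: "v \<in> tempered" unfolding v_def by (rule dist_fourier_tempered[OF f])
  have vm: "order_at_most v m" unfolding m_def v_def[symmetric] by (rule order_at_most_dist_order[OF v])
  have HJ: "H \<subseteq> J" using H by (simp add: bounded_away_def)
  define F where "F k = e ` {- int k..<0}" for k
  define G where "G K = e ` {0..int K}" for K
  have ev1: "\<forall>\<^sub>F k in sequentially. - int k \<le> n" for n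
    by (rule eventually_sequentiallyI[of "nat (- n)"]) simp
  have ev2: "\<forall>\<^sub>F k in sequentially. n \<le> int k" for n
    by (rule eventually_sequentiallyI[of "nat n"]) simp
  have FL: "exhausts F (J - H)"
    unfolding exhausts_def
  proof (intro conjI allI impI)
    fix E assume "finite E \<and> E \<subseteq> J - H"
    then show "\<forall>\<^sub>F k in sequentially. E \<subseteq> F k"
      unfolding F_def
      by (intro exhausts_image_int[OF e(1)]) (auto intro: ev1)
  qed (use e(1) in \<open>auto simp: F_def bij_betw_def\<close>)
  have GH: "exhausts G H"
    unfolding exhausts_def
  proof (intro conjI allI impI)
    fix E assume "finite E \<and> E \<subseteq> H"
    then show "\<forall>\<^sub>F k in sequentially. E \<subseteq> G k"
      unfolding G_def
      by (intro exhausts_image_int[OF e(2)]) (auto intro: ev2)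
  qed (use e(2) in \<open>auto simp: G_def bij_betw_def\<close>)
  have eJ: "inj_on e UNIV" "range e \<subseteq> J"
  proof -
    have "bij_betw e ({..<0} \<union> {0..}) ((J - H) \<union> H)"
      by (rule bij_betw_combine[OF e]) auto
    moreover have "{..<0} \<union> {0..} = (UNIV :: int set)" by auto
    ultimately show "inj_on e UNIV" "range e \<subseteq> J" using HJ by (auto simp: bij_betw_def)
  qed
  have SI: "S I = fourier_multiplier (part (e ` I)) f" if "finite I" for I
    unfolding S_def
    by (rule dist_sum_multipliers[OF f that]) (use eJ in \<open>auto intro: inj_on_subset\<close>)
  have sfin: "(\<lambda>x. complex_of_real (part (e ` I) x)) \<in> schwartz" if "finite I" for I
    by (rule schwartz_part_finite) (use that eJ in auto)
  have St: "S I \<in> tempered" if "finite I" for I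
    unfolding SI[OF that] by (rule fourier_multiplier_tempered[OF slow_growth_schwartz[OF sfin[OF that]] f])
  define \<chi>' where "\<chi>' x = 1 - part H x" for x
  define T where "T g = taylor_poly q v g" for g
  have Tt: "dist_of_fun (T g) \<in> tempered" for g
    unfolding T_def by (intro dist_of_fun_tempered moderate_growth_polynomial polynomial_function_taylor_poly)
  define u\<^sub>1 where "u\<^sub>1 = fourier_multiplier \<chi>' f \<oplus>\<^sub>D dist_of_fun (T \<chi>')"
  define u\<^sub>2 where "u\<^sub>2 = fourier_multiplier (part H) f"
  define P\<^sub>k where "P\<^sub>k k = T (part (F k))" for k
  have chis: "(\<lambda>x. complex_of_real (\<chi>' x)) \<in> schwartz"
  proof -
    have "(\<lambda>x. 0 :: complex) \<in> schwartz" by (auto simp: schwartz_iff partials_const)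
    from low_frequency_convergence(2)[OF H FL r v vm this]
    show ?thesis by (simp add: \<chi>'_def)
  qed
  have sgH: "slow_growth (\<lambda>x. complex_of_real (part H x))" by (rule slow_growth_part[OF H])
  have u1: "u\<^sub>1 \<in> tempered"
    unfolding u\<^sub>1_def by (intro dist_add_tempered fourier_multiplier_tempered slow_growth_schwartz chis f Tt)
  have u2: "u\<^sub>2 \<in> tempered"
    unfolding u\<^sub>2_def by (rule fourier_multiplier_tempered[OF sgH f])
  have g: "u\<^sub>1 \<oplus>\<^sub>D u\<^sub>2 \<in> tempered" by (rule dist_add_tempered[OF u1 u2])
  have low: "(\<lambda>k. (S {- int k..<0} \<oplus>\<^sub>D dist_of_fun (P\<^sub>k k)) \<psi>) \<longlonglongrightarrow> u\<^sub>1 \<psi>" if \<psi>: "\<psi> \<in> schwartz" for \<psi>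
  proof -
    have "(S {- int k..<0} \<oplus>\<^sub>D dist_of_fun (P\<^sub>k k)) \<psi> = v (\<lambda>x. of_real (part (F k) x) * fourier_rem q \<psi> x)" for k
      unfolding P\<^sub>k_def T_def SI[OF finite_atLeastLessThan_int] F_def v_def
      by (rule corrected_multiplier[OF sfin[OF finite_atLeastLessThan_int] f \<psi>])
    moreover have "u\<^sub>1 \<psi> = v (\<lambda>x. of_real (\<chi>' x) * fourier_rem q \<psi> x)"
      unfolding u\<^sub>1_def T_def v_def by (rule corrected_multiplier[OF chis f \<psi>])
    ultimately show ?thesis
      using low_frequency_convergence(1)[OF H FL r v vm \<psi>] by (simp only: q_def \<chi>'_def[abs_def])
  qed
  have high: "(\<lambda>K. S {0..int K} \<psi>) \<longlonglongrightarrow> u\<^sub>2 \<psi>" if \<psi>: "\<psi> \<in> schwartz" for \<psi>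
  proof -
    have "S {0..int K} \<psi> = v (\<lambda>x. of_real (part (G K) x) * inv_fourier \<psi> x)" for K
      unfolding SI[OF finite_atLeastAtMost_int] G_def v_def
      by (rule fourier_multiplier_apply[OF slow_growth_schwartz[OF sfin[OF finite_atLeastAtMost_int]] \<psi>])
    moreover have "u\<^sub>2 \<psi> = v (\<lambda>x. of_real (part H x) * inv_fourier \<psi> x)"
      unfolding u\<^sub>2_def v_def by (rule fourier_multiplier_apply[OF sgH \<psi>])
    ultimately show ?thesis
      using high_frequency_convergence[OF H GH v inv_fourier_schwartz[OF \<psi>]] by simp
  qed
  have lim1: "limitin tempered_topology (\<lambda>k. S {- int k..<0} \<oplus>\<^sub>D dist_of_fun (P\<^sub>k k)) u\<^sub>1 sequentially"
    using low by (subst limitin_tempered_topology[OF u1]) (auto intro!: dist_add_tempered St simp: P\<^sub>k_def Tt)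
  have lim2: "limitin tempered_topology (\<lambda>K. S {0..int K}) u\<^sub>2 sequentially"
    using high by (subst limitin_tempered_topology[OF u2]) (auto intro!: St)
  have Pp: "polynomial_function (T g)" for g
    unfolding T_def by (rule polynomial_function_taylor_poly)
  define P where "P x = - T \<chi>' x" for x
  have PP: "polynomial_function P"
    unfolding P_def by (rule polynomial_function_minus[OF Pp])
  have fg: "f = u\<^sub>1 \<oplus>\<^sub>D u\<^sub>2 \<oplus>\<^sub>D dist_of_fun P"
  proof (rule extensionalityI[of _ schwartz])
    fix \<psi> :: "real^'n \<Rightarrow> complex" assume \<psi>: "\<psi> \<in> schwartz"
    note w = inv_fourier_schwartz[OF \<psi>]
    have "dist_of_fun (\<lambda>x. T \<chi>' x + P x) \<psi> = dist_of_fun (T \<chi>') \<psi> + dist_of_fun P \<psi>"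
      by (intro dist_of_fun_add moderate_growth_polynomial Pp PP \<psi>)
    then have z: "dist_of_fun (T \<chi>') \<psi> + dist_of_fun P \<psi> = 0"
      using \<psi> by (simp add: P_def dist_of_fun_def)
    have "f \<psi> = v (inv_fourier \<psi>)"
      unfolding v_def by (rule dist_fourier_inv_fourier[OF \<psi>, symmetric])
    also have "inv_fourier \<psi> = (\<lambda>x. of_real (\<chi>' x) * inv_fourier \<psi> x + of_real (part H x) * inv_fourier \<psi> x)"
      by (simp add: \<chi>'_def fun_eq_iff algebra_simps)
    also have "v \<dots> = v (\<lambda>x. of_real (\<chi>' x) * inv_fourier \<psi> x) + v (\<lambda>x. of_real (part H x) * inv_fourier \<psi> x)"
      by (intro temperedD(2)[OF v] schwartz_mult slow_growth_schwartz[OF chis] sgH w)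
    also have "\<dots> = fourier_multiplier \<chi>' f \<psi> + fourier_multiplier (part H) f \<psi>"
      unfolding v_def by (simp only: fourier_multiplier_apply[OF slow_growth_schwartz[OF chis] \<psi>] fourier_multiplier_apply[OF sgH \<psi>])
    also have "\<dots> = (u\<^sub>1 \<oplus>\<^sub>D u\<^sub>2 \<oplus>\<^sub>D dist_of_fun P) \<psi>"
      using \<psi> z by (simp add: u\<^sub>1_def u\<^sub>2_def dist_add_def algebra_simps)
    finally show "f \<psi> = (u\<^sub>1 \<oplus>\<^sub>D u\<^sub>2 \<oplus>\<^sub>D dist_of_fun P) \<psi>" .
  qed (use temperedD(1)[OF f] in \<open>auto simp: dist_add_def restrict_extensional\<close>)
  have lim: "limitin tempered_topology
      (\<lambda>(k, K). S {- int k..int K} \<oplus>\<^sub>D dist_of_fun (P\<^sub>k k)) (u\<^sub>1 \<oplus>\<^sub>D u\<^sub>2) (sequentially \<times>\<^sub>F sequentially)"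
  proof (subst limitin_tempered_topology[OF g])
    show "(case n of (k, K) \<Rightarrow> S {- int k..int K} \<oplus>\<^sub>D dist_of_fun (P\<^sub>k k)) \<in> tempered" for n
      by (cases n) (auto intro!: dist_add_tempered St simp: P\<^sub>k_def Tt)
    show "\<forall>\<psi>\<in>schwartz. ((\<lambda>n. (case n of (k, K) \<Rightarrow> S {- int k..int K} \<oplus>\<^sub>D dist_of_fun (P\<^sub>k k)) \<psi>)
        \<longlongrightarrow> (u\<^sub>1 \<oplus>\<^sub>D u\<^sub>2) \<psi>) (sequentially \<times>\<^sub>F sequentially)"
    proof
      fix \<psi> :: "real^'n \<Rightarrow> complex" assume \<psi>: "\<psi> \<in> schwartz"
      have "{- int k..int K} = {- int k..<0} \<union> {0..int K}" for k K by auto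
      then have s: "S {- int k..int K} \<psi> = S {- int k..<0} \<psi> + S {0..int K} \<psi>" for k K
        using \<psi> by (simp add: S_def dist_sum_def sum.union_disjoint disjoint_iff)
      have "((\<lambda>n. (S {- int (fst n)..<0} \<oplus>\<^sub>D dist_of_fun (P\<^sub>k (fst n))) \<psi> + S {0..int (snd n)} \<psi>)
          \<longlongrightarrow> u\<^sub>1 \<psi> + u\<^sub>2 \<psi>) (sequentially \<times>\<^sub>F sequentially)"
        by (intro tendsto_add filterlim_compose[OF low[OF \<psi>] filterlim_fst] filterlim_compose[OF high[OF \<psi>] filterlim_snd])
      then show "((\<lambda>n. (case n of (k, K) \<Rightarrow> S {- int k..int K} \<oplus>\<^sub>D dist_of_fun (P\<^sub>k k)) \<psi>)
        \<longlongrightarrow> (u\<^sub>1 \<oplus>\<^sub>D u\<^sub>2) \<psi>) (sequentially \<times>\<^sub>F sequentially)"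
        using \<psi> by (simp add: dist_add_def case_prod_beta s algebra_simps)
    qed
  qed
  have deg: "poly_degree_le (m + M * m) (P\<^sub>k k)" for k
    unfolding P\<^sub>k_def T_def q_def by (rule poly_degree_le_taylor_poly)
  have "mod_poly (S {- int k..<0} \<oplus>\<^sub>D dist_of_fun (P\<^sub>k k)) = mod_poly (S {- int k..<0})" for k
    unfolding P\<^sub>k_def by (rule mod_poly_add_polynomial[OF Pp])
  then have "limitin tempered_mod_poly_topology (\<lambda>k. mod_poly (S {- int k..<0})) (mod_poly u\<^sub>1) sequentially"
    using limitin_tempered_mod_poly[OF lim1] by simp
  moreover have "mod_poly f = mod_poly (u\<^sub>1 \<oplus>\<^sub>D u\<^sub>2)"
    using mod_poly_add_polynomial[OF PP, of "u\<^sub>1 \<oplus>\<^sub>D u\<^sub>2"] fg by simp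
  ultimately show ?thesis
    using u1 u2 g PP fg lim deg limitin_tempered_mod_poly[OF lim2] by blast
qed

end

theorem lemma5p1:
  fixes a :: "real^'n::finite" and \<kappa> :: real
    and \<rho> h\<^sub>1 h\<^sub>2 h :: "real^'n \<Rightarrow> real" and \<delta>\<^sub>0 \<delta>\<^sub>1 \<delta>\<^sub>2 c\<^sub>1 \<delta> :: real
    and J :: "'j set" and \<xi> b :: "'j \<Rightarrow> real^'n" and A :: "'j \<Rightarrow> real^'n^'n"
    and P Q :: "(real^'n) set" and \<Phi> :: "real^'n \<Rightarrow> real" and \<phi> :: "'j \<Rightarrow> real^'n \<Rightarrow> real"
  assumes a_pos: "\<And>i. a $ i > 0" and a_sum: "(\<Sum>i\<in>UNIV. a $ i) = real CARD('n)"
    and \<kappa>: "\<kappa> \<ge> 1" "\<And>x y. anorm a (x + y) \<le> \<kappa> * (anorm a x + anorm a y)"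
    and hybrid: "hybrid_regulation a \<rho> h\<^sub>1 h\<^sub>2 \<delta>\<^sub>1 \<delta>\<^sub>2 c\<^sub>1 h"
    and h_moderate: "moderate a \<delta>\<^sub>0 h" and \<delta>: "0 < \<delta>" "\<delta> < \<delta>\<^sub>0"
    and covering: "structured_covering J A b P Q"
    and centres: "\<And>j. j \<in> J \<Longrightarrow> \<xi> j \<noteq> 0"
    and A: "\<And>j. j \<in> J \<Longrightarrow> A j = dilation a (\<delta> * h (\<xi> j))"
    and balls: "\<And>j. j \<in> J \<Longrightarrow> affine_map (A j) (b j) ` Q = aball a (\<xi> j) (\<delta> * h (\<xi> j))"
    and \<Phi>: "smooth \<Phi>" "\<And>x. \<Phi> x \<ge> 0" "\<And>x. x \<in> P \<Longrightarrow> \<Phi> x = 1" "supp \<Phi> \<subseteq> Q"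
    and \<phi>: "\<phi> = sqrt_system J A b \<Phi>"
  shows "\<exists>p :: nat \<Rightarrow> nat. \<forall>\<delta>\<^sub>s C J\<^sub>1 J\<^sub>2 (e :: int \<Rightarrow> 'j).
    0 < \<delta>\<^sub>s \<and> \<delta>\<^sub>s \<le> min \<delta>\<^sub>1 \<delta>\<^sub>2 \<and> \<delta>\<^sub>s * c\<^sub>1 < 1 \<and>
    0 < C \<and> C < (2/3) / (\<kappa> * (1 + c\<^sub>1 * \<delta>\<^sub>s)) \<and>
    J\<^sub>1 = low_indices a J (\<lambda>j. aball a (\<xi> j) (\<delta> * h (\<xi> j))) C \<and> J\<^sub>2 = J - J\<^sub>1 \<and>
    bij_betw e {..<0} J\<^sub>1 \<and> bij_betw e {0..} J\<^sub>2 \<longrightarrow>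
    (\<forall>f \<in> tempered.
      let S = dist_sum (\<lambda>n. fourier_multiplier (\<lambda>x. (\<phi> (e n) x)\<^sup>2) f) in
      (\<exists>u\<^sub>1 \<in> tempered. \<exists>u\<^sub>2 \<in> tempered.
         limitin tempered_mod_poly_topology (\<lambda>k. mod_poly (S {- int k..< 0})) (mod_poly u\<^sub>1) sequentially \<and>
         limitin tempered_mod_poly_topology (\<lambda>K. mod_poly (S {0..int K})) (mod_poly u\<^sub>2) sequentially \<and>
         mod_poly f = mod_poly (u\<^sub>1 \<oplus>\<^sub>D u\<^sub>2)) \<and>
      (\<exists>(P\<^sub>k :: nat \<Rightarrow> real^'n \<Rightarrow> complex) (P :: real^'n \<Rightarrow> complex). \<exists>g \<in> tempered.
         (\<forall>k\<ge>1. poly_degree_le (p (dist_order (dist_fourier f))) (P\<^sub>k k)) \<and>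
         polynomial_function P \<and>
         limitin tempered_topology
           (\<lambda>(k, K). S {- int k..int K} \<oplus>\<^sub>D dist_of_fun (P\<^sub>k k)) g (sequentially \<times>\<^sub>F sequentially) \<and>
         f = g \<oplus>\<^sub>D dist_of_fun P))"
proof -
  define amin amax where "amin = Min (range (($) a))" and "amax = Max (range (($) a))"
  interpret anisotropy a amin amax
  proof
    have "amin \<in> range (($) a)" unfolding amin_def by (intro Min_in) auto
    then show "amin > 0" using a_pos by auto
  qed (auto simp: amin_def amax_def intro: Min_le Max_ge)
  have h_pos: "h \<zeta> > 0" if "\<zeta> \<noteq> 0" for \<zeta> using h_moderate that by (simp add: moderate_def)
  interpret bump_covering a J "\<lambda>j. \<delta> * h (\<xi> j)" A b P Q \<Phi>
    using \<delta>(1) h_pos centres A covering \<Phi> by unfold_locales auto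
  have patch: "patch j = aball a (\<xi> j) (\<delta> * h (\<xi> j))" if "j \<in> J" for j
    unfolding patch_def by (rule balls[OF that])
  obtain B M where B: "0 < B" "\<And>\<xi> \<zeta> i. \<xi> \<noteq> 0 \<Longrightarrow> \<zeta> \<noteq> 0 \<Longrightarrow> adist a \<xi> \<zeta> < \<delta> * h \<xi> \<Longrightarrow>
      (\<delta> * h \<xi>) powr (- (a $ i)) \<le> B * (1 + (1 / norm \<zeta>) ^ M)"
    by (rule dilation_parameter_bound[OF hybrid h_moderate \<delta>]) (rule that)
  interpret tame_bump_covering a J "\<lambda>j. \<delta> * h (\<xi> j)" A b P Q \<Phi> "max 1 B" M
  proof
    fix \<zeta> :: "real^'n" assume \<zeta>: "\<zeta> \<noteq> 0"
    have "B * (1 + (1 / norm \<zeta>) ^ M) \<le> max 1 B * (1 + (1 / norm \<zeta>) ^ M)"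
      by (intro mult_right_mono) auto
    then show "steepness (max 1 B * (1 + (1 / norm \<zeta>) ^ M)) \<zeta>"
      unfolding steepness_def using B(2)[OF centres \<zeta>]
      by (auto simp: patch aball_def intro: order_trans)
  qed simp
  show ?thesis
  proof (intro exI[of _ "\<lambda>m. m + M * m"] allI impI ballI)
    fix \<delta>\<^sub>s C J\<^sub>1 J\<^sub>2 and e :: "int \<Rightarrow> 'j" and f :: "(real^'n \<Rightarrow> complex) \<Rightarrow> complex"
    assume *: "0 < \<delta>\<^sub>s \<and> \<delta>\<^sub>s \<le> min \<delta>\<^sub>1 \<delta>\<^sub>2 \<and> \<delta>\<^sub>s * c\<^sub>1 < 1 \<and>
      0 < C \<and> C < (2/3) / (\<kappa> * (1 + c\<^sub>1 * \<delta>\<^sub>s)) \<and>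
      J\<^sub>1 = low_indices a J (\<lambda>j. aball a (\<xi> j) (\<delta> * h (\<xi> j))) C \<and> J\<^sub>2 = J - J\<^sub>1 \<and>
      bij_betw e {..<0} J\<^sub>1 \<and> bij_betw e {0..} J\<^sub>2"
      and f: "f \<in> tempered"
    have C: "0 < C" and J1: "J\<^sub>1 = low_indices a J (\<lambda>j. aball a (\<xi> j) (\<delta> * h (\<xi> j))) C"
      and J2: "J\<^sub>2 = J - J\<^sub>1" and e: "bij_betw e {..<0} J\<^sub>1" "bij_betw e {0..} J\<^sub>2"
      using * by auto
    have J12: "J - J\<^sub>2 = J\<^sub>1" using J1 J2 by (auto simp: low_indices_def)
    have away: "bounded_away ((min 1 C) powr amax) J\<^sub>2"
      unfolding bounded_away_def
    proof (intro conjI ballI)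
      fix k \<zeta> assume k: "k \<in> J\<^sub>2" and \<zeta>: "\<zeta> \<in> patch k"
      show "(min 1 C) powr amax \<le> norm \<zeta>"
      proof (rule ccontr)
        assume "\<not> (min 1 C) powr amax \<le> norm \<zeta>"
        then have "anorm a \<zeta> < C" using C by (intro anorm_less) auto
        then have "\<zeta> \<in> aball a 0 C" by (simp add: aball_def adist_def)
        then show False using k \<zeta> patch[of k] by (auto simp: J1 J2 low_indices_def)
      qed
    qed (use C J2 in auto)
    obtain r where r: "\<And>\<xi> \<zeta>. \<xi> \<noteq> 0 \<Longrightarrow> 0 \<notin> aball a \<xi> (\<delta> * h \<xi>) \<Longrightarrow> aball a \<xi> (\<delta> * h \<xi>) \<inter> aball a 0 C \<noteq> {} \<Longrightarrow>
        \<zeta> \<in> aball a \<xi> (\<delta> * h \<xi>) \<Longrightarrow> norm \<zeta> \<le> r"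
      by (rule balls_meeting_origin_bounded[OF hybrid h_moderate \<delta> \<kappa>, where C = C]) (rule that)
    have low: "norm \<zeta> \<le> r" if k: "k \<in> J - J\<^sub>2" and \<zeta>: "\<zeta> \<in> patch k" for k \<zeta>
    proof -
      have "k \<in> J" "aball a (\<xi> k) (\<delta> * h (\<xi> k)) \<inter> aball a 0 C \<noteq> {}"
        using k J12 by (auto simp: J1 low_indices_def)
      then show ?thesis
        using r[OF centres] zero_notin_patch[of k] \<zeta> patch[of k] by auto
    qed
    show "let S = dist_sum (\<lambda>n. fourier_multiplier (\<lambda>x. (\<phi> (e n) x)\<^sup>2) f) in
      (\<exists>u\<^sub>1 \<in> tempered. \<exists>u\<^sub>2 \<in> tempered.
         limitin tempered_mod_poly_topology (\<lambda>k. mod_poly (S {- int k..< 0})) (mod_poly u\<^sub>1) sequentially \<and>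
         limitin tempered_mod_poly_topology (\<lambda>K. mod_poly (S {0..int K})) (mod_poly u\<^sub>2) sequentially \<and>
         mod_poly f = mod_poly (u\<^sub>1 \<oplus>\<^sub>D u\<^sub>2)) \<and>
      (\<exists>(P\<^sub>k :: nat \<Rightarrow> real^'n \<Rightarrow> complex) (P :: real^'n \<Rightarrow> complex). \<exists>g \<in> tempered.
         (\<forall>k\<ge>1. poly_degree_le (dist_order (dist_fourier f) + M * dist_order (dist_fourier f)) (P\<^sub>k k)) \<and>
         polynomial_function P \<and>
         limitin tempered_topology
           (\<lambda>(k, K). S {- int k..int K} \<oplus>\<^sub>D dist_of_fun (P\<^sub>k k)) g (sequentially \<times>\<^sub>F sequentially) \<and>
         f = g \<oplus>\<^sub>D dist_of_fun P)"
      unfolding Let_def \<phi>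
      by (rule decomposition[OF away low]) (use e f J12 in auto)
  qed
qed

end
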